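(* Let $n\ge1$. (1) For $(z_1,\dots,z_n)\in\mathbb{C}_\infty^n$ with $|z_i|_\infty<|\theta|_\infty^{\,i-n+nq/(q-1)}$ for $1\le i\le n$, one has $\mathrm{Log}_{\mathrm{C}^{\otimes n}}((z_1,\dots,z_n)^{\mathtt T})\equiv\vec{\mathrm{Log}}_n((z_1,\dots,z_n)^{\mathtt T})\pmod{\Lambda_n}$. (2) Let $\mathrm{Exp}_n:\mathbb{C}_\infty^n/\Lambda_n\to\mathbb{C}_\infty^n$ be the map induced by $\mathrm{Exp}_{\mathrm{C}^{\otimes n}}$. Then $\vec{\mathrm{Log}}_n$ is the inverse of $\mathrm{Exp}_n$.
   Context: Notation: $q$ a prime power, $|\theta|_\infty=q$, $\mathbb{C}_\infty$ the completion of an algebraic closure of $\mathbb{F}_q((1/\theta))$. $\mathbb{T}\subset\mathbb{C}_\infty[[t]]$ the Tate algebra; $\mathbb{T}_q$ the series converging on $|t|_\infty\le q$. Twist $(\sum a_it^i)^{(1)}=\sum a_i^qt^i$; $\wp(f)=f-f^{(1)}$ is a surjective $\mathbb{F}_q[t]$-linear map $\mathbb{T}\to\mathbb{T}$ with kernel $\mathbb{F}_q[t]$. Fix a $(q-1)$-th root of $-\theta$ and $\Omega=(-\theta)^{-q/(q-1)}\prod_{i\ge1}(1-t/\theta^{q^i})$. For $Z\in\mathbb{T}$, $\vec{\mathfrak{Li}}_n(Z)\in\mathbb{T}/\Omega^{-n}\mathbb{F}_q[t]$ is the class of $\Omega^{-n}g$ for any $g\in\mathbb{T}$ with $\wp(g)=\Omega^nZ$.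 $\tau(x)=x^q$ coordinatewise; $N$ is the $n\times n$ matrix with $1$'s on the superdiagonal, $E$ the matrix with a single $1$ at position $(n,1)$. $\mathrm{Exp}_{\mathrm{C}^{\otimes n}}=\sum_{i\ge0}\alpha_i\tau^i$ ($\alpha_0=I_n$) is the unique such $\mathbb{F}_q$-linear series with $\mathrm{Exp}\circ(\theta I_n+N)=(\theta I_n+N+E\tau)\circ\mathrm{Exp}$; it converges on $\mathbb{C}_\infty^n$ and is surjective with kernel $\Lambda_n$. $\mathrm{Log}_{\mathrm{C}^{\otimes n}}$ is the formal power series inverse to $\mathrm{Exp}_{\mathrm{C}^{\otimes n}}$; it converges on the region $|z_i|_\infty<|\theta|_\infty^{i-n+nq/(q-1)}$. $\delta_0^n:\mathbb{T}_q\to\mathbb{C}_\infty^n$ sends $f=\sum_{i\ge0}c_i(t-\theta)^i$ to $(c_{n-1},\dots,c_0)^{\mathtt T}$; it is known that $\delta_0^n(\Omega^{-n}\mathbb{F}_q[t])=\Lambda_n$ and that for $f\in\mathbb{C}_\infty[t]$ the representatives of $\vec{\mathfrak{Li}}_n(f)$ lie in $\mathbb{T}_q$. $\vec{\mathrm{Log}}_n:\mathbb{C}_\infty^n\to\mathbb{C}_\infty^n/\Lambda_n$ is defined by $\vec{\mathrm{Log}}_n((z_1,\dots,z_n)^{\mathtt T})=\delta_0^n\big(\vec{\mathfrak{Li}}_n(\sum_{k=1}^n(t-\theta)^{n-k}z_k)\big)\bmod\Lambda_n$. *)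

theory Defs
  imports
    "Jordan_Normal_Form.Matrix"
    "HOL-Algebra.Algebraic_Closure_Type"
    "HOL-Computational_Algebra.Computational_Algebra"
    "HOL-Library.Cardinality"
    "HOL-Library.Set_Algebras"
    Complex_Main
begin

text \<open>
  The type variable \<open>'f\<close> is the finite field with \<open>q\<close> elements, and \<open>'f fls\<close> is
  \<open>F_q((1/\<theta>))\<close>: the formal variable \<open>fls_X\<close> stands for \<open>1/\<theta>\<close>, so that \<open>\<theta>\<close> is \<open>fls_X_inv\<close>.
  The field \<open>C_\<infinity>\<close> is a complete ultrametric field \<open>'c\<close> together with an embedding \<open>j\<close> of
  the algebraic closure of \<open>'f fls\<close> onto a dense subfield, whose absolute value restricts to
  the \<open>1/\<theta>\<close>-adic one, normalised by \<open>|\<theta>| = q\<close>. This determines \<open>'c\<close> up to isometric isomorphism.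
\<close>

definition vabs :: "'c::{zero,metric_space} \<Rightarrow> real" where
  "vabs x = dist x 0"

locale C_infinity =
  field_hom j for j :: "'f::{finite,field} fls alg_closure \<Rightarrow> 'c::{field,complete_space}" +
  assumes dist_eq_vabs: "dist x y = vabs (x - y :: 'c)"
    and vabs_mult: "vabs (x * y :: 'c) = vabs x * vabs y"
    and vabs_add: "vabs (x + y :: 'c) \<le> max (vabs x) (vabs y)"
    and vabs_Laurent: "a \<noteq> 0 \<Longrightarrow> vabs (j (to_ac a)) = real CARD('f) powi (- fls_subdegree a)"
    and dense: "e > 0 \<Longrightarrow> \<exists>y. dist (j y) x < e"

definition qcard :: "('f::{finite,field} fls alg_closure \<Rightarrow> 'c) \<Rightarrow> nat" where
  "qcard j = CARD('f)"

definition theta :: "('f::{finite,field} fls alg_closure \<Rightarrow> 'c) \<Rightarrow> 'c" where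
  "theta j = j (to_ac fls_X_inv)"

definition Fq :: "('f::{finite,field} fls alg_closure \<Rightarrow> 'c) \<Rightarrow> 'c set" where
  "Fq j = range (\<lambda>a. j (to_ac (fls_const a)))"

definition Fq_t :: "('f::{finite,field} fls alg_closure \<Rightarrow> 'c::field) \<Rightarrow> 'c fps set" where
  "Fq_t j = {fps_of_poly p |p. \<forall>i. coeff p i \<in> Fq j}"

text \<open>The power series converging on \<open>|t| \<le> r\<close>; \<open>T\<close> is \<open>Tate 1\<close> and \<open>T_q\<close> is \<open>Tate q\<close>.\<close>

definition Tate :: "real \<Rightarrow> 'c::{field,metric_space} fps set" where
  "Tate r = {f. \<forall>x. vabs x \<le> r \<longrightarrow> summable (\<lambda>i. fps_nth f i * x ^ i)}"

definition twist :: "nat \<Rightarrow> 'c::field fps \<Rightarrow> 'c fps" where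
  "twist q f = Abs_fps (\<lambda>i. fps_nth f i ^ q)"

definition wp :: "nat \<Rightarrow> 'c::field fps \<Rightarrow> 'c fps" where
  "wp q f = f - twist q f"

text \<open>
  Here \<open>\<eta>\<close> is the chosen \<open>(q-1)\<close>-th root of \<open>-\<theta>\<close>, so \<open>(-\<theta>)^{-q/(q-1)} = \<eta>^{-q}\<close>. The infinite
  product is taken coefficientwise with respect to the topology of \<open>C_\<infinity>\<close>; the library's topology
  on formal power series is the \<open>t\<close>-adic one, in which this product does not converge.
\<close>

definition Omega ::
  "('f::{finite,field} fls alg_closure \<Rightarrow> 'c::{field,metric_space}) \<Rightarrow> 'c \<Rightarrow> 'c fps" where
  "Omega j \<eta> = Abs_fps (\<lambda>k. lim (\<lambda>m. fps_nth
     (fps_const (inverse (\<eta> ^ qcard j)) *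
       (\<Prod>i=1..m. 1 - fps_const (inverse (theta j ^ (qcard j ^ i))) * fps_X)) k))"

text \<open>
  Elements of a quotient \<open>A/L\<close> are cosets \<open>a +o L\<close>. A map given on representatives is turned
  into a map on classes by \<open>the_elem\<close> of its set of values, which is meaningful exactly
  if the value does not depend on the representative.
\<close>

definition period_module ::
  "('f::{finite,field} fls alg_closure \<Rightarrow> 'c::{field,metric_space}) \<Rightarrow> 'c \<Rightarrow> nat \<Rightarrow> 'c fps set" where
  "period_module j \<eta> n = (\<lambda>a. inverse (Omega j \<eta>) ^ n * a) ` Fq_t j"

definition Li ::
  "('f::{finite,field} fls alg_closure \<Rightarrow> 'c::{field,metric_space}) \<Rightarrow> 'c \<Rightarrow> nat \<Rightarrow>
     'c fps \<Rightarrow> 'c fps set" where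
  "Li j \<eta> n Z = the_elem ((\<lambda>g. (inverse (Omega j \<eta>) ^ n * g) +o period_module j \<eta> n) `
     {g \<in> Tate 1. wp (qcard j) g = Omega j \<eta> ^ n * Z})"

text \<open>
  Matrices and vectors are indexed from \<open>0\<close>: the entry \<open>z_i\<close> is \<open>z $ (i - 1)\<close>.
\<close>

definition N_mat :: "nat \<Rightarrow> 'c::field mat" where
  "N_mat n = mat n n (\<lambda>(r, s). if s = r + 1 then 1 else 0)"

definition E_mat :: "nat \<Rightarrow> 'c::field mat" where
  "E_mat n = mat n n (\<lambda>(r, s). if r = n - 1 \<and> s = 0 then 1 else 0)"

text \<open>
  A sequence \<open>A\<close> of \<open>n\<times>n\<close> matrices stands for the \<open>F_q\<close>-linear series \<open>\<Sum>i. A i \<tau>^i\<close>.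
  Composition is governed by \<open>\<tau>^i B = B^{(i)} \<tau>^i\<close>, where \<open>B^{(i)}\<close> has the \<open>q^i\<close>-th powers
  of the entries of \<open>B\<close>.
\<close>

definition tau_comp ::
  "nat \<Rightarrow> nat \<Rightarrow> (nat \<Rightarrow> 'c::field mat) \<Rightarrow> (nat \<Rightarrow> 'c mat) \<Rightarrow> nat \<Rightarrow> 'c mat" where
  "tau_comp q n A B k = mat n n (\<lambda>(r, s).
     \<Sum>i\<le>k. (A i * map_mat (\<lambda>x. x ^ (q ^ i)) (B (k - i))) $$ (r, s))"

definition tau_const :: "nat \<Rightarrow> 'c::field mat \<Rightarrow> nat \<Rightarrow> 'c mat" where
  "tau_const n M i = (if i = 0 then M else 0\<^sub>m n n)"

definition tau_eval ::
  "nat \<Rightarrow> nat \<Rightarrow> (nat \<Rightarrow> 'c::{field,metric_space} mat) \<Rightarrow> 'c vec \<Rightarrow> 'c vec" where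
  "tau_eval q n A z = vec n (\<lambda>r. \<Sum>i. (A i *\<^sub>v map_vec (\<lambda>x. x ^ (q ^ i)) z) $ r)"

definition d_theta :: "('f::{finite,field} fls alg_closure \<Rightarrow> 'c::field) \<Rightarrow> nat \<Rightarrow> 'c mat" where
  "d_theta j n = theta j \<cdot>\<^sub>m 1\<^sub>m n + N_mat n"

definition phi_theta ::
  "('f::{finite,field} fls alg_closure \<Rightarrow> 'c::field) \<Rightarrow> nat \<Rightarrow> nat \<Rightarrow> 'c mat" where
  "phi_theta j n i =
     (if i = 0 then d_theta j n else if i = 1 then E_mat n else 0\<^sub>m n n)"

definition Exp_series ::
  "('f::{finite,field} fls alg_closure \<Rightarrow> 'c::field) \<Rightarrow> nat \<Rightarrow> nat \<Rightarrow> 'c mat" where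
  "Exp_series j n = (THE \<alpha>. (\<forall>i. \<alpha> i \<in> carrier_mat n n) \<and> \<alpha> 0 = 1\<^sub>m n \<and>
     tau_comp (qcard j) n \<alpha> (tau_const n (d_theta j n)) =
     tau_comp (qcard j) n (phi_theta j n) \<alpha>)"

definition Log_series ::
  "('f::{finite,field} fls alg_closure \<Rightarrow> 'c::field) \<Rightarrow> nat \<Rightarrow> nat \<Rightarrow> 'c mat" where
  "Log_series j n = (THE \<beta>. (\<forall>i. \<beta> i \<in> carrier_mat n n) \<and>
     tau_comp (qcard j) n (Exp_series j n) \<beta> = tau_const n (1\<^sub>m n) \<and>
     tau_comp (qcard j) n \<beta> (Exp_series j n) = tau_const n (1\<^sub>m n))"

definition Exp_C ::
  "('f::{finite,field} fls alg_closure \<Rightarrow> 'c::{field,metric_space}) \<Rightarrow> nat \<Rightarrow> 'c vec \<Rightarrow> 'c vec" where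
  "Exp_C j n = tau_eval (qcard j) n (Exp_series j n)"

definition Log_C ::
  "('f::{finite,field} fls alg_closure \<Rightarrow> 'c::{field,metric_space}) \<Rightarrow> nat \<Rightarrow> 'c vec \<Rightarrow> 'c vec" where
  "Log_C j n = tau_eval (qcard j) n (Log_series j n)"

definition Lambda ::
  "('f::{finite,field} fls alg_closure \<Rightarrow> 'c::{field,metric_space}) \<Rightarrow> nat \<Rightarrow> 'c vec set" where
  "Lambda j n = {z \<in> carrier_vec n. Exp_C j n z = 0\<^sub>v n}"

definition quot_Lambda ::
  "('f::{finite,field} fls alg_closure \<Rightarrow> 'c::{field,metric_space}) \<Rightarrow> nat \<Rightarrow> 'c vec set set" where
  "quot_Lambda j n = (\<lambda>z. z +o Lambda j n) ` carrier_vec n"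

definition Exp_n ::
  "('f::{finite,field} fls alg_closure \<Rightarrow> 'c::{field,metric_space}) \<Rightarrow> nat \<Rightarrow> 'c vec set \<Rightarrow> 'c vec" where
  "Exp_n j n C = the_elem (Exp_C j n ` C)"

text \<open>The coefficients \<open>c\<close> of \<open>f = \<Sum>i. c i (t - \<theta>)^i\<close> on the disc \<open>|t| \<le> q\<close>, for \<open>f \<in> T_q\<close>.\<close>

definition theta_coeffs ::
  "('f::{finite,field} fls alg_closure \<Rightarrow> 'c::{field,metric_space}) \<Rightarrow> 'c fps \<Rightarrow> nat \<Rightarrow> 'c" where
  "theta_coeffs j f = (THE c. \<forall>x. vabs x \<le> real (qcard j) \<longrightarrow>
     (\<lambda>i. c i * (x - theta j) ^ i) sums (\<Sum>i. fps_nth f i * x ^ i))"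

definition delta0 ::
  "('f::{finite,field} fls alg_closure \<Rightarrow> 'c::{field,metric_space}) \<Rightarrow> nat \<Rightarrow> 'c fps \<Rightarrow> 'c vec" where
  "delta0 j n f = vec n (\<lambda>i. theta_coeffs j f (n - 1 - i))"

definition Log_n ::
  "('f::{finite,field} fls alg_closure \<Rightarrow> 'c::{field,metric_space}) \<Rightarrow> 'c \<Rightarrow> nat \<Rightarrow>
     'c vec \<Rightarrow> 'c vec set" where
  "Log_n j \<eta> n z = the_elem ((\<lambda>f. delta0 j n f +o Lambda j n) `
     Li j \<eta> n (\<Sum>k=1..n. (fps_X - fps_const (theta j)) ^ (n - k) * fps_const (z $ (k - 1))))"

end

theory Submission
  imports Defs
begin

text \<open>
  Writing \<open>g = \<Omega>^n f\<close>, the equation \<open>\<wp>(g) = \<Omega>^n Z\<close> becomes \<open>f - \<sigma>'(f) = Z\<close> with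
  \<open>\<sigma>'(f) = f^{(1)} / (t - \<theta>^q)^n\<close>, because \<open>\<Omega> = (t - \<theta>^q) \<Omega>^{(1)}\<close>. If \<open>f\<close> has small Gauss norm
  on \<open>|t| \<le> q\<close>, then \<open>f = \<Sum>i. \<sigma>'^i(Z)\<close>, and the expansions of the summands at \<open>t = \<theta>\<close> are
  exactly the terms of the logarithm series: they satisfy its functional equation, since
  multiplication by \<open>t\<close> acts on expansions as \<open>\<theta> + N\<close>. Hence the exponential of \<open>\<delta>_0(f)\<close> is \<open>z\<close>
  for small \<open>f\<close>.

  An arbitrary solution is reduced to a small one by division by \<open>t\<close>: the series
  \<open>(f - f(0) (1 - t/\<theta>)^n) / t\<close> solves the equation for a point \<open>w\<close> with \<open>\<phi>_\<theta>(w) = z\<close>, its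
  expansion at \<open>\<theta>\<close> is that of \<open>f\<close> divided by \<open>\<theta> + N\<close>, and its Gauss norm is smaller by the
  factor \<open>q\<close>. Thus the exponential maps \<open>\<delta>_0(f)\<close> to \<open>z\<close> for every solution \<open>f\<close>, so
  the class of \<open>\<delta>_0(f)\<close> modulo periods is the full fibre of the exponential over \<open>z\<close>.
\<close>

subsection \<open>Frobenius on \<open>C_\<infinity>\<close>\<close>

text \<open>Two obstacles shape the proof. The coefficients of the logarithm are expansions of
  explicit rational functions, whereas those of the exponential are known only through a recursion.
  So the logarithm is built first, the exponential is obtained as its inverse under composition, and
  the definite descriptions of both are matched by uniqueness. Secondly, the logarithm converges
  only on a bounded region and says nothing about large points; division by \<open>t\<close> takes
  over there. It works because \<open>(t - \<theta>)^n\<close> vanishes to order \<open>n\<close> at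
  \<open>\<theta>\<close>, hence is invisible to \<open>delta0\<close>, while
  \<open>inv_sigma\<close> sends it to 1: a multiple of it cancels the constant term of
  \<open>f\<close> and changes the equation only by terms that the action of \<open>t\<close>
  accounts for. The exponential intertwines \<open>\<theta> + N\<close> with that action, so the
  claim for the quotient yields the claim for \<open>f\<close>. The critical size is
  \<open>vabs \<eta> ^ (q * n)\<close>, that is \<open>q^(nq/(q-1))\<close>, the norm of
  \<open>\<Omega>^(-n)\<close>: if \<open>Z\<close> is smaller, then \<open>\<Omega>^n Z\<close> has
  norm below 1, where Artin-Schreier equations have small solutions. Since this size exceeds 1,
  descending to norm 1 is enough.\<close>

lemma finite_field_pow_card:
  fixes x :: "'a :: {finite,field}"
  shows "x ^ CARD('a) = x"
proof (cases "x = 0")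
  case False
  let ?U = "UNIV - {0 :: 'a}"
  have "bij_betw ((*) x) ?U ?U"
    using False by (intro bij_betwI[of _ _ _ "\<lambda>y. y / x"]) auto
  hence "(\<Prod>y\<in>?U. x * y) = \<Prod>?U" by (rule prod.reindex_bij_betw)
  hence "x ^ card ?U = 1" by (simp add: prod.distrib)
  moreover have "CARD('a) = Suc (card ?U)" by (subst card_Suc_Diff1) auto
  ultimately show ?thesis by (simp only: power_Suc mult_1_right)
qed simp

lemma finite_field_card_ge_2: "CARD('a :: {finite,field}) \<ge> 2"
proof -
  have "card {0, 1 :: 'a} \<le> CARD('a)" by (rule card_mono) auto
  thus ?thesis by simp
qed

text \<open>
  The polynomial \<open>(X + 1)^q - X^q - 1\<close> has degree less than \<open>q\<close> and vanishes at all \<open>q\<close> elements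
  of the field, so it is zero.
\<close>

lemma finite_field_binomial_eq_0:
  assumes "0 < k" "k < CARD('a :: {finite,field})"
  shows "(of_nat (CARD('a) choose k) :: 'a) = 0"
proof -
  let ?q = "CARD('a)"
  define p :: "'a poly" where "p = (\<Sum>k\<in>{0<..<?q}. monom (of_nat (?q choose k)) k)"
  have deg: "degree p \<le> ?q - 1"
    unfolding p_def by (rule degree_sum_le) (auto intro: order.trans[OF degree_monom_le])
  have "poly p x = 0" for x
  proof -
    have q2: "?q \<ge> 2" by (rule finite_field_card_ge_2)
    have "(x + 1) ^ ?q = (\<Sum>k\<le>?q. of_nat (?q choose k) * x ^ k)"
      by (simp add: binomial_ring)
    also have "{..?q} = insert 0 (insert ?q {0<..<?q})"
      by auto
    also have "(\<Sum>k\<in>insert 0 (insert ?q {0<..<?q}). of_nat (?q choose k) * x ^ k) = 1 + (x ^ ?q + poly p x)"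
      using q2 by (subst sum.insert) (auto simp: p_def poly_sum poly_monom)
    finally show ?thesis
      by (simp add: finite_field_pow_card)
  qed
  hence "{x. poly p x = 0} = UNIV" by auto
  have "p = 0"
  proof (rule ccontr)
    assume "p \<noteq> 0"
    hence "card {x. poly p x = 0} \<le> degree p" by (rule card_poly_roots_bound)
    thus False using deg finite_field_card_ge_2[where ?'a='a] \<open>{x. poly p x = 0} = UNIV\<close> by simp
  qed
  hence "coeff p k = 0" by simp
  also have "coeff p k = of_nat (?q choose k)"
    using assms by (simp add: p_def coeff_sum)
  finally show ?thesis .
qed

context C_infinity
begin

abbreviation q :: nat where "q \<equiv> qcard j"
abbreviation \<theta> :: 'c where "\<theta> \<equiv> theta j"

lemma q_ge_2: "q \<ge> 2"
  unfolding qcard_def by (rule finite_field_card_ge_2)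

lemma q_pos [simp]: "0 < q" using q_ge_2 by linarith

lemma embed_of_nat: "j (of_nat k) = of_nat k"
  by (induction k) (simp_all add: hom_add)

text \<open>The middle binomial coefficients vanish already in the finite field, and the embedding
  \<open>j\<close> carries this over to \<open>'c\<close>.\<close>

lemma frobenius_add: "(x + y :: 'c) ^ q = x ^ q + y ^ q"
proof -
  have 0: "of_nat (q choose k) = (0 :: 'c)" if k: "0 < k" "k < q" for k
  proof -
    have "of_nat (q choose k) = (0 :: 'f)"
      using finite_field_binomial_eq_0 k unfolding qcard_def by blast
    hence "j (to_ac (fls_const (of_nat (q choose k)))) = 0"
      by (simp only: fls_const_0 to_ac_0 hom_zero)
    thus ?thesis by (simp only: fls_of_nat [symmetric] to_ac_of_nat embed_of_nat)
  qed
  have "(x + y) ^ q = (\<Sum>k\<le>q. of_nat (q choose k) * x ^ k * y ^ (q - k))"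
    by (rule binomial_ring)
  also have "{..q} = insert 0 (insert q {0<..<q})" using q_pos by auto
  also have "(\<Sum>k\<in>\<dots>. of_nat (q choose k) * x ^ k * y ^ (q - k)) = y ^ q + x ^ q"
    using q_ge_2 by (subst sum.insert) (auto simp: 0)
  finally show ?thesis by simp
qed

lemma frobenius_minus: "(- x :: 'c) ^ q = - (x ^ q)"
proof -
  have "(-x + x) ^ q = (-x)^q + x^q" by (rule frobenius_add)
  thus ?thesis using q_pos by (simp add: eq_neg_iff_add_eq_0 power_0_left)
qed

lemma frobenius_diff: "(x - y :: 'c) ^ q = x ^ q - y ^ q"
  using frobenius_add[of x "-y"] by (simp add: frobenius_minus)

lemma frobenius_pow_add: "(x + y :: 'c) ^ (q ^ i) = x ^ (q ^ i) + y ^ (q ^ i)"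
  by (induction i arbitrary: x y) (simp_all add: power_mult frobenius_add)

lemma frobenius_pow_diff: "(x - y :: 'c) ^ (q ^ i) = x ^ (q ^ i) - y ^ (q ^ i)"
  by (induction i arbitrary: x y) (simp_all add: power_mult frobenius_diff)

lemma frobenius_pow_sum: "(sum f A :: 'c) ^ (q ^ i) = (\<Sum>x\<in>A. f x ^ (q ^ i))"
  by (induction A rule: infinite_finite_induct) (simp_all add: frobenius_pow_add power_0_left)

lemma frobenius_sum: "(sum f A :: 'c) ^ q = (\<Sum>x\<in>A. f x ^ q)"
  using frobenius_pow_sum[of f A 1] by simp

subsection \<open>Ultrametric limits and series\<close>

lemma vabs_nonneg [simp]: "0 \<le> vabs (x :: 'c)"
  by (simp add: vabs_def)

lemma vabs_eq_0_iff [simp]: "vabs (x :: 'c) = 0 \<longleftrightarrow> x = 0"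
  by (simp add: vabs_def)

lemma vabs_0 [simp]: "vabs (0 :: 'c) = 0"
  by (simp add: vabs_def)

lemma vabs_pos_iff [simp]: "0 < vabs (x :: 'c) \<longleftrightarrow> x \<noteq> 0"
  using vabs_nonneg[of x] vabs_eq_0_iff[of x] by linarith

lemma vabs_1 [simp]: "vabs (1 :: 'c) = 1"
  using vabs_mult[of 1 1] by simp

lemma vabs_power: "vabs (x ^ k :: 'c) = vabs x ^ k"
  by (induction k) (simp_all add: vabs_mult)

lemma vabs_minus [simp]: "vabs (- x :: 'c) = vabs x"
  using dist_eq_vabs[of 0 x] by (simp add: vabs_def dist_commute)

lemma vabs_diff: "vabs (x - y :: 'c) \<le> max (vabs x) (vabs y)"
  using vabs_add[of x "-y"] by simp

lemma vabs_diff_commute: "vabs (x - y :: 'c) = vabs (y - x)"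
  using vabs_minus[of "x - y"] by simp

lemma vabs_inverse: "vabs (inverse x :: 'c) = inverse (vabs x)"
proof (cases "x = 0")
  case False
  hence "vabs x * vabs (inverse x) = 1" by (simp flip: vabs_mult)
  thus ?thesis using False by (simp add: field_simps)
qed simp

lemma vabs_divide: "vabs (x / y :: 'c) = vabs x / vabs y"
  by (simp add: divide_inverse vabs_mult vabs_inverse)

lemma vabs_add_le: "vabs x \<le> M \<Longrightarrow> vabs y \<le> M \<Longrightarrow> vabs (x + y :: 'c) \<le> M"
  using vabs_add[of x y] by linarith

lemma vabs_diff_le: "vabs x \<le> M \<Longrightarrow> vabs y \<le> M \<Longrightarrow> vabs (x - y :: 'c) \<le> M"
  using vabs_diff[of x y] by linarith

lemma vabs_sum_le: "(\<And>x. x \<in> A \<Longrightarrow> vabs (f x) \<le> M) \<Longrightarrow> 0 \<le> M \<Longrightarrow> vabs (sum f A :: 'c) \<le> M"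
  by (induction A rule: infinite_finite_induct) (simp_all add: vabs_add_le)

lemma vabs_add_eq: "vabs y < vabs x \<Longrightarrow> vabs (x + y :: 'c) = vabs x"
  using vabs_add[of x y] vabs_diff[of "x + y" y] by auto

lemma vabs_theta: "vabs \<theta> = real q"
  unfolding theta_def
  by (subst vabs_Laurent) (simp_all add: qcard_def)

lemma theta_nonzero [simp]: "\<theta> \<noteq> 0"
  using vabs_theta q_pos by (metis vabs_0 of_nat_0_eq_iff less_irrefl)

lemma vabs_of_nat: "vabs (of_nat k :: 'c) \<le> 1"
  by (induction k) (simp_all add: vabs_add_le)

text \<open>The field operations of \<open>'c\<close> are tied to its metric only through
  \<open>vabs\<close>; the limit laws below are reduced to real limits by this equivalence.\<close>

lemma tendsto_iff_vabs: "(f \<longlongrightarrow> (l::'c)) F \<longleftrightarrow> ((\<lambda>x. vabs (f x - l)) \<longlongrightarrow> 0) F"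
  by (subst tendsto_dist_iff) (simp add: dist_eq_vabs)

lemma vabs_tendsto_0_iff: "((\<lambda>x. vabs (f x)) \<longlongrightarrow> 0) F \<longleftrightarrow> (f \<longlongrightarrow> (0::'c)) F"
  by (simp add: tendsto_iff_vabs)

lemma ultra_tendsto_add:
  assumes "(f \<longlongrightarrow> (l::'c)) F" "(g \<longlongrightarrow> m) F"
  shows "((\<lambda>x. f x + g x) \<longlongrightarrow> l + m) F"
proof -
  have "((\<lambda>x. max (vabs (f x - l)) (vabs (g x - m))) \<longlongrightarrow> max 0 0) F"
    using assms by (intro tendsto_max) (simp_all add: tendsto_iff_vabs)
  hence "((\<lambda>x. max (vabs (f x - l)) (vabs (g x - m))) \<longlongrightarrow> 0) F" by simp
  thus ?thesis unfolding tendsto_iff_vabs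
    by (rule tendsto_sandwich[OF _ _ tendsto_const, rotated 2])
      (use vabs_add in \<open>auto simp: add_diff_add\<close>)
qed

lemma ultra_tendsto_cmult:
  assumes "(f \<longlongrightarrow> (l::'c)) F"
  shows "((\<lambda>x. c * f x) \<longlongrightarrow> c * l) F"
  using tendsto_mult[OF tendsto_const, of "\<lambda>x. vabs (f x - l)" 0 F "vabs c"] assms
  by (simp add: tendsto_iff_vabs vabs_mult flip: right_diff_distrib)

lemma ultra_tendsto_diff:
  assumes "(f \<longlongrightarrow> (l::'c)) F" "(g \<longlongrightarrow> m) F"
  shows "((\<lambda>x. f x - g x) \<longlongrightarrow> l - m) F"
  using ultra_tendsto_add[OF assms(1) ultra_tendsto_cmult[OF assms(2), of "-1"]] by simp

lemma ultra_tendsto_sum: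
  assumes "\<And>i. i \<in> A \<Longrightarrow> (f i \<longlongrightarrow> (l i::'c)) F"
  shows "((\<lambda>x. \<Sum>i\<in>A. f i x) \<longlongrightarrow> (\<Sum>i\<in>A. l i)) F"
  using assms by (induction A rule: infinite_finite_induct) (auto intro: ultra_tendsto_add)

text \<open>By additivity a difference of \<open>q^i\<close>-th powers is the power of the
  difference, so continuity is immediate.\<close>

lemma ultra_tendsto_frobenius_pow:
  assumes "(f \<longlongrightarrow> (l::'c)) F"
  shows "((\<lambda>x. f x ^ (q ^ i)) \<longlongrightarrow> l ^ (q ^ i)) F"
  using tendsto_power[of "\<lambda>x. vabs (f x - l)" 0 F "q ^ i"] assms
  by (simp add: tendsto_iff_vabs vabs_power power_0_left flip: frobenius_pow_diff)

lemma ultra_tendsto_vabs_le: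
  assumes "(f \<longlonglongrightarrow> (l::'c))" "eventually (\<lambda>n. vabs (f n) \<le> M) sequentially"
  shows "vabs l \<le> M"
proof (rule tendsto_upperbound)
  show "(\<lambda>n. vabs (f n)) \<longlonglongrightarrow> vabs l"
    unfolding vabs_def by (intro tendsto_intros assms)
qed (use assms in auto)

text \<open>\<open>f (n + k) - f n\<close> is a sum of consecutive differences and, by the
  ultrametric inequality, is bounded by the largest of them, whatever \<open>k\<close> is.\<close>

lemma ultra_Cauchy:
  assumes "(\<lambda>n. f (Suc n) - f n) \<longlonglongrightarrow> (0::'c)"
  shows "convergent f"
proof -
  have "Cauchy f"
  proof (rule metric_CauchyI)
    fix e :: real assume e: "e > 0"
    have "(\<lambda>n. vabs (f (Suc n) - f n)) \<longlonglongrightarrow> 0"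
      using assms by (simp add: vabs_tendsto_0_iff)
    from order_tendstoD(2)[OF this e] obtain N where N: "\<And>n. n \<ge> N \<Longrightarrow> vabs (f (Suc n) - f n) < e"
      by (auto simp: eventually_sequentially)
    have *: "vabs (f (n + k) - f n) < e" if "n \<ge> N" for n k
    proof (induction k)
      case (Suc k)
      have "vabs ((f (Suc (n + k)) - f (n + k)) + (f (n + k) - f n)) \<le>
              max (vabs (f (Suc (n + k)) - f (n + k))) (vabs (f (n + k) - f n))"
        by (rule vabs_add)
      also have "\<dots> < e" using Suc N[of "n + k"] that by simp
      finally show ?case by simp
    qed (use e in simp)
    show "\<exists>M. \<forall>m\<ge>M. \<forall>n\<ge>M. dist (f m) (f n) < e"
    proof (intro exI allI impI)
      fix m n assume "m \<ge> N" "n \<ge> N"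
      thus "dist (f m) (f n) < e"
        using *[of n "m - n"] *[of m "n - m"]
        by (cases "n \<le> m") (auto simp: dist_eq_vabs vabs_diff_commute)
    qed
  qed
  thus ?thesis by (rule Cauchy_convergent)
qed

lemma ultra_summable_iff: "summable (f :: nat \<Rightarrow> 'c) \<longleftrightarrow> f \<longlonglongrightarrow> 0"
proof
  assume "summable f"
  then obtain s where s: "(\<lambda>n. \<Sum>i<n. f i) \<longlonglongrightarrow> s" by (auto simp: summable_def sums_def)
  have "(\<lambda>n. (\<Sum>i<Suc n. f i) - (\<Sum>i<n. f i)) \<longlonglongrightarrow> s - s"
    by (intro ultra_tendsto_diff s LIMSEQ_Suc)
  thus "f \<longlonglongrightarrow> 0" by simp
next
  assume "f \<longlonglongrightarrow> 0"
  hence "convergent (\<lambda>n. \<Sum>i<n. f i)" by (intro ultra_Cauchy) simp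
  thus "summable f" by (auto simp: summable_def sums_def convergent_def)
qed

lemma ultra_sums_unique:
  assumes "f sums s"
  shows "suminf f = (s :: 'c)"
  unfolding suminf_def
proof (rule the_equality, rule assms)
  show "t = s" if "f sums t" for t
    using LIMSEQ_unique[of _ t s] that assms unfolding sums_def by blast
qed

lemma ultra_summable_sums: "summable (f :: nat \<Rightarrow> 'c) \<Longrightarrow> f sums suminf f"
  using ultra_sums_unique[of f] by (auto simp: summable_def)

lemma ultra_sums_add: "f sums a \<Longrightarrow> g sums b \<Longrightarrow> (\<lambda>i. f i + g i) sums (a + b :: 'c)"
  unfolding sums_def by (simp add: sum.distrib ultra_tendsto_add)

lemma ultra_sums_diff: "f sums a \<Longrightarrow> g sums b \<Longrightarrow> (\<lambda>i. f i - g i) sums (a - b :: 'c)"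
  unfolding sums_def by (simp add: sum_subtractf ultra_tendsto_diff)

lemma ultra_sums_cmult: "f sums a \<Longrightarrow> (\<lambda>i. c * f i) sums (c * a :: 'c)"
  unfolding sums_def by (simp add: ultra_tendsto_cmult flip: sum_distrib_left)

lemma ultra_sums_sum:
  "(\<And>k. k \<in> A \<Longrightarrow> f k sums a k) \<Longrightarrow> (\<lambda>i. \<Sum>k\<in>A. f k i) sums (\<Sum>k\<in>A. a k :: 'c)"
  unfolding sums_def by (subst sum.swap) (rule ultra_tendsto_sum)

lemma ultra_sums_frobenius_pow: "f sums a \<Longrightarrow> (\<lambda>i. f i ^ (q ^ k)) sums (a ^ (q ^ k) :: 'c)"
  unfolding sums_def by (simp add: ultra_tendsto_frobenius_pow flip: frobenius_pow_sum)

lemma ultra_sums_vabs_le: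
  assumes "f sums (s :: 'c)" "\<And>i. vabs (f i) \<le> M"
  shows "vabs s \<le> M"
  using assms(1) unfolding sums_def
  by (rule ultra_tendsto_vabs_le, intro always_eventually allI vabs_sum_le)
    (use assms(2) order.trans[OF vabs_nonneg assms(2)] in auto)

lemma ultra_sums_Suc: "(\<lambda>i. f (Suc i)) sums s \<Longrightarrow> f sums (f 0 + s :: 'c)"
proof -
  assume "(\<lambda>i. f (Suc i)) sums s"
  hence "(\<lambda>n. f 0 + (\<Sum>i<n. f (Suc i))) \<longlonglongrightarrow> f 0 + s"
    unfolding sums_def by (intro ultra_tendsto_add tendsto_const)
  hence "(\<lambda>n. \<Sum>i<Suc n. f i) \<longlonglongrightarrow> f 0 + s"
    by (subst sum.lessThan_Suc_shift) simp
  thus ?thesis unfolding sums_def by (subst (asm) filterlim_sequentially_Suc)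
qed

lemma vabs_comparison_tendsto_0:
  assumes "\<And>i. vabs (f i :: 'c) \<le> b i" "b \<longlonglongrightarrow> 0"
  shows "f \<longlonglongrightarrow> 0"
proof -
  have "(\<lambda>i. vabs (f i)) \<longlonglongrightarrow> 0"
    by (rule tendsto_sandwich[OF _ _ tendsto_const assms(2)]) (use assms(1) in auto)
  thus ?thesis by (simp add: vabs_tendsto_0_iff)
qed

text \<open>The first \<open>n\<close> rows and the first \<open>n\<close> diagonals differ by row
  tails made of terms with \<open>i + k \<ge> n\<close>. All of these are bounded by the tail of
  \<open>b\<close>, and ultrametric sums do not accumulate errors.\<close>

lemma ultra_double_sums:
  fixes a :: "nat \<Rightarrow> nat \<Rightarrow> 'c"
  assumes b: "\<And>i k. vabs (a i k) \<le> b (i + k)" "b \<longlonglongrightarrow> 0"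
    and row: "\<And>i. a i sums r i"
    and diag: "(\<lambda>m. \<Sum>i\<le>m. a i (m - i)) sums s"
  shows "r sums s"
proof -
  have diff: "vabs ((\<Sum>i<n. r i) - (\<Sum>m<n. \<Sum>i\<le>m. a i (m - i))) \<le> e"
    if e: "e > 0" "\<And>m. m \<ge> n \<Longrightarrow> b m \<le> e" for n e
  proof -
    have "(\<Sum>m<n. \<Sum>i\<le>m. a i (m - i)) = (\<Sum>(i,k)\<in>{(i,k). i + k < n}. a i k)"
      by (rule sum.triangle_reindex[symmetric])
    also have "{(i,k). i + k < n} = Sigma {..<n} (\<lambda>i. {..<n - i})" by auto
    also have "(\<Sum>(i,k)\<in>\<dots>. a i k) = (\<Sum>i<n. \<Sum>k<n-i. a i k)"
      by (rule sum.Sigma[symmetric]) auto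
    finally have "(\<Sum>i<n. r i) - (\<Sum>m<n. \<Sum>i\<le>m. a i (m - i)) = (\<Sum>i<n. r i - (\<Sum>k<n-i. a i k))"
      by (simp add: sum_subtractf)
    also have "vabs \<dots> \<le> e"
    proof (rule vabs_sum_le)
      fix i assume i: "i \<in> {..<n}"
      have "(\<lambda>N. (\<Sum>k<N. a i k) - (\<Sum>k<n-i. a i k)) \<longlonglongrightarrow> r i - (\<Sum>k<n-i. a i k)"
        using row[of i] unfolding sums_def by (intro ultra_tendsto_diff tendsto_const)
      thus "vabs (r i - (\<Sum>k<n-i. a i k)) \<le> e"
      proof (rule ultra_tendsto_vabs_le)
        show "\<forall>\<^sub>F N in sequentially. vabs ((\<Sum>k<N. a i k) - (\<Sum>k<n-i. a i k)) \<le> e"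
          using eventually_ge_at_top[of "n - i"]
        proof eventually_elim
          case (elim N)
          have "(\<Sum>k<N. a i k) - (\<Sum>k<n-i. a i k) = sum (a i) ({..<N} - {..<n-i})"
            using elim by (subst sum_diff) auto
          also have "vabs \<dots> \<le> e"
          proof (rule vabs_sum_le)
            fix k assume k: "k \<in> {..<N} - {..<n-i}"
            have "vabs (a i k) \<le> b (i + k)" by (rule b)
            also have "\<dots> \<le> e" using k i by (intro e) auto
            finally show "vabs (a i k) \<le> e" .
          qed (use e in simp)
          finally show ?case .
        qed
      qed
    qed (use e in simp)
    finally show ?thesis .
  qed
  have "(\<lambda>n. (\<Sum>i<n. r i) - (\<Sum>m<n. \<Sum>i\<le>m. a i (m - i))) \<longlonglongrightarrow> 0"
  proof (rule metric_LIMSEQ_I)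
    fix e :: real assume e: "e > 0"
    then obtain N where N: "\<And>m. m \<ge> N \<Longrightarrow> b m < e / 2"
      using order_tendstoD(2)[OF b(2), of "e / 2"] by (auto simp: eventually_sequentially)
    show "\<exists>no. \<forall>n\<ge>no. dist ((\<Sum>i<n. r i) - (\<Sum>m<n. \<Sum>i\<le>m. a i (m - i))) 0 < e"
    proof (intro exI[of _ N] allI impI)
      fix n assume "n \<ge> N"
      hence "vabs ((\<Sum>i<n. r i) - (\<Sum>m<n. \<Sum>i\<le>m. a i (m - i))) \<le> e / 2"
        using e N by (intro diff) (auto intro!: less_imp_le)
      thus "dist ((\<Sum>i<n. r i) - (\<Sum>m<n. \<Sum>i\<le>m. a i (m - i))) 0 < e"
        using e by (simp add: dist_eq_vabs)
    qed
  qed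
  hence "(\<lambda>n. (\<Sum>i<n. r i) - (\<Sum>m<n. \<Sum>i\<le>m. a i (m - i)) + (\<Sum>m<n. \<Sum>i\<le>m. a i (m - i))) \<longlonglongrightarrow> 0 + s"
    using diag unfolding sums_def by (intro ultra_tendsto_add) auto
  thus ?thesis by (simp add: sums_def)
qed


lemma q_neq_0 [simp]: "q \<noteq> 0"
  using q_pos by linarith

subsection \<open>Gauss norms and Tate algebras\<close>

abbreviation Tq :: "'c fps set" where "Tq \<equiv> Tate (real q)"

text \<open>A bound on the Gauss norm for radius \<open>r\<close>, used instead of a supremum so
  that it makes sense before any convergence is known.\<close>

definition gauss_le :: "real \<Rightarrow> real \<Rightarrow> 'c fps \<Rightarrow> bool" where
  "gauss_le r b f \<longleftrightarrow> (\<forall>i. vabs (fps_nth f i) * r ^ i \<le> b)"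

lemma gauss_leD: "gauss_le r b f \<Longrightarrow> vabs (fps_nth f i) * r ^ i \<le> b"
  by (simp add: gauss_le_def)

lemma gauss_le_nonneg: "gauss_le r b f \<Longrightarrow> 0 \<le> b"
  using gauss_leD[of r b f 0] by (auto intro: order.trans[OF vabs_nonneg])

lemma gauss_le_mono: "gauss_le r b f \<Longrightarrow> b \<le> c \<Longrightarrow> gauss_le r c f"
  unfolding gauss_le_def by (meson order.trans)

lemma gauss_le_add:
  assumes "gauss_le r b f" "gauss_le r b g" "0 \<le> r"
  shows "gauss_le r b (f + g)"
  unfolding gauss_le_def
proof
  fix i
  have "vabs (fps_nth (f + g) i) * r ^ i \<le> max (vabs (fps_nth f i)) (vabs (fps_nth g i)) * r ^ i"
    using assms(3) by (intro mult_right_mono) (simp_all add: vabs_add)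
  thus "vabs (fps_nth (f + g) i) * r ^ i \<le> b"
    using gauss_leD[OF assms(1), of i] gauss_leD[OF assms(2), of i] by (auto simp: max_def split: if_splits)
qed

lemma gauss_le_minus [simp]: "gauss_le r b (- f) \<longleftrightarrow> gauss_le r b f"
  by (simp add: gauss_le_def)

lemma gauss_le_diff:
  "gauss_le r b f \<Longrightarrow> gauss_le r b g \<Longrightarrow> 0 \<le> r \<Longrightarrow> gauss_le r b (f - g)"
  using gauss_le_add[of r b f "-g"] by simp

lemma gauss_le_mult:
  assumes "gauss_le r b f" "gauss_le r c g" "0 \<le> r"
  shows "gauss_le r (b * c) (f * g)"
  unfolding gauss_le_def
proof
  fix k
  have b0: "0 \<le> b" and c0: "0 \<le> c" using assms gauss_le_nonneg by blast+
  show "vabs (fps_nth (f * g) k) * r ^ k \<le> b * c"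
  proof (cases "r = 0 \<and> k > 0")
    case False
    hence r: "r ^ k > 0" using assms(3) by (cases "r = 0") auto
    have "vabs (fps_nth (f * g) k) \<le> b * c / r ^ k"
      unfolding fps_mult_nth
    proof (rule vabs_sum_le)
      fix i assume i: "i \<in> {0..k}"
      have "vabs (fps_nth f i * fps_nth g (k - i)) * r ^ k =
              (vabs (fps_nth f i) * r ^ i) * (vabs (fps_nth g (k - i)) * r ^ (k - i))"
        using i by (simp add: vabs_mult flip: power_add)
      also have "\<dots> \<le> b * c"
        using assms b0 by (intro mult_mono gauss_leD) simp_all
      finally show "vabs (fps_nth f i * fps_nth g (k - i)) \<le> b * c / r ^ k"
        using r by (simp add: field_simps)
    qed (use b0 c0 r in simp)
    thus ?thesis using r by (simp add: field_simps)
  qed (use b0 c0 in \<open>auto simp: power_0_left\<close>)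
qed

lemma gauss_le_1 [simp]: "gauss_le r 1 1"
  by (auto simp: gauss_le_def fps_one_nth)

lemma gauss_le_power: "gauss_le r b f \<Longrightarrow> 0 \<le> r \<Longrightarrow> gauss_le r (b ^ n) (f ^ n)"
  by (induction n) (auto intro: gauss_le_mult)

lemma gauss_le_const [simp]: "gauss_le r b (fps_const c) \<longleftrightarrow> vabs c \<le> b"
  by (auto simp: gauss_le_def dest: spec[of _ 0] intro: order.trans[OF vabs_nonneg])

lemma gauss_le_X: "0 \<le> r \<Longrightarrow> r \<le> b \<Longrightarrow> gauss_le r b fps_X"
  by (auto simp: gauss_le_def fps_X_def)

text \<open>The recursion for the coefficients of the inverse expresses each one by products of
  coefficients of \<open>f\<close> with earlier ones; the bound 1 is multiplicative and stable under
  ultrametric sums, so it propagates.\<close>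

lemma gauss_le_inverse:
  assumes "gauss_le r 1 f" "fps_nth f 0 = 1" "0 \<le> r"
  shows "gauss_le r 1 (inverse f)"
  unfolding gauss_le_def
proof
  fix k
  show "vabs (fps_nth (inverse f) k) * r ^ k \<le> 1"
  proof (induction k rule: less_induct)
    case (less k)
    show ?case
    proof (cases "k = 0 \<or> r = 0")
      case False
      hence r: "r ^ k > 0" using assms(3) by simp
      have "fps_nth (f * inverse f) k = 0"
        using False assms(2) by (subst inverse_mult_eq_1') (simp_all add: fps_one_nth)
      hence "fps_nth (inverse f) k = - (\<Sum>i=1..k. fps_nth f i * fps_nth (inverse f) (k - i))"
        by (simp add: fps_mult_nth sum.atLeast_Suc_atMost assms(2) eq_neg_iff_add_eq_0)
      also have "vabs \<dots> \<le> 1 / r ^ k"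
        unfolding vabs_minus
      proof (rule vabs_sum_le)
        fix i assume i: "i \<in> {1..k}"
        have "vabs (fps_nth f i * fps_nth (inverse f) (k - i)) * r ^ k =
                (vabs (fps_nth f i) * r ^ i) * (vabs (fps_nth (inverse f) (k - i)) * r ^ (k - i))"
          using i by (simp add: vabs_mult flip: power_add)
        also have "\<dots> \<le> 1 * 1"
          using assms i by (intro mult_mono gauss_leD less.IH) auto
        finally show "vabs (fps_nth f i * fps_nth (inverse f) (k - i)) \<le> 1 / r ^ k"
          using r by (simp add: field_simps)
      qed (use r in simp)
      finally show ?thesis using r by (simp add: field_simps)
    qed (use assms(2) in \<open>auto simp: power_0_left\<close>)
  qed
qed

lemma linear_fps_inverse_eq:
  assumes "b \<noteq> (0 :: 'c)"
  shows "inverse (fps_X - fps_const b) = fps_const (- inverse b) * inverse (1 - fps_const (inverse b) * fps_X)"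
proof -
  have "fps_X - fps_const b = fps_const (- b) * (1 - fps_const (inverse b) * fps_X)"
    using assms by (simp add: algebra_simps flip: mult.assoc)
  hence "inverse (fps_X - fps_const b) = inverse (fps_const (- b)) * inverse (1 - fps_const (inverse b) * fps_X)"
    by (simp only: fps_inverse_mult)
  also have "inverse (fps_const (- b)) = fps_const (- inverse b)"
    by (subst fps_const_inverse) simp_all
  finally show ?thesis .
qed

text \<open>After taking out the factor \<open>- b\<close>, what remains to be inverted is
  \<open>1 - t/b\<close>, whose Gauss norm is at most 1 as long as the radius does not exceed
  \<open>vabs b\<close>.\<close>

lemma gauss_le_linear_inverse:
  assumes "0 \<le> r" "r \<le> vabs b" "b \<noteq> (0 :: 'c)"
  shows "gauss_le r (inverse (vabs b)) (inverse (fps_X - fps_const b))"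
proof -
  have "gauss_le r 1 (1 - fps_const (inverse b) * fps_X)"
  proof (rule gauss_le_diff)
    have "gauss_le r (inverse (vabs b) * vabs b) (fps_const (inverse b) * fps_X)"
      using assms by (intro gauss_le_mult gauss_le_X) (simp_all add: vabs_inverse)
    thus "gauss_le r 1 (fps_const (inverse b) * fps_X)" using assms by simp
  qed (use assms in simp_all)
  hence "gauss_le r 1 (inverse (1 - fps_const (inverse b) * fps_X))"
    using assms by (intro gauss_le_inverse) simp_all
  hence "gauss_le r (inverse (vabs b) * 1) (fps_const (- inverse b) * inverse (1 - fps_const (inverse b) * fps_X))"
    using assms by (intro gauss_le_mult) (simp_all add: vabs_inverse flip: fps_const_neg)
  thus ?thesis using assms by (simp add: linear_fps_inverse_eq)
qed

text \<open>A point \<open>y\<close> on the boundary of the disc turns convergence on the disc into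
  a condition on the radius alone. It is applied with \<open>1\<close> for radius 1 and with
  \<open>\<theta>\<close> for radius \<open>q\<close>.\<close>

lemma Tate_iff:
  fixes f :: "'c fps"
  assumes "vabs (y :: 'c) = r"
  shows "f \<in> Tate r \<longleftrightarrow> (\<lambda>i. vabs (fps_nth f i) * r ^ i) \<longlonglongrightarrow> 0"
proof
  assume "f \<in> Tate r"
  hence "(\<lambda>i. fps_nth f i * y ^ i) \<longlonglongrightarrow> 0"
    using assms by (auto simp: Tate_def ultra_summable_iff)
  hence "(\<lambda>i. vabs (fps_nth f i * y ^ i)) \<longlonglongrightarrow> 0" by (simp add: vabs_tendsto_0_iff)
  thus "(\<lambda>i. vabs (fps_nth f i) * r ^ i) \<longlonglongrightarrow> 0" by (simp add: vabs_mult vabs_power assms)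
next
  assume *: "(\<lambda>i. vabs (fps_nth f i) * r ^ i) \<longlonglongrightarrow> 0"
  show "f \<in> Tate r"
    unfolding Tate_def ultra_summable_iff
    by (intro CollectI allI impI vabs_comparison_tendsto_0[OF _ *])
      (auto simp: vabs_mult vabs_power intro!: mult_left_mono power_mono)
qed

lemma Tate_1_iff: "f \<in> Tate 1 \<longleftrightarrow> (\<lambda>i. fps_nth f i) \<longlonglongrightarrow> (0::'c)"
  using Tate_iff[OF vabs_1, of f] vabs_tendsto_0_iff[of "fps_nth f" sequentially] by simp

lemma Tate_q_iff: "f \<in> Tq \<longleftrightarrow> (\<lambda>i. vabs (fps_nth f i :: 'c) * real q ^ i) \<longlonglongrightarrow> 0"
  by (rule Tate_iff[OF vabs_theta])

lemma gauss_le_imp_Tate: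
  assumes "gauss_le s b f" "real q < s"
  shows "f \<in> Tq"
  unfolding Tate_q_iff
proof (rule tendsto_sandwich[OF _ _ tendsto_const])
  have s: "s > 0" using assms(2) q_pos by (meson of_nat_0_le_iff le_less_trans)
  show "(\<lambda>i. b * (real q / s) ^ i) \<longlonglongrightarrow> 0"
    using assms s by (intro tendsto_mult_right_zero LIMSEQ_power_zero) simp
  show "\<forall>\<^sub>F i in sequentially. vabs (fps_nth f i) * real q ^ i \<le> b * (real q / s) ^ i"
  proof (intro always_eventually allI)
    fix i
    have "vabs (fps_nth f i) * real q ^ i = (vabs (fps_nth f i) * s ^ i) * (real q / s) ^ i"
      using s by (simp add: power_divide)
    also have "\<dots> \<le> b * (real q / s) ^ i"
      using s by (intro mult_right_mono gauss_leD assms) simp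
    finally show "vabs (fps_nth f i) * real q ^ i \<le> b * (real q / s) ^ i" .
  qed
qed simp

lemma Tate_q_imp_gauss_le:
  assumes "f \<in> Tq"
  obtains b where "gauss_le (real q) b f"
proof -
  have "Bseq (\<lambda>i. vabs (fps_nth f i) * real q ^ i)"
    using assms by (intro convergent_imp_Bseq) (auto simp: Tate_q_iff convergent_def)
  then obtain b where "\<And>i. \<bar>vabs (fps_nth f i) * real q ^ i\<bar> \<le> b" by (auto simp: Bseq_def)
  hence "gauss_le (real q) b f" unfolding gauss_le_def by (metis abs_le_D1)
  thus ?thesis by (rule that)
qed

lemma Tate_q_imp_Tate_1:
  assumes "f \<in> Tq"
  shows "f \<in> Tate 1"
  using q_ge_2 assms unfolding Tate_def by auto

lemma Tate_q_add:
  assumes "f \<in> Tq" "g \<in> Tq"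
  shows "f + g \<in> Tq"
proof -
  have "(\<lambda>i. fps_nth f i * \<theta> ^ i + fps_nth g i * \<theta> ^ i) \<longlonglongrightarrow> 0 + 0"
    using assms by (intro ultra_tendsto_add)
      (auto simp: Tate_q_iff vabs_mult vabs_power vabs_theta simp flip: vabs_tendsto_0_iff)
  thus ?thesis
    by (simp add: Tate_q_iff vabs_mult vabs_power vabs_theta flip: vabs_tendsto_0_iff distrib_right)
qed

lemma Tate_q_minus [simp]: "- f \<in> Tq \<longleftrightarrow> f \<in> Tq"
  by (simp add: Tate_q_iff)

lemma Tate_q_diff:
  "f \<in> Tq \<Longrightarrow> g \<in> Tq \<Longrightarrow> f - g \<in> Tq"
  using Tate_q_add[of f "-g"] by simp

lemma Tate_q_mult:
  assumes "f \<in> Tq" "g \<in> Tq"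
  shows "f * g \<in> Tq"
proof -
  obtain b c where bc: "gauss_le (real q) b f" "gauss_le (real q) c g"
    using assms Tate_q_imp_gauss_le by metis
  \<comment> \<open>A common bound for both factors, kept at least 1 so that
    \<open>e / (2 * a)\<close> is a positive tolerance.\<close>
  define a where "a = max 1 (max b c)"
  have a: "gauss_le (real q) a f" "gauss_le (real q) a g" "a \<ge> 1"
    using bc by (auto simp: a_def intro: gauss_le_mono)
  show ?thesis
    unfolding Tate_q_iff
  proof (rule metric_LIMSEQ_I)
    fix e :: real assume e: "e > 0"
    have ev: "\<exists>N. \<forall>i\<ge>N. vabs (fps_nth h i) * real q ^ i < e / (2 * a)" if "h \<in> Tq" for h :: "'c fps"
      using order_tendstoD(2)[of "\<lambda>i. vabs (fps_nth h i) * real q ^ i" 0 sequentially "e / (2 * a)"]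
        that e a(3) by (auto simp: Tate_q_iff eventually_sequentially)
    obtain N1 where N1: "\<And>i. i \<ge> N1 \<Longrightarrow> vabs (fps_nth f i) * real q ^ i < e / (2 * a)"
      using ev[OF assms(1)] by blast
    obtain N2 where N2: "\<And>i. i \<ge> N2 \<Longrightarrow> vabs (fps_nth g i) * real q ^ i < e / (2 * a)"
      using ev[OF assms(2)] by blast
    show "\<exists>no. \<forall>n\<ge>no. dist (vabs (fps_nth (f * g) n) * real q ^ n) 0 < e"
    proof (intro exI[of _ "N1 + N2"] allI impI)
      fix k assume k: "k \<ge> N1 + N2"
      have r: "real q ^ k > 0" by simp
      have "vabs (fps_nth (f * g) k) \<le> e / 2 / real q ^ k"
        unfolding fps_mult_nth
      proof (rule vabs_sum_le)
        fix i assume i: "i \<in> {0..k}"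
        have "vabs (fps_nth f i * fps_nth g (k - i)) * real q ^ k =
                (vabs (fps_nth f i) * real q ^ i) * (vabs (fps_nth g (k - i)) * real q ^ (k - i))"
          using i by (simp add: vabs_mult flip: power_add)
        also have "\<dots> \<le> e / 2"
        \<comment> \<open>Since \<open>k \<ge> N1 + N2\<close>, one of the indices \<open>i\<close>
          and \<open>k - i\<close> lies in the range where its factor is small; the other factor is
          at most \<open>a\<close>.\<close>
        proof (cases "i \<ge> N1")
          case True
          have "(vabs (fps_nth f i) * real q ^ i) * (vabs (fps_nth g (k - i)) * real q ^ (k - i)) \<le> e / (2 * a) * a"
            using a e N1[OF True] by (intro mult_mono gauss_leD[OF a(2)]) simp_all
          thus ?thesis using a(3) by simp
        next
          case False
          hence "k - i \<ge> N2" using k by linarith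
          hence "(vabs (fps_nth f i) * real q ^ i) * (vabs (fps_nth g (k - i)) * real q ^ (k - i)) \<le> a * (e / (2 * a))"
            using a e N2[of "k - i"] by (intro mult_mono gauss_leD[OF a(1)]) simp_all
          thus ?thesis using a(3) by simp
        qed
        finally show "vabs (fps_nth f i * fps_nth g (k - i)) \<le> e / 2 / real q ^ k"
          using r by (simp add: field_simps)
      qed (use e in simp)
      hence "vabs (fps_nth (f * g) k) * real q ^ k \<le> e / 2"
        using r by (simp add: field_simps)
      thus "dist (vabs (fps_nth (f * g) k) * real q ^ k) 0 < e" using e by simp
    qed
  qed
qed

lemma Tate_q_const [simp]: "fps_const c \<in> Tq"
  by (rule gauss_le_imp_Tate[of "real q + 1" "vabs c"]) simp_all

lemma Tate_q_1 [simp]: "1 \<in> Tq"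
  using Tate_q_const[of 1] by simp

lemma Tate_q_X [simp]: "fps_X \<in> Tq"
  by (rule gauss_le_imp_Tate[of "real q + 1" "real q + 1"]) (simp_all add: gauss_le_X)

lemma Tate_q_power: "f \<in> Tq \<Longrightarrow> f ^ n \<in> Tq"
  by (induction n) (auto intro: Tate_q_mult)

lemma Tate_q_sum: "(\<And>x. x \<in> A \<Longrightarrow> f x \<in> Tq) \<Longrightarrow> sum f A \<in> Tq"
  using Tate_q_const[of 0] by (induction A rule: infinite_finite_induct) (auto intro: Tate_q_add)

subsection \<open>Twisting and Artin--Schreier equations\<close>

lemma twist_nth [simp]: "fps_nth (twist k f) i = fps_nth f i ^ k"
  by (simp add: twist_def)

lemma twist_add: "twist q (f + g) = twist q f + twist q (g :: 'c fps)"
  by (simp add: fps_eq_iff frobenius_add)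

lemma twist_diff: "twist q (f - g) = twist q f - twist q (g :: 'c fps)"
  by (simp add: fps_eq_iff frobenius_diff)

lemma twist_mult: "twist q (f * g) = twist q f * twist q (g :: 'c fps)"
  by (simp add: fps_eq_iff fps_mult_nth frobenius_sum power_mult_distrib)

lemma twist_const [simp]: "twist q (fps_const c) = fps_const (c ^ q :: 'c)"
  by (simp add: fps_eq_iff power_0_left)

lemma twist_1 [simp]: "twist q 1 = (1 :: 'c fps)"
  using twist_const[of 1] by simp

lemma twist_X [simp]: "twist q fps_X = (fps_X :: 'c fps)"
  by (simp add: fps_eq_iff fps_X_def power_0_left)

lemma twist_power: "twist q (f ^ n) = (twist q f :: 'c fps) ^ n"
  by (induction n) (simp_all add: twist_mult)

lemma twist_sum: "twist q (sum f A) = (\<Sum>x\<in>A. twist q (f x) :: 'c fps)"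
  by (simp add: fps_eq_iff fps_sum_nth frobenius_sum)

lemma twist_inverse:
  assumes "fps_nth f 0 \<noteq> (0 :: 'c)"
  shows "twist q (inverse f) = inverse (twist q f)"
proof -
  have "twist q (inverse f) * twist q f = 1"
    using assms by (simp add: inverse_mult_eq_1 flip: twist_mult)
  thus ?thesis by (metis fps_inverse_unique mult.commute)
qed

text \<open>The twist raises the coefficients, but not \<open>t^i\<close>, to the
  \<open>q\<close>-th power. As the radius is at least 1, the Gauss norm after twisting is at most
  the \<open>q\<close>-th power of the old one.\<close>

lemma vabs_power_q_le: "vabs (x :: 'c) ^ q * real q ^ i \<le> (vabs x * real q ^ i) ^ q"
proof -
  have "real q ^ i \<le> (real q ^ i) ^ q"
    using q_ge_2 by (intro self_le_power one_le_power) auto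
  thus ?thesis by (simp add: power_mult_distrib mult_left_mono)
qed

lemma gauss_le_twist:
  assumes "gauss_le (real q) b f"
  shows "gauss_le (real q) (b ^ q) (twist q f)"
  unfolding gauss_le_def
proof
  fix i
  have "vabs (fps_nth (twist q f) i) * real q ^ i \<le> (vabs (fps_nth f i) * real q ^ i) ^ q"
    by (simp add: vabs_power vabs_power_q_le)
  also have "\<dots> \<le> b ^ q"
    using assms by (intro power_mono gauss_leD) simp_all
  finally show "vabs (fps_nth (twist q f) i) * real q ^ i \<le> b ^ q" .
qed

lemma Tate_q_twist:
  assumes "f \<in> Tq"
  shows "twist q f \<in> Tq"
  unfolding Tate_q_iff
proof (rule tendsto_sandwich[OF _ _ tendsto_const])
  show "(\<lambda>i. (vabs (fps_nth f i) * real q ^ i) ^ q) \<longlonglongrightarrow> 0"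
    using assms by (simp add: Tate_q_iff)
qed (simp_all add: vabs_power vabs_power_q_le)


section \<open>Kernel and surjectivity of \<open>wp\<close>\<close>

lemma Fq_iff: "x \<in> Fq j \<longleftrightarrow> x ^ q = x"
proof -
  define p :: "'c poly" where "p = monom 1 q + monom (- 1) 1"
  have deg: "degree p = q"
    unfolding p_def using q_ge_2
    by (subst degree_add_eq_left) (auto simp: degree_monom_eq)
  hence p0: "p \<noteq> 0" by auto
  have roots: "{x. poly p x = 0} = {x. x ^ q = x}"
    by (auto simp: p_def poly_monom)
  \<comment> \<open>The \<open>q\<close> elements of \<open>Fq j\<close> are roots of
    \<open>X^q - X\<close>, which has at most \<open>q\<close> roots, so counting gives
    equality.\<close>
  have "Fq j = {x. x ^ q = x}"
  proof (rule card_seteq)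
    show "finite {x :: 'c. x ^ q = x}"
      using poly_roots_finite[OF p0] by (simp add: roots)
    show "Fq j \<subseteq> {x. x ^ q = x}"
    proof
      fix x assume "x \<in> Fq j"
      then obtain a where a: "x = j (to_ac (fls_const a))" by (auto simp: Fq_def)
      have "x ^ q = j (to_ac (fls_const (a ^ q)))"
        unfolding a by (simp add: hom_power fls_const_power)
      also have "a ^ q = a" unfolding qcard_def by (rule finite_field_pow_card)
      finally show "x \<in> {x. x ^ q = x}" by (simp add: a)
    qed
    have "inj (\<lambda>a. j (to_ac (fls_const a)))"
      by (intro injI) (simp, metis fls_const_nth)
    hence "card (Fq j) = q" by (simp add: Fq_def card_image qcard_def)
    thus "card {x :: 'c. x ^ q = x} \<le> card (Fq j)"
      using card_poly_roots_bound[OF p0] by (simp add: roots deg)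
  qed
  thus ?thesis by auto
qed

text \<open>A coefficient fixed by Frobenius with absolute value below 1 must be 0. Since the
  coefficients of an element of \<open>Tate 1\<close> tend to 0, only finitely many survive and the
  series is a polynomial over \<open>Fq j\<close>.\<close>

lemma wp_0_iff:
  assumes "g \<in> Tate 1"
  shows "wp q g = 0 \<longleftrightarrow> g \<in> Fq_t j"
proof
  assume "wp q g = 0"
  hence frob: "fps_nth g i ^ q = fps_nth g i" for i
    by (simp add: wp_def fps_eq_iff)
  have "\<forall>\<^sub>F i in sequentially. vabs (fps_nth g i) < 1"
    using order_tendstoD(2)[of "\<lambda>i. vabs (fps_nth g i)" 0 sequentially 1] assms
    by (simp add: Tate_1_iff vabs_tendsto_0_iff)
  then obtain N where N: "\<And>i. i \<ge> N \<Longrightarrow> vabs (fps_nth g i) < 1"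
    by (auto simp: eventually_sequentially)
  have "fps_nth g i = 0" if "i \<ge> N" for i
  proof (rule ccontr)
    assume nz: "fps_nth g i \<noteq> 0"
    have "vabs (fps_nth g i) ^ q < vabs (fps_nth g i) ^ 1"
      using N[OF that] nz q_ge_2 by (intro power_strict_decreasing) auto
    thus False using frob[of i] by (metis vabs_power power_one_right less_irrefl)
  qed
  hence "\<forall>\<^sub>\<infinity>i. fps_nth g i = 0"
    by (auto simp: MOST_nat_le)
  hence "fps_of_poly (Abs_poly (fps_nth g)) = g"
    by (simp add: fps_eq_iff Abs_poly_inverse)
  moreover have "coeff (Abs_poly (fps_nth g)) i \<in> Fq j" for i
    using \<open>\<forall>\<^sub>\<infinity>i. fps_nth g i = 0\<close> frob by (simp add: Abs_poly_inverse Fq_iff)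
  ultimately show "g \<in> Fq_t j"
    unfolding Fq_t_def by (intro CollectI exI[of _ "Abs_poly (fps_nth g)"]) auto
next
  assume "g \<in> Fq_t j"
  thus "wp q g = 0" by (auto simp: Fq_t_def wp_def fps_eq_iff Fq_iff)
qed

lemma Fq_t_in_Tate: "a \<in> Fq_t j \<Longrightarrow> a \<in> Tate 1"
proof -
  assume "a \<in> Fq_t j"
  then obtain p where p: "a = fps_of_poly p" by (auto simp: Fq_t_def)
  have "\<forall>\<^sub>F i in sequentially. fps_nth a i = 0"
    using eventually_gt_at_top[of "degree p"] by eventually_elim (simp add: p coeff_eq_0)
  thus ?thesis unfolding Tate_1_iff by (rule tendsto_eventually)
qed

text \<open>The solution is the sum of all \<open>a^(q^i)\<close>, which telescopes under
  \<open>x - x^q\<close>; its first term has the largest absolute value.\<close>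

lemma Artin_Schreier_small:
  assumes "vabs (a :: 'c) < 1"
  shows "\<exists>x. x - x ^ q = a \<and> vabs x \<le> vabs a"
proof -
  have le: "vabs (a ^ (q ^ i)) \<le> vabs a ^ (i + 1)" for i
  proof -
    have "i + 1 \<le> q ^ i"
    proof (induction i)
      case (Suc i)
      have "Suc i + 1 \<le> 2 * (i + 1)" by simp
      also have "\<dots> \<le> q * q ^ i" using Suc q_ge_2 by (intro mult_mono) auto
      finally show ?case by simp
    qed simp
    thus ?thesis using assms unfolding vabs_power by (intro power_decreasing) auto
  qed
  have "(\<lambda>i. vabs a ^ (i + 1)) \<longlonglongrightarrow> 0"
    using assms LIMSEQ_power_zero[of "vabs a", THEN LIMSEQ_Suc] by simp
  hence "(\<lambda>i. a ^ (q ^ i)) \<longlonglongrightarrow> 0"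
    using le by (rule vabs_comparison_tendsto_0[rotated])
  then obtain x where x: "(\<lambda>i. a ^ (q ^ i)) sums x"
    using ultra_summable_iff summable_def by blast
  have "(\<lambda>i. a ^ (q ^ Suc i)) sums (x ^ q)"
    using ultra_sums_frobenius_pow[OF x, of 1] by (simp add: mult.commute flip: power_mult)
  from ultra_sums_unique[OF ultra_sums_Suc[of "\<lambda>i. a ^ (q ^ i)", OF this]] have "x = a + x ^ q"
    using ultra_sums_unique[OF x] by simp
  moreover have "vabs x \<le> vabs a"
  proof (rule ultra_sums_vabs_le[OF x])
    fix i
    have "vabs a ^ (i + 1) \<le> vabs a ^ 1" using assms by (intro power_decreasing) auto
    thus "vabs (a ^ (q ^ i)) \<le> vabs a" using le[of i] by simp
  qed
  ultimately show ?thesis by (metis add_diff_cancel_right')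
qed

text \<open>By density \<open>a\<close> is an algebraic element plus an error below 1. The algebraic
  part is solved in the algebraic closure, the error by the convergent series, and additivity joins
  the two.\<close>

lemma Artin_Schreier: "\<exists>x. x - x ^ q = (a :: 'c)"
proof -
  obtain b where b: "dist (j b) a < 1" using dense[of 1 a] by auto
  define p where "p = monom 1 q + (monom (- 1) 1 + [:b:])"
  have "degree (monom (- 1) 1 + [:b:]) < q"
    using q_ge_2 by (intro le_less_trans[OF degree_add_le[of _ 1]]) (auto simp: degree_monom_le)
  hence "degree p = q"
    unfolding p_def using q_ge_2
    by (subst degree_add_eq_left) (auto simp: degree_monom_eq)
  then obtain y where "poly p y = 0"
    using alg_closed_imp_poly_has_root[of p] q_pos by metis
  hence "b = y - y ^ q" by (simp add: p_def poly_monom algebra_simps eq_neg_iff_add_eq_0)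
  hence y: "j b = j y - j y ^ q" by (simp add: hom_distribs hom_power)
  have "vabs (a - j b) < 1" using b by (simp add: dist_eq_vabs vabs_diff_commute)
  then obtain x where x: "x - x ^ q = a - j b" using Artin_Schreier_small by blast
  have "(x + j y) - (x + j y) ^ q = (x - x ^ q) + (j y - j y ^ q)" by (simp add: frobenius_add)
  also have "\<dots> = a" by (simp add: x flip: y)
  finally have "(x + j y) - (x + j y) ^ q = a" .
  thus ?thesis by blast
qed

text \<open>The equation is solved coefficient by coefficient, taking the small solution wherever
  the right-hand side is below 1; this makes the solutions tend to 0. The last conclusion keeps the
  bound available for Gauss norms.\<close>

lemma wp_surj:
  fixes h :: "'c fps"
  assumes "h \<in> Tate 1"
  obtains g where "g \<in> Tate 1" "wp q g = h"
    "\<And>i. vabs (fps_nth h i) < 1 \<Longrightarrow> vabs (fps_nth g i) \<le> vabs (fps_nth h i)"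
proof -
  have "\<exists>x. x - x ^ q = fps_nth h i \<and> (vabs (fps_nth h i) < 1 \<longrightarrow> vabs x \<le> vabs (fps_nth h i))" for i
    using Artin_Schreier[of "fps_nth h i"] Artin_Schreier_small[of "fps_nth h i"] by blast
  then obtain x where x: "\<And>i. x i - x i ^ q = fps_nth h i"
    "\<And>i. vabs (fps_nth h i) < 1 \<Longrightarrow> vabs (x i) \<le> vabs (fps_nth h i)" by metis
  have h: "(\<lambda>i. vabs (fps_nth h i)) \<longlonglongrightarrow> 0"
    using assms by (simp add: Tate_1_iff vabs_tendsto_0_iff)
  have "(\<lambda>i. vabs (x i)) \<longlonglongrightarrow> 0"
  proof (rule tendsto_sandwich[OF _ _ tendsto_const h])
    show "\<forall>\<^sub>F i in sequentially. vabs (x i) \<le> vabs (fps_nth h i)"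
      using order_tendstoD(2)[OF h, of 1] by (auto elim: eventually_mono intro: x)
  qed simp
  hence "Abs_fps x \<in> Tate 1" by (simp add: Tate_1_iff vabs_tendsto_0_iff)
  moreover have "wp q (Abs_fps x) = h" by (simp add: wp_def fps_eq_iff x)
  ultimately show ?thesis using x(2) by (intro that[of "Abs_fps x"]) simp_all
qed

text \<open>For \<open>vabs x < 1\<close> the term \<open>x\<close> dominates \<open>x^q\<close>, so
  from some index on the coefficients of \<open>g\<close> and \<open>wp q g\<close> have equal
  absolute values, and convergence on the larger disc passes back to \<open>g\<close>.\<close>

lemma wp_Tate_q:
  assumes "g \<in> Tate 1" "wp q g \<in> Tq"
  shows "g \<in> Tq"
proof -
  have "\<forall>\<^sub>F i in sequentially. vabs (fps_nth g i) < 1"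
    using order_tendstoD(2)[of "\<lambda>i. vabs (fps_nth g i)" 0 sequentially 1] assms
    by (simp add: Tate_1_iff vabs_tendsto_0_iff)
  hence "\<forall>\<^sub>F i in sequentially. vabs (fps_nth (wp q g) i) * real q ^ i = vabs (fps_nth g i) * real q ^ i"
  proof eventually_elim
    case (elim i)
    show ?case
    proof (cases "fps_nth g i = 0")
      case False
      have "vabs (fps_nth g i) ^ q < vabs (fps_nth g i) ^ 1"
        using elim False q_ge_2 by (intro power_strict_decreasing) auto
      hence "vabs (- (fps_nth g i ^ q)) < vabs (fps_nth g i)" by (simp add: vabs_power)
      from vabs_add_eq[OF this] show ?thesis by (simp add: wp_def)
    qed (simp add: wp_def)
  qed
  moreover have "(\<lambda>i. vabs (fps_nth (wp q g) i) * real q ^ i) \<longlonglongrightarrow> 0"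
    using assms(2) by (simp add: Tate_q_iff)
  ultimately show ?thesis unfolding Tate_q_iff by (rule Lim_transform_eventually[rotated])
qed

subsection \<open>The function \<open>\<Omega>\<close> and the equation for \<open>Li\<close>\<close>

definition omega_prod :: "nat \<Rightarrow> 'c fps" where
  "omega_prod m = (\<Prod>i=1..m. 1 - fps_const (inverse (\<theta> ^ (q ^ i))) * fps_X)"

text \<open>\<open>Omega\<close> without the factor \<open>inverse (\<eta> ^ q)\<close>: constant
  coefficient 1 is what the bound for the inverse series requires.\<close>

definition omega_lim :: "'c fps" where
  "omega_lim = Abs_fps (\<lambda>k. lim (\<lambda>m. fps_nth (omega_prod m) k))"

text \<open>The radius \<open>q^q\<close> is the absolute value of \<open>\<theta>^q\<close>, the
  zero of \<open>\<Omega>\<close> closest to 0. It is strictly larger than \<open>q\<close>, so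
  bounds on it put both \<open>\<Omega>\<close> and its inverse into \<open>Tq\<close>.\<close>

lemma gauss_le_omega_factor:
  assumes "i \<ge> 1"
  shows "gauss_le (real q ^ q) 1 (1 - fps_const (inverse (\<theta> ^ (q ^ i))) * fps_X)"
proof (rule gauss_le_diff)
  have "q ^ 1 \<le> q ^ i" using assms q_ge_2 by (intro power_increasing) auto
  hence *: "real q ^ q \<le> real q ^ (q ^ i)" using q_ge_2 by (intro power_increasing) auto
  have "gauss_le (real q ^ q) (inverse (real q ^ (q ^ i)) * real q ^ (q ^ i)) (fps_const (inverse (\<theta> ^ (q ^ i))) * fps_X)"
    using * by (intro gauss_le_mult gauss_le_X) (simp_all add: vabs_inverse vabs_power vabs_theta)
  thus "gauss_le (real q ^ q) 1 (fps_const (inverse (\<theta> ^ (q ^ i))) * fps_X)" by simp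
qed simp_all

lemma omega_prod_Suc:
  "omega_prod (Suc m) = omega_prod m * (1 - fps_const (inverse (\<theta> ^ (q ^ Suc m))) * fps_X)"
  by (simp add: omega_prod_def)

lemma gauss_le_omega_prod: "gauss_le (real q ^ q) 1 (omega_prod m)"
proof (induction m)
  case (Suc m)
  have "gauss_le (real q ^ q) (1 * 1) (omega_prod m * (1 - fps_const (inverse (\<theta> ^ (q ^ Suc m))) * fps_X))"
    using Suc by (intro gauss_le_mult gauss_le_omega_factor) simp_all
  thus ?case by (simp add: omega_prod_def)
qed (simp add: omega_prod_def)

lemma omega_prod_nth_0 [simp]: "fps_nth (omega_prod m) 0 = 1"
  by (induction m) (simp_all add: omega_prod_def)

lemma omega_prod_tendsto: "(\<lambda>m. fps_nth (omega_prod m) k) \<longlonglongrightarrow> fps_nth omega_lim k"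
proof -
  have "(\<lambda>m. fps_nth (omega_prod (Suc m)) k - fps_nth (omega_prod m) k) \<longlonglongrightarrow> 0"
  proof (cases k)
    case (Suc l)
    have eq: "fps_nth (omega_prod (Suc m)) k - fps_nth (omega_prod m) k =
            - (inverse (\<theta> ^ (q ^ Suc m)) * fps_nth (omega_prod m) l)" for m
      by (simp add: omega_prod_def Suc algebra_simps)
    show ?thesis unfolding eq
    proof (rule vabs_comparison_tendsto_0)
      fix m
      have "vabs (fps_nth (omega_prod m) l) * 1 \<le> vabs (fps_nth (omega_prod m) l) * (real q ^ q) ^ l"
        using q_ge_2 by (intro mult_left_mono one_le_power) auto
      also have "\<dots> \<le> 1" by (intro gauss_leD gauss_le_omega_prod)
      finally have 1: "vabs (fps_nth (omega_prod m) l) \<le> 1" by simp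
      have "m < q ^ m" using q_ge_2 by (intro power_gt_expt) auto
      also have "q ^ m \<le> q ^ Suc m" using q_ge_2 by (intro power_increasing) auto
      finally have "m \<le> q ^ Suc m" by simp
      hence "real q ^ m \<le> real q ^ (q ^ Suc m)"
        using q_ge_2 by (intro power_increasing) auto
      hence "inverse (real q ^ (q ^ Suc m)) \<le> inverse (real q ^ m)"
        by (intro le_imp_inverse_le) simp_all
      hence "inverse (real q ^ (q ^ Suc m)) * vabs (fps_nth (omega_prod m) l) \<le> inverse (real q ^ m) * 1"
        using 1 by (intro mult_mono) simp_all
      thus "vabs (- (inverse (\<theta> ^ (q ^ Suc m)) * fps_nth (omega_prod m) l)) \<le> inverse (real q) ^ m"
        by (simp add: vabs_mult vabs_inverse vabs_power vabs_theta power_inverse)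
      show "(\<lambda>m. inverse (real q) ^ m) \<longlonglongrightarrow> 0"
        using q_ge_2 by (intro LIMSEQ_power_zero) (simp add: field_simps)
    qed
  qed simp
  hence "convergent (\<lambda>m. fps_nth (omega_prod m) k)" by (rule ultra_Cauchy)
  thus ?thesis by (simp add: omega_lim_def convergent_LIMSEQ_iff)
qed

lemma omega_lim_nth_0 [simp]: "fps_nth omega_lim 0 = 1"
  using LIMSEQ_unique[OF omega_prod_tendsto[of 0], of 1] by simp

lemma gauss_le_omega_lim: "gauss_le (real q ^ q) 1 omega_lim"
  unfolding gauss_le_def
proof
  fix i
  have "vabs (fps_nth omega_lim i) \<le> 1 / (real q ^ q) ^ i"
  proof (rule ultra_tendsto_vabs_le[OF omega_prod_tendsto], intro always_eventually allI)
    fix m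
    show "vabs (fps_nth (omega_prod m) i) \<le> 1 / (real q ^ q) ^ i"
      using gauss_leD[OF gauss_le_omega_prod, of m i] by (simp add: field_simps)
  qed
  thus "vabs (fps_nth omega_lim i) * (real q ^ q) ^ i \<le> 1" by (simp add: field_simps)
qed

text \<open>Twisting moves the zero \<open>\<theta>^(q^i)\<close> to
  \<open>\<theta>^(q^(i+1))\<close>, so a twisted partial product is the next partial product
  without its first factor; the identity passes to the coefficientwise limit.\<close>

lemma omega_lim_twist: "omega_lim = (1 - fps_const (inverse (\<theta> ^ q)) * fps_X) * twist q omega_lim"
proof (rule fps_ext)
  fix k
  have prod: "omega_prod (Suc m) = (1 - fps_const (inverse (\<theta> ^ q)) * fps_X) * twist q (omega_prod m)" for m
  proof (induction m)
    case (Suc m)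
    let ?f = "\<lambda>m. 1 - fps_const (inverse (\<theta> ^ (q ^ m))) * fps_X"
    have "twist q (?f (Suc m)) = ?f (Suc (Suc m))"
      by (simp add: twist_diff twist_mult power_inverse mult.commute flip: power_mult)
    hence "twist q (omega_prod (Suc m)) = twist q (omega_prod m) * ?f (Suc (Suc m))"
      by (simp only: omega_prod_Suc twist_mult)
    thus ?case
      by (subst omega_prod_Suc, subst Suc.IH) (simp only: mult.assoc)
  qed (simp add: omega_prod_def)
  define c where "c = inverse (\<theta> ^ q)"
  have nth: "fps_nth ((1 - fps_const c * fps_X) * f) k = fps_nth f k - c * (if k = 0 then 0 else fps_nth f (k - 1))" for f
    by (simp add: algebra_simps)
  have tw: "(\<lambda>m. fps_nth (omega_prod m) i ^ q) \<longlonglongrightarrow> fps_nth omega_lim i ^ q" for i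
    using ultra_tendsto_frobenius_pow[OF omega_prod_tendsto[of i], of 1] by simp
  have "(\<lambda>m. fps_nth (omega_prod (Suc m)) k) \<longlonglongrightarrow> fps_nth omega_lim k"
    by (intro LIMSEQ_Suc omega_prod_tendsto)
  moreover have "(\<lambda>m. fps_nth (omega_prod (Suc m)) k) \<longlonglongrightarrow> fps_nth ((1 - fps_const c * fps_X) * twist q omega_lim) k"
    unfolding prod nth c_def [symmetric] by (cases "k = 0") (simp_all add: tw ultra_tendsto_diff ultra_tendsto_cmult)
  ultimately show "fps_nth omega_lim k = fps_nth ((1 - fps_const (inverse (\<theta> ^ q)) * fps_X) * twist q omega_lim) k"
    unfolding c_def [symmetric] by (rule LIMSEQ_unique)
qed

lemma Omega_eq: "Omega j \<eta> = fps_const (inverse (\<eta> ^ q)) * omega_lim"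
proof (rule fps_ext)
  fix k
  have "(\<lambda>m. inverse (\<eta> ^ q) * fps_nth (omega_prod m) k) \<longlonglongrightarrow> inverse (\<eta> ^ q) * fps_nth omega_lim k"
    by (intro ultra_tendsto_cmult omega_prod_tendsto)
  thus "fps_nth (Omega j \<eta>) k = fps_nth (fps_const (inverse (\<eta> ^ q)) * omega_lim) k"
    by (simp add: Omega_def omega_prod_def limI)
qed

lemma gauss_le_radius_mono:
  assumes "gauss_le r b f" "0 \<le> s" "s \<le> r"
  shows "gauss_le s b f"
  unfolding gauss_le_def
proof
  fix i
  have "vabs (fps_nth f i) * s ^ i \<le> vabs (fps_nth f i) * r ^ i"
    using assms by (intro mult_left_mono power_mono) simp_all
  also have "\<dots> \<le> b" by (rule gauss_leD[OF assms(1)])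
  finally show "vabs (fps_nth f i) * s ^ i \<le> b" .
qed

lemma q_less_q_power_q: "real q < real q ^ q"
  using q_ge_2 power_strict_increasing[of 1 q "real q"] by simp

lemma root_nonzero: "\<eta> ^ (q - 1) = - \<theta> \<Longrightarrow> \<eta> \<noteq> 0"
  using q_ge_2 by (auto simp: power_0_left)

lemma gauss_le_Omega: "gauss_le (real q ^ q) (inverse (vabs \<eta> ^ q)) (Omega j \<eta>)"
proof -
  have "gauss_le (real q ^ q) (inverse (vabs \<eta> ^ q) * 1) (Omega j \<eta>)"
    unfolding Omega_eq by (intro gauss_le_mult gauss_le_omega_lim) (simp_all add: vabs_inverse vabs_power)
  thus ?thesis by simp
qed

lemma gauss_le_inverse_Omega: "gauss_le (real q ^ q) (vabs \<eta> ^ q) (inverse (Omega j \<eta>))"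
proof -
  have "gauss_le (real q ^ q) (vabs \<eta> ^ q * 1) (fps_const (\<eta> ^ q) * inverse omega_lim)"
    by (intro gauss_le_mult gauss_le_inverse gauss_le_omega_lim) (simp_all add: vabs_power)
  also have "fps_const (\<eta> ^ q) * inverse omega_lim = inverse (Omega j \<eta>)"
    by (simp add: Omega_eq fps_inverse_mult fps_const_inverse)
  finally show ?thesis by simp
qed

lemma Omega_in_Tate: "Omega j \<eta> \<in> Tq"
  by (rule gauss_le_imp_Tate[OF gauss_le_Omega q_less_q_power_q])

lemma inverse_Omega_in_Tate: "inverse (Omega j \<eta>) \<in> Tq"
  by (rule gauss_le_imp_Tate[OF gauss_le_inverse_Omega q_less_q_power_q])

lemma Omega_nth_0: "fps_nth (Omega j \<eta>) 0 = inverse (\<eta> ^ q)"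
  by (simp add: Omega_eq)

text \<open>This is where the choice of the root enters: for \<open>e = \<eta>^(-q)\<close> the
  relation \<open>\<eta>^(q-1) = -\<theta>\<close> gives \<open>e = (-\<theta>)^q e^q\<close>, which
  turns the normalised factor \<open>1 - t/\<theta>^q\<close> into
  \<open>t - \<theta>^q\<close>.\<close>

lemma Omega_twist:
  assumes "\<eta> ^ (q - 1) = - \<theta>"
  shows "Omega j \<eta> = (fps_X - fps_const (\<theta> ^ q)) * twist q (Omega j \<eta>)"
proof -
  define e where "e = inverse (\<eta> ^ q)"
  define c where "c = inverse (\<theta> ^ q)"
  have nz: "\<eta> \<noteq> 0" using assms by (rule root_nonzero)
  have "e ^ q * (\<eta> ^ (q - 1)) ^ q = e"
  proof -
    have "(\<eta> ^ (q - 1)) ^ q = (\<eta> ^ q) ^ (q - 1)" by (simp add: mult.commute flip: power_mult)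
    moreover have "e ^ q = e * e ^ (q - 1)" by (metis power_eq_if q_neq_0)
    ultimately show ?thesis using nz by (simp add: e_def power_inverse)
  qed
  hence e: "e = - (\<theta> ^ q * e ^ q)" by (simp only: assms frobenius_minus) (simp add: mult.commute)
  have c: "\<theta> ^ q * c = 1" by (simp add: c_def)
  have "(fps_X - fps_const (\<theta> ^ q)) * fps_const (e ^ q) =
          fps_const (- (\<theta> ^ q * e ^ q)) * (1 - fps_const c * fps_X)"
  proof (rule fps_ext)
    fix k
    show "fps_nth ((fps_X - fps_const (\<theta> ^ q)) * fps_const (e ^ q)) k =
          fps_nth (fps_const (- (\<theta> ^ q * e ^ q)) * (1 - fps_const c * fps_X)) k"
      using c by (cases "k = 0"; cases "k = 1") (simp_all add: fps_X_def fps_one_nth mult_ac)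
  qed
  hence lin: "(fps_X - fps_const (\<theta> ^ q)) * fps_const (e ^ q) = fps_const e * (1 - fps_const c * fps_X)"
    by (simp only: e[symmetric])
  have "(fps_X - fps_const (\<theta> ^ q)) * twist q (Omega j \<eta>) =
          (fps_X - fps_const (\<theta> ^ q)) * fps_const (e ^ q) * twist q omega_lim"
    by (simp add: Omega_eq twist_mult e_def mult.assoc)
  also have "\<dots> = fps_const e * ((1 - fps_const c * fps_X) * twist q omega_lim)"
    by (simp only: lin mult.assoc)
  also have "\<dots> = fps_const e * omega_lim"
    unfolding c_def by (subst (2) omega_lim_twist) (rule refl)
  finally show ?thesis by (simp add: Omega_eq e_def)
qed

text \<open>
  In Anderson's language this is the inverse of the operator \<open>\<sigma>(f) = (t - \<theta>)^n f^{(-1)}\<close> of the dual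
  \<open>t\<close>-motive of the \<open>n\<close>-th tensor power of the Carlitz module.
\<close>

definition inv_sigma :: "nat \<Rightarrow> 'c fps \<Rightarrow> 'c fps" where
  "inv_sigma n f = inverse (fps_X - fps_const (\<theta> ^ q)) ^ n * twist q f"

text \<open>For \<open>Z\<close> in \<open>Tq\<close> this is the class
  \<open>Li j \<eta> n Z\<close>, described without reference to \<open>Omega\<close>.\<close>

definition Sol :: "nat \<Rightarrow> 'c fps \<Rightarrow> 'c fps set" where
  "Sol n Z = {f \<in> Tq. f - inv_sigma n f = Z}"

lemma wp_Omega_mult:
  assumes "\<eta> ^ (q - 1) = - \<theta>"
  shows "wp q (Omega j \<eta> ^ n * f) = Omega j \<eta> ^ n * (f - inv_sigma n f)"
proof -
  let ?l = "fps_X - fps_const (\<theta> ^ q)"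
  have 1: "inverse ?l * ?l = 1" by (rule inverse_mult_eq_1) simp
  have "inverse ?l * Omega j \<eta> = inverse ?l * (?l * twist q (Omega j \<eta>))"
    by (simp only: Omega_twist[OF assms, symmetric])
  also have "\<dots> = twist q (Omega j \<eta>)"
    by (simp only: 1 mult_1_left flip: mult.assoc)
  finally have "twist q (Omega j \<eta>) = inverse ?l * Omega j \<eta>" by (rule sym)
  hence "twist q (Omega j \<eta> ^ n * f) = Omega j \<eta> ^ n * inv_sigma n f"
    by (simp add: twist_mult twist_power inv_sigma_def power_mult_distrib mult_ac)
  thus ?thesis by (simp add: wp_def algebra_simps)
qed

lemma wp_add: "wp q (f + g) = wp q f + wp q (g :: 'c fps)"
  by (simp add: wp_def twist_add)

lemma Tate_1_add: "f \<in> Tate 1 \<Longrightarrow> g \<in> Tate 1 \<Longrightarrow> f + g \<in> (Tate 1 :: 'c fps set)"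
  using ultra_tendsto_add[of "fps_nth f" 0 sequentially "fps_nth g" 0] by (simp add: Tate_1_iff)

lemma Tate_1_diff: "f \<in> Tate 1 \<Longrightarrow> g \<in> Tate 1 \<Longrightarrow> f - g \<in> (Tate 1 :: 'c fps set)"
  using ultra_tendsto_diff[of "fps_nth f" 0 sequentially "fps_nth g" 0] by (simp add: Tate_1_iff)

lemma wp_diff: "wp q (f - g) = wp q f - wp q (g :: 'c fps)"
  by (simp add: wp_def twist_diff)

section \<open>Representatives of \<open>Li\<close> as solutions of a twisted equation\<close>

context
  fixes \<eta> :: 'c
  assumes root: "\<eta> ^ (q - 1) = - \<theta>"
begin

lemma Omega_mult_inverse: "Omega j \<eta> ^ n * inverse (Omega j \<eta>) ^ n = 1"
proof -
  have "Omega j \<eta> * inverse (Omega j \<eta>) = 1"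
    using root_nonzero[OF root] by (intro inverse_mult_eq_1') (simp add: Omega_nth_0)
  thus ?thesis by (simp flip: power_mult_distrib)
qed

text \<open>What needs an argument is convergence: \<open>g\<close> is only given in
  \<open>Tate 1\<close>, but \<open>wp q g\<close> lies in \<open>Tq\<close>, which forces
  \<open>g\<close> into \<open>Tq\<close>; multiplication by powers of \<open>\<Omega>\<close> or
  its inverse stays there.\<close>

lemma Sol_eq_image:
  assumes Z: "Z \<in> Tq"
  shows "Sol n Z = (\<lambda>g. inverse (Omega j \<eta>) ^ n * g) ` {g \<in> Tate 1. wp q g = Omega j \<eta> ^ n * Z}"
proof (intro equalityI subsetI)
  fix f assume f: "f \<in> Sol n Z"
  have "f = inverse (Omega j \<eta>) ^ n * (Omega j \<eta> ^ n * f)"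
    using Omega_mult_inverse[of n] by (metis mult.assoc mult.commute mult_1_left)
  moreover have "Omega j \<eta> ^ n * f \<in> Tate 1"
    using f by (intro Tate_q_imp_Tate_1 Tate_q_mult Tate_q_power Omega_in_Tate) (simp add: Sol_def)
  moreover have "f - inv_sigma n f = Z" using f by (simp add: Sol_def)
  ultimately show "f \<in> (\<lambda>g. inverse (Omega j \<eta>) ^ n * g) ` {g \<in> Tate 1. wp q g = Omega j \<eta> ^ n * Z}"
    by (intro image_eqI[of _ _ "Omega j \<eta> ^ n * f"]) (simp_all add: wp_Omega_mult[OF root])
next
  fix f assume "f \<in> (\<lambda>g. inverse (Omega j \<eta>) ^ n * g) ` {g \<in> Tate 1. wp q g = Omega j \<eta> ^ n * Z}"
  then obtain g where g: "f = inverse (Omega j \<eta>) ^ n * g" "g \<in> Tate 1" "wp q g = Omega j \<eta> ^ n * Z"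
    by auto
  have "wp q g \<in> Tq" unfolding g(3) by (intro Tate_q_mult Tate_q_power Omega_in_Tate Z)
  hence gT: "g \<in> Tq" by (rule wp_Tate_q[OF g(2)])
  have g_eq: "g = Omega j \<eta> ^ n * f"
    unfolding g(1) using Omega_mult_inverse[of n] by (metis mult.assoc mult_1_left)
  have "Omega j \<eta> ^ n * (f - inv_sigma n f) = Omega j \<eta> ^ n * Z"
    using g(3) unfolding g_eq wp_Omega_mult[OF root] .
  moreover have "Omega j \<eta> ^ n \<noteq> 0"
    using Omega_mult_inverse[of n] by (metis mult_zero_left zero_neq_one)
  ultimately have "f - inv_sigma n f = Z" by (metis mult_left_cancel)
  moreover have "f \<in> Tq" unfolding g(1) by (intro Tate_q_mult Tate_q_power inverse_Omega_in_Tate gT)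
  ultimately show "f \<in> Sol n Z" by (simp add: Sol_def)
qed

text \<open>The bound on \<open>b\<close> makes every coefficient of \<open>\<Omega>^n Z\<close>
  smaller than 1, so the small Artin-Schreier solutions can be taken throughout. The norm bounds for
  \<open>\<Omega>^n\<close> and its inverse are reciprocal, hence \<open>b\<close> is recovered
  without loss.\<close>

lemma Sol_small:
  assumes Z: "Z \<in> Tq" and b: "gauss_le (real q) b Z" "b < (vabs \<eta> ^ q) ^ n"
  obtains f where "f \<in> Sol n Z" "gauss_le (real q) b f"
proof -
  let ?a = "(vabs \<eta> ^ q) ^ n"
  have a: "?a > 0" using root_nonzero[OF root] by simp
  have q0: "real q \<le> real q ^ q" using q_less_q_power_q by simp
  define h where "h = Omega j \<eta> ^ n * Z"
  have h: "h \<in> Tate 1" unfolding h_def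
    by (intro Tate_q_imp_Tate_1 Tate_q_mult Tate_q_power Omega_in_Tate Z)
  have hb: "gauss_le (real q) (inverse (vabs \<eta> ^ q) ^ n * b) h"
    unfolding h_def using q0
    by (intro gauss_le_mult gauss_le_power b gauss_le_radius_mono[OF gauss_le_Omega]) simp_all
  have c: "inverse (vabs \<eta> ^ q) ^ n * b < 1"
  proof -
    have "inverse ?a * b < inverse ?a * ?a" using a b by (intro mult_strict_left_mono) simp_all
    also have "inverse ?a * ?a = 1" using a by (intro left_inverse) linarith
    finally show ?thesis by (simp only: power_inverse)
  qed
  obtain g where g: "g \<in> Tate 1" "wp q g = h"
    "\<And>i. vabs (fps_nth h i) < 1 \<Longrightarrow> vabs (fps_nth g i) \<le> vabs (fps_nth h i)"
    using wp_surj[OF h] by blast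
  have "gauss_le (real q) (inverse (vabs \<eta> ^ q) ^ n * b) g"
    unfolding gauss_le_def
  proof
    fix i
    have "vabs (fps_nth h i) * 1 \<le> vabs (fps_nth h i) * real q ^ i"
      using q_ge_2 by (intro mult_left_mono one_le_power) auto
    also note gauss_leD[OF hb, of i]
    also note c
    finally have "vabs (fps_nth g i) \<le> vabs (fps_nth h i)" by (intro g(3)) simp
    hence "vabs (fps_nth g i) * real q ^ i \<le> vabs (fps_nth h i) * real q ^ i"
      by (intro mult_right_mono) simp_all
    also note gauss_leD[OF hb, of i]
    finally show "vabs (fps_nth g i) * real q ^ i \<le> inverse (vabs \<eta> ^ q) ^ n * b" .
  qed
  hence "gauss_le (real q) (?a * (inverse (vabs \<eta> ^ q) ^ n * b)) (inverse (Omega j \<eta>) ^ n * g)"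
    using q0 by (intro gauss_le_mult gauss_le_power gauss_le_radius_mono[OF gauss_le_inverse_Omega]) simp_all
  also have "?a * (inverse (vabs \<eta> ^ q) ^ n * b) = b"
    using root_nonzero[OF root] by (simp add: power_inverse)
  finally have "gauss_le (real q) b (inverse (Omega j \<eta>) ^ n * g)" .
  moreover have "inverse (Omega j \<eta>) ^ n * g \<in> Sol n Z"
    using g by (auto simp: Sol_eq_image[OF Z] h_def)
  ultimately show ?thesis by (intro that)
qed

lemma Sol_nonempty:
  assumes Z: "Z \<in> Tq"
  shows "Sol n Z \<noteq> {}"
proof -
  have "Omega j \<eta> ^ n * Z \<in> Tate 1"
    by (intro Tate_q_imp_Tate_1 Tate_q_mult Tate_q_power Omega_in_Tate Z)
  from wp_surj[OF this] obtain g where "g \<in> Tate 1" "wp q g = Omega j \<eta> ^ n * Z"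
    by blast
  thus ?thesis by (auto simp: Sol_eq_image[OF Z])
qed

text \<open>Two choices of \<open>g\<close> differ by the kernel \<open>Fq_t j\<close> of
  \<open>wp\<close>, so each of them produces the same coset, namely the whole solution set.\<close>

lemma Li_eq_Sol:
  assumes Z: "Z \<in> Tq"
  shows "Li j \<eta> n Z = Sol n Z"
proof -
  let ?G = "{g \<in> Tate 1. wp q g = Omega j \<eta> ^ n * Z}"
  have coset: "(inverse (Omega j \<eta>) ^ n * g) +o period_module j \<eta> n = Sol n Z" if g: "g \<in> ?G" for g
  proof -
    have G: "?G = (\<lambda>a. g + a) ` Fq_t j"
    proof (intro equalityI subsetI)
      fix h assume h: "h \<in> ?G"
      have "h - g \<in> Tate 1" using g h by (intro Tate_1_diff) auto
      moreover have "wp q (h - g) = 0" using g h by (simp add: wp_diff)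
      ultimately have "h - g \<in> Fq_t j" using wp_0_iff by blast
      thus "h \<in> (\<lambda>a. g + a) ` Fq_t j" by (intro image_eqI[of _ _ "h - g"]) simp_all
    next
      fix h assume "h \<in> (\<lambda>a. g + a) ` Fq_t j"
      then obtain a where a: "h = g + a" "a \<in> Fq_t j" by auto
      have "a \<in> Tate 1" using a(2) by (rule Fq_t_in_Tate)
      moreover from this have "wp q a = 0" using a(2) wp_0_iff by blast
      ultimately show "h \<in> ?G" using g by (auto simp: a(1) wp_add intro: Tate_1_add)
    qed
    show ?thesis
      unfolding Sol_eq_image[OF Z] G period_module_def elt_set_plus_def
      by (auto simp: image_iff distrib_left)
  qed
  \<comment> \<open>A constant family over a nonempty index set has a singleton image, which is what
    gives \<open>the_elem\<close> its meaning.\<close>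
  obtain g where g: "g \<in> ?G" using Sol_nonempty[OF Z, of n] unfolding Sol_eq_image[OF Z] by blast
  have "(\<lambda>g. (inverse (Omega j \<eta>) ^ n * g) +o period_module j \<eta> n) ` ?G = (\<lambda>_. Sol n Z) ` ?G"
    by (rule image_cong[OF refl coset])
  also have "\<dots> = {Sol n Z}" using g by blast
  finally have "(\<lambda>g. (inverse (Omega j \<eta>) ^ n * g) +o period_module j \<eta> n) ` ?G = {Sol n Z}" .
  thus ?thesis by (simp add: Li_def)
qed

end


subsection \<open>Taylor expansion at \<open>\<theta>\<close>\<close>

text \<open>The \<open>k\<close>-th hyperderivative of \<open>f\<close> at \<open>\<theta>\<close>.
  Binomial coefficients take the place of a division by \<open>k!\<close>, which is impossible in
  positive characteristic.\<close>

definition taylor_coeff :: "'c fps \<Rightarrow> nat \<Rightarrow> 'c" where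
  "taylor_coeff f k = (\<Sum>l. fps_nth f (k + l) * of_nat ((k + l) choose k) * \<theta> ^ l)"

lemma taylor_term_bound:
  "vabs (fps_nth f (k + l) * of_nat ((k + l) choose k) * \<theta> ^ l) * real q ^ k \<le> vabs (fps_nth f (k + l)) * real q ^ (k + l)"
proof -
  have "vabs (fps_nth f (k + l) * of_nat ((k + l) choose k) * \<theta> ^ l) * real q ^ k =
          vabs (of_nat ((k + l) choose k) :: 'c) * (vabs (fps_nth f (k + l)) * real q ^ (k + l))"
    by (simp add: vabs_mult vabs_power vabs_theta power_add)
  also have "\<dots> \<le> 1 * (vabs (fps_nth f (k + l)) * real q ^ (k + l))"
    by (intro mult_right_mono vabs_of_nat) simp
  finally show ?thesis by simp
qed

lemma taylor_coeff_sums: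
  assumes "f \<in> Tq"
  shows "(\<lambda>l. fps_nth f (k + l) * of_nat ((k + l) choose k) * \<theta> ^ l) sums taylor_coeff f k"
proof -
  have "(\<lambda>l. fps_nth f (k + l) * of_nat ((k + l) choose k) * \<theta> ^ l) \<longlonglongrightarrow> 0"
  proof (rule vabs_comparison_tendsto_0)
    fix l
    show "vabs (fps_nth f (k + l) * of_nat ((k + l) choose k) * \<theta> ^ l)
            \<le> vabs (fps_nth f (l + k)) * real q ^ (l + k) / real q ^ k"
      using taylor_term_bound[of f k l] by (simp add: field_simps add.commute)
    have "(\<lambda>l. vabs (fps_nth f (l + k)) * real q ^ (l + k)) \<longlonglongrightarrow> 0"
      using assms unfolding Tate_q_iff by (rule LIMSEQ_ignore_initial_segment)
    from tendsto_divide[OF this tendsto_const[of "real q ^ k"]]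
    show "(\<lambda>l. vabs (fps_nth f (l + k)) * real q ^ (l + k) / real q ^ k) \<longlonglongrightarrow> 0" by simp
  qed
  thus ?thesis unfolding taylor_coeff_def by (intro ultra_summable_sums) (simp add: ultra_summable_iff)
qed

lemma taylor_coeff_bound:
  assumes "f \<in> Tq" "gauss_le (real q) b f"
  shows "vabs (taylor_coeff f k) * real q ^ k \<le> b"
proof -
  have "vabs (taylor_coeff f k) \<le> b / real q ^ k"
  proof (rule ultra_sums_vabs_le[OF taylor_coeff_sums[OF assms(1)]])
    fix l
    show "vabs (fps_nth f (k + l) * of_nat ((k + l) choose k) * \<theta> ^ l) \<le> b / real q ^ k"
      using order.trans[OF taylor_term_bound[of f k l] gauss_leD[OF assms(2)]] by (simp add: field_simps)
  qed
  thus ?thesis by (simp add: field_simps)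
qed

lemma taylor_coeff_add:
  assumes "f \<in> Tq" "g \<in> Tq"
  shows "taylor_coeff (f + g) k = taylor_coeff f k + taylor_coeff g k"
  using ultra_sums_add[OF taylor_coeff_sums[OF assms(1), of k] taylor_coeff_sums[OF assms(2), of k]]
  unfolding taylor_coeff_def[of "f + g"] by (intro ultra_sums_unique) (simp add: algebra_simps)

lemma taylor_coeff_cmult:
  assumes "f \<in> Tq"
  shows "taylor_coeff (fps_const c * f) k = c * taylor_coeff f k"
  using ultra_sums_cmult[OF taylor_coeff_sums[OF assms(1), of k], of c]
  unfolding taylor_coeff_def[of "fps_const c * f"] by (intro ultra_sums_unique) (simp add: mult_ac)

lemma taylor_coeff_diff:
  assumes "f \<in> Tq" "g \<in> Tq"
  shows "taylor_coeff (f - g) k = taylor_coeff f k - taylor_coeff g k"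
  using ultra_sums_diff[OF taylor_coeff_sums[OF assms(1), of k] taylor_coeff_sums[OF assms(2), of k]]
  unfolding taylor_coeff_def[of "f - g"] by (intro ultra_sums_unique) (simp add: algebra_simps)

lemma taylor_coeff_sum:
  assumes "\<And>x. x \<in> A \<Longrightarrow> f x \<in> Tq"
  shows "taylor_coeff (\<Sum>x\<in>A. f x) k = (\<Sum>x\<in>A. taylor_coeff (f x) k)"
  using assms
proof (induction A rule: infinite_finite_induct)
  case (insert x A)
  thus ?case by (simp add: taylor_coeff_add Tate_q_sum)
next
  case empty
  show ?case using taylor_coeff_cmult[of 0 0 k] Tate_q_const[of 0] by simp
next
  case (infinite A)
  show ?case using infinite taylor_coeff_cmult[of 0 0 k] Tate_q_const[of 0] by simp
qed

lemma taylor_coeff_X: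
  assumes "f \<in> Tq"
  shows "taylor_coeff (fps_X * f) k = \<theta> * taylor_coeff f k + (if k = 0 then 0 else taylor_coeff f (k - 1))"
proof (cases k)
  case 0
  have "(\<lambda>l. fps_nth (fps_X * f) (0 + Suc l) * of_nat ((0 + Suc l) choose 0) * \<theta> ^ Suc l) sums (\<theta> * taylor_coeff f 0)"
    using ultra_sums_cmult[OF taylor_coeff_sums[OF assms, of 0], of \<theta>] by (simp add: mult_ac)
  from ultra_sums_Suc[of "\<lambda>l. fps_nth (fps_X * f) (0 + l) * of_nat ((0 + l) choose 0) * \<theta> ^ l", OF this]
  show ?thesis
    unfolding 0 taylor_coeff_def[of "fps_X * f"] by (intro ultra_sums_unique) simp
next
  case (Suc m)
  \<comment> \<open>Pascal's rule splits the binomial coefficient of \<open>fps_X * f\<close> into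
    this part and the one for \<open>m\<close>. The term of \<open>g\<close> at 0 vanishes because
    \<open>m choose Suc m = 0\<close>, which permits the index shift.\<close>
  define g where "g = (\<lambda>l. fps_nth f (m + l) * of_nat ((m + l) choose Suc m) * \<theta> ^ l)"
  have "(\<lambda>l. g (Suc l)) sums (\<theta> * taylor_coeff f k)"
    using ultra_sums_cmult[OF taylor_coeff_sums[OF assms, of k], of \<theta>] by (simp add: mult_ac g_def Suc)
  from ultra_sums_Suc[of g, OF this] have "g sums (\<theta> * taylor_coeff f k)"
    by (simp add: g_def binomial_eq_0)
  from ultra_sums_add[OF this taylor_coeff_sums[OF assms, of m]]
  have "(\<lambda>l. fps_nth (fps_X * f) (k + l) * of_nat ((k + l) choose k) * \<theta> ^ l) sums (\<theta> * taylor_coeff f k + taylor_coeff f m)"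
    by (simp add: Suc g_def algebra_simps)
  thus ?thesis
    unfolding taylor_coeff_def[of "fps_X * f"] Suc by (intro ultra_sums_unique) simp
qed

lemma taylor_coeff_linear_mult:
  assumes "f \<in> Tq"
  shows "taylor_coeff ((fps_X - fps_const \<theta>) * f) k = (if k = 0 then 0 else taylor_coeff f (k - 1))"
proof -
  have "(fps_X - fps_const \<theta>) * f = fps_X * f - fps_const \<theta> * f" by (simp add: algebra_simps)
  thus ?thesis using assms
    by (simp add: taylor_coeff_diff taylor_coeff_X taylor_coeff_cmult Tate_q_mult)
qed

lemma ultra_sums_single: "(\<lambda>i. if i = m then c else 0) sums (c :: 'c)"
  using sums_single[of m "\<lambda>_. c"] by simp

lemma taylor_coeff_1: "taylor_coeff 1 k = (if k = 0 then 1 else 0)"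
proof -
  have "(\<lambda>l. fps_nth 1 (k + l) * of_nat ((k + l) choose k) * \<theta> ^ l) = (\<lambda>l. if l = 0 then (if k = 0 then 1 else 0) else 0)"
    by (auto simp: fun_eq_iff fps_one_nth)
  thus ?thesis
    unfolding taylor_coeff_def using ultra_sums_single[of 0 "if k = 0 then 1 else 0"]
    by (intro ultra_sums_unique) simp
qed

lemma taylor_coeff_linear_power:
  "taylor_coeff ((fps_X - fps_const \<theta>) ^ m) k = (if k = m then 1 else 0)"
proof (induction m arbitrary: k)
  case (Suc m)
  have "(fps_X - fps_const \<theta>) ^ m \<in> Tq"
    by (intro Tate_q_power Tate_q_diff Tate_q_X Tate_q_const)
  thus ?case by (auto simp: taylor_coeff_linear_mult Suc)
qed (simp add: taylor_coeff_1)

text \<open>Every point of an ultrametric disc is a centre: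
  \<open>vabs (x - \<theta>) \<le> q\<close> again, so the double series from
  \<open>x = (x - \<theta>) + \<theta>\<close> may be rearranged on the whole disc.\<close>

lemma taylor_expansion:
  assumes "f \<in> Tq" "vabs x \<le> real q"
  shows "(\<lambda>i. taylor_coeff f i * (x - \<theta>) ^ i) sums (\<Sum>i. fps_nth f i * x ^ i)"
proof -
  define a where "a = (\<lambda>i l. fps_nth f (i + l) * of_nat ((i + l) choose i) * \<theta> ^ l * (x - \<theta>) ^ i)"
  show ?thesis
  proof (rule ultra_double_sums[where a = a])
    have x: "vabs (x - \<theta>) \<le> real q" using assms(2) by (intro vabs_diff_le) (simp_all add: vabs_theta)
    fix i l
    have "vabs (a i l) = vabs (fps_nth f (i + l) * of_nat ((i + l) choose i) * \<theta> ^ l) * vabs (x - \<theta>) ^ i"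
      by (simp add: a_def vabs_mult vabs_power)
    also have "\<dots> \<le> vabs (fps_nth f (i + l) * of_nat ((i + l) choose i) * \<theta> ^ l) * real q ^ i"
      using x by (intro mult_left_mono power_mono) simp_all
    also have "\<dots> \<le> vabs (fps_nth f (i + l)) * real q ^ (i + l)" by (rule taylor_term_bound)
    finally show "vabs (a i l) \<le> vabs (fps_nth f (i + l)) * real q ^ (i + l)" .
  next
    show "(\<lambda>m. vabs (fps_nth f m) * real q ^ m) \<longlonglongrightarrow> 0" using assms(1) by (simp add: Tate_q_iff)
  next
    fix i
    show "a i sums (taylor_coeff f i * (x - \<theta>) ^ i)"
      using ultra_sums_cmult[OF taylor_coeff_sums[OF assms(1), of i], of "(x - \<theta>) ^ i"]
      by (simp add: a_def mult_ac)
  next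
    have "(\<Sum>i\<le>m. a i (m - i)) = fps_nth f m * x ^ m" for m
    proof -
      have "(\<Sum>i\<le>m. a i (m - i)) = fps_nth f m * (\<Sum>i\<le>m. of_nat (m choose i) * (x - \<theta>) ^ i * \<theta> ^ (m - i))"
        unfolding a_def sum_distrib_left by (intro sum.cong) (auto simp: mult_ac)
      also have "(\<Sum>i\<le>m. of_nat (m choose i) * (x - \<theta>) ^ i * \<theta> ^ (m - i)) = ((x - \<theta>) + \<theta>) ^ m"
        by (rule binomial_ring[symmetric])
      finally show ?thesis by simp
    qed
    moreover have "summable (\<lambda>i. fps_nth f i * x ^ i)"
      using assms by (simp add: Tate_def)
    ultimately show "(\<lambda>m. \<Sum>i\<le>m. a i (m - i)) sums (\<Sum>i. fps_nth f i * x ^ i)"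
      by (simp add: ultra_summable_sums)
  qed
qed

lemma ultra_sums_0_dominated:
  assumes "f sums (0 :: 'c)" "\<And>i. i \<noteq> m \<Longrightarrow> vabs (f i) \<le> e" "0 \<le> e"
  shows "vabs (f m) \<le> e"
proof -
  have "(\<lambda>i. f i - (if i = m then f m else 0)) sums (0 - f m)"
    by (intro ultra_sums_diff assms ultra_sums_single)
  hence "vabs (0 - f m) \<le> e"
    by (rule ultra_sums_vabs_le) (use assms in auto)
  thus ?thesis by simp
qed

text \<open>With the lower coefficients already zero, the term of degree \<open>m\<close> is the
  negative of the sum of the higher ones, which is of order \<open>y^(m+1)\<close>. Letting
  \<open>y\<close> tend to 0 leaves no room for \<open>d m\<close>.\<close>

lemma power_series_eq_0:
  assumes "\<And>y. vabs y \<le> real q \<Longrightarrow> (\<lambda>i. d i * y ^ i) sums (0 :: 'c)"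
  shows "d m = 0"
proof (induction m rule: less_induct)
  case (less m)
  have "summable (\<lambda>i. d i * \<theta> ^ i)" using assms[of \<theta>] by (auto simp: summable_def vabs_theta)
  hence "Abs_fps d \<in> Tq"
    by (simp add: Tate_q_iff ultra_summable_iff vabs_mult vabs_power vabs_theta flip: vabs_tendsto_0_iff)
  then obtain b where b: "gauss_le (real q) b (Abs_fps d)" by (rule Tate_q_imp_gauss_le)
  hence b0: "b \<ge> 0" by (rule gauss_le_nonneg)
  have d: "vabs (d i) \<le> b / real q ^ i" for i
    using gauss_leD[OF b, of i] by (simp add: field_simps)
  have "vabs (d m) \<le> b * inverse (real q) ^ k" for k
  proof -
    \<comment> \<open>Powers of \<open>1/\<theta>\<close> serve as nonzero test points of
      arbitrarily small absolute value.\<close>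
    define y where "y = inverse \<theta> ^ k"
    have y: "vabs y = inverse (real q) ^ k" by (simp add: y_def vabs_power vabs_inverse vabs_theta)
    have y1: "vabs y \<le> 1" unfolding y using q_ge_2 by (intro power_le_one) (auto simp: field_simps)
    have y0: "vabs y > 0" by (simp add: y_def)
    have "vabs (d m * y ^ m) \<le> b * vabs y ^ Suc m"
    proof (rule ultra_sums_0_dominated[where f = "\<lambda>i. d i * y ^ i"])
      show "(\<lambda>i. d i * y ^ i) sums 0"
        using y1 q_ge_2 by (intro assms) linarith
      fix i assume "i \<noteq> m"
      show "vabs (d i * y ^ i) \<le> b * vabs y ^ Suc m"
      proof (cases "i < m")
        case True
        thus ?thesis using less b0 by simp
      next
        case False
        have "vabs (d i) \<le> b / 1"
          using q_ge_2 by (intro order.trans[OF d] divide_left_mono b0 one_le_power) auto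
        moreover have "vabs y ^ i \<le> vabs y ^ Suc m"
          using False \<open>i \<noteq> m\<close> y1 by (intro power_decreasing) auto
        ultimately show ?thesis using b0 unfolding vabs_mult vabs_power by (intro mult_mono) auto
      qed
    qed (use b0 in simp)
    hence "vabs (d m) * vabs y ^ m \<le> (b * vabs y) * vabs y ^ m"
      by (simp add: vabs_mult vabs_power mult_ac)
    thus ?thesis using y0 unfolding y by (subst (asm) mult_le_cancel_right_pos) simp_all
  qed
  moreover have "(\<lambda>k. b * inverse (real q) ^ k) \<longlonglongrightarrow> 0"
    using q_ge_2 by (intro tendsto_mult_right_zero LIMSEQ_power_zero) (simp add: field_simps)
  ultimately have "vabs (d m) \<le> 0" by (intro tendsto_lowerbound[of _ 0]) auto
  thus "d m = 0" using vabs_eq_0_iff[of "d m"] vabs_nonneg[of "d m"] by linarith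
qed

lemma theta_coeffs_eq:
  assumes "f \<in> Tq"
  shows "theta_coeffs j f = taylor_coeff f"
  unfolding theta_coeffs_def
proof (rule the_equality)
  show "\<forall>x. vabs x \<le> real q \<longrightarrow> (\<lambda>i. taylor_coeff f i * (x - \<theta>) ^ i) sums (\<Sum>i. fps_nth f i * x ^ i)"
    using taylor_expansion[OF assms] by blast
next
  fix c assume c: "\<forall>x. vabs x \<le> real q \<longrightarrow> (\<lambda>i. c i * (x - \<theta>) ^ i) sums (\<Sum>i. fps_nth f i * x ^ i)"
  have "c m - taylor_coeff f m = 0" for m
  proof (rule power_series_eq_0)
    fix y :: 'c assume y: "vabs y \<le> real q"
    have x: "vabs (y + \<theta>) \<le> real q" using y by (intro vabs_add_le) (simp_all add: vabs_theta)
    from ultra_sums_diff[OF c[rule_format, OF x] taylor_expansion[OF assms x]]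
    show "(\<lambda>i. (c i - taylor_coeff f i) * y ^ i) sums 0" by (simp add: algebra_simps)
  qed
  thus "c = taylor_coeff f" by (auto simp: fun_eq_iff)
qed

lemma delta0_eq: "f \<in> Tq \<Longrightarrow> delta0 j n f = vec n (\<lambda>i. taylor_coeff f (n - 1 - i))"
  by (simp add: delta0_def theta_coeffs_eq)

end

subsection \<open>Twisted power series with matrix coefficients\<close>

text \<open>Solves the coefficient of \<open>\<tau>^k\<close> in \<open>A B = 1\<close> for
  \<open>A k\<close>, on the understanding that \<open>B\<close> starts with the identity
  matrix.\<close>

function tau_inverse :: "nat \<Rightarrow> nat \<Rightarrow> (nat \<Rightarrow> 'c::field mat) \<Rightarrow> nat \<Rightarrow> 'c mat" where
  "tau_inverse q n B k = mat n n (\<lambda>(r, s). if k = 0 then if r = s then 1 else 0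
     else - (\<Sum>i<k. \<Sum>u<n. tau_inverse q n B i $$ (r, u) * (B (k - i) $$ (u, s)) ^ (q ^ i)))"
  by auto
termination by (relation "measure (\<lambda>(q, n, B, k). k)") auto

declare tau_inverse.simps [simp del]

context C_infinity
begin

definition tau_series :: "nat \<Rightarrow> (nat \<Rightarrow> 'c mat) set" where
  "tau_series n = {A. \<forall>i. A i \<in> carrier_mat n n}"

lemma tau_series_carrier: "A \<in> tau_series n \<Longrightarrow> A i \<in> carrier_mat n n"
  by (simp add: tau_series_def)

lemma tau_comp_in_tau_series [simp]: "tau_comp q n A B \<in> tau_series n"
  by (simp add: tau_series_def tau_comp_def)

lemma tau_const_in_tau_series [simp]: "M \<in> carrier_mat n n \<Longrightarrow> tau_const n M \<in> tau_series n"
  by (simp add: tau_series_def tau_const_def)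

lemma tau_comp_index:
  assumes "A \<in> tau_series n" "B \<in> tau_series n" "r < n" "s < n"
  shows "tau_comp q n A B k $$ (r, s) = (\<Sum>i\<le>k. \<Sum>u<n. A i $$ (r, u) * (B (k - i) $$ (u, s)) ^ (q ^ i))"
proof -
  have "(A i * map_mat f (B m)) $$ (r, s) = (\<Sum>u<n. A i $$ (r, u) * f (B m $$ (u, s)))" for i m f
  proof -
    have AB: "A i \<in> carrier_mat n n" "B m \<in> carrier_mat n n" using assms by (auto dest: tau_series_carrier)
    thus ?thesis
      using assms(3,4) by (auto simp: scalar_prod_def atLeast0LessThan intro!: sum.cong)
  qed
  thus ?thesis using assms(3,4) by (simp add: tau_comp_def)
qed

lemma tau_series_eqI:
  assumes "A \<in> tau_series n" "B \<in> tau_series n" "\<And>k r s. r < n \<Longrightarrow> s < n \<Longrightarrow> A k $$ (r, s) = B k $$ (r, s)"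
  shows "A = B"
proof (intro ext eq_matI)
  fix k i l assume "i < dim_row (B k)" "l < dim_col (B k)"
  thus "A k $$ (i, l) = B k $$ (i, l)" using tau_series_carrier[OF assms(2), of k] by (intro assms(3)) auto
next
  fix k show "dim_row (A k) = dim_row (B k)" "dim_col (A k) = dim_col (B k)"
    using tau_series_carrier[OF assms(1), of k] tau_series_carrier[OF assms(2), of k] by auto
qed

text \<open>Additivity of the \<open>q^i\<close>-th power lets it pass through the inner matrix
  product; the remaining reindexing is the one for triple Cauchy products.\<close>

lemma tau_comp_assoc:
  assumes "A \<in> tau_series n" "B \<in> tau_series n" "C \<in> tau_series n"
  shows "tau_comp q n (tau_comp q n A B) C = tau_comp q n A (tau_comp q n B C)"
proof (rule tau_series_eqI)
  fix k r s assume rs: "r < n" "s < n"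
  define F where "F = (\<lambda>i l m. \<Sum>v<n. \<Sum>u<n. A i $$ (r, v) * B l $$ (v, u) ^ (q ^ i) * C m $$ (u, s) ^ (q ^ (i + l)))"
  have "tau_comp q n (tau_comp q n A B) C k $$ (r, s) = (\<Sum>m=0..k. \<Sum>i=0..m. F i (m - i) (k - m))"
  proof -
    have "(\<Sum>u<n. tau_comp q n A B m $$ (r, u) * (C (k - m) $$ (u, s)) ^ (q ^ m)) = (\<Sum>i=0..m. F i (m - i) (k - m))" for m
    proof -
      have "(\<Sum>u<n. tau_comp q n A B m $$ (r, u) * (C (k - m) $$ (u, s)) ^ (q ^ m)) =
        (\<Sum>u<n. \<Sum>i=0..m. \<Sum>v<n. A i $$ (r, v) * (B (m - i) $$ (v, u)) ^ (q ^ i) * (C (k - m) $$ (u, s)) ^ (q ^ m))"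
        using rs assms by (intro sum.cong) (simp_all add: tau_comp_index sum_distrib_right atLeast0AtMost)
      also have "\<dots> = (\<Sum>i=0..m. \<Sum>u<n. \<Sum>v<n. A i $$ (r, v) * (B (m - i) $$ (v, u)) ^ (q ^ i) * (C (k - m) $$ (u, s)) ^ (q ^ m))"
        by (rule sum.swap)
      also have "\<dots> = (\<Sum>i=0..m. \<Sum>v<n. \<Sum>u<n. A i $$ (r, v) * (B (m - i) $$ (v, u)) ^ (q ^ i) * (C (k - m) $$ (u, s)) ^ (q ^ m))"
        by (intro sum.cong[OF refl] sum.swap)
      also have "\<dots> = (\<Sum>i=0..m. F i (m - i) (k - m))"
        unfolding F_def by (intro sum.cong) auto
      finally show ?thesis .
    qed
    thus ?thesis using rs assms by (subst tau_comp_index) (simp_all add: atLeast0AtMost)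
  qed
  also have "\<dots> = (\<Sum>i=0..k. \<Sum>l=0..k - i. F i l (k - i - l))"
    by (rule fps_mult_assoc_lemma)
  also have "\<dots> = tau_comp q n A (tau_comp q n B C) k $$ (r, s)"
  proof -
    have "(\<Sum>v<n. A i $$ (r, v) * (tau_comp q n B C (k - i) $$ (v, s)) ^ (q ^ i)) = (\<Sum>l=0..k - i. F i l (k - i - l))" for i
    proof -
      have "(\<Sum>v<n. A i $$ (r, v) * (tau_comp q n B C (k - i) $$ (v, s)) ^ (q ^ i)) =
        (\<Sum>v<n. \<Sum>l=0..k - i. \<Sum>u<n. A i $$ (r, v) * B l $$ (v, u) ^ (q ^ i) * C (k - i - l) $$ (u, s) ^ (q ^ (i + l)))"
        using rs assms
        by (intro sum.cong) (simp_all add: tau_comp_index frobenius_pow_sum sum_distrib_left atLeast0AtMost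
          power_mult_distrib power_add mult.assoc mult.commute[of "q ^ i"] flip: power_mult)
      also have "\<dots> = (\<Sum>l=0..k - i. F i l (k - i - l))"
        unfolding F_def by (rule sum.swap)
      finally show ?thesis .
    qed
    thus ?thesis using rs assms by (subst tau_comp_index) (simp_all add: atLeast0AtMost)
  qed
  finally show "tau_comp q n (tau_comp q n A B) C k $$ (r, s) = tau_comp q n A (tau_comp q n B C) k $$ (r, s)" .
qed simp_all

lemma tau_comp_const_left:
  assumes "B \<in> tau_series n" "M \<in> carrier_mat n n" "r < n" "s < n"
  shows "tau_comp q n (tau_const n M) B k $$ (r, s) = (\<Sum>u<n. M $$ (r, u) * B k $$ (u, s))"
proof -
  have "tau_comp q n (tau_const n M) B k $$ (r, s) =
     (\<Sum>i\<le>k. \<Sum>u<n. tau_const n M i $$ (r, u) * B (k - i) $$ (u, s) ^ (q ^ i))"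
    using assms by (intro tau_comp_index) simp_all
  also have "\<dots> = (\<Sum>i\<le>k. if i = 0 then (\<Sum>u<n. M $$ (r, u) * B k $$ (u, s)) else 0)"
    using assms by (intro sum.cong[OF refl, of "{..k}"]) (auto simp: tau_const_def)
  also have "\<dots> = (\<Sum>u<n. M $$ (r, u) * B k $$ (u, s))" by simp
  finally show ?thesis .
qed

lemma tau_comp_const_right:
  assumes "A \<in> tau_series n" "M \<in> carrier_mat n n" "r < n" "s < n"
  shows "tau_comp q n A (tau_const n M) k $$ (r, s) = (\<Sum>u<n. A k $$ (r, u) * M $$ (u, s) ^ (q ^ k))"
proof -
  have "tau_comp q n A (tau_const n M) k $$ (r, s) =
     (\<Sum>i\<le>k. \<Sum>u<n. A i $$ (r, u) * tau_const n M (k - i) $$ (u, s) ^ (q ^ i))"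
    using assms by (intro tau_comp_index) simp_all
  also have "\<dots> = (\<Sum>i\<le>k. if i = k then (\<Sum>u<n. A k $$ (r, u) * M $$ (u, s) ^ (q ^ k)) else 0)"
    using assms by (intro sum.cong[OF refl, of "{..k}"]) (auto simp: tau_const_def power_0_left)
  also have "\<dots> = (\<Sum>u<n. A k $$ (r, u) * M $$ (u, s) ^ (q ^ k))" by simp
  finally show ?thesis .
qed

lemma one_mat_sum_left:
  assumes "r < n"
  shows "(\<Sum>u<n. 1\<^sub>m n $$ (r, u) * f u) = (f r :: 'c)"
proof -
  have "(\<Sum>u<n. 1\<^sub>m n $$ (r, u) * f u) = (\<Sum>u<n. if u = r then f r else 0)"
    using assms by (intro sum.cong) auto
  thus ?thesis using assms by simp
qed

lemma one_mat_sum_right: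
  assumes "s < n"
  shows "(\<Sum>u<n. f u * 1\<^sub>m n $$ (u, s) ^ (q ^ k)) = (f s :: 'c)"
proof -
  have "(\<Sum>u<n. f u * 1\<^sub>m n $$ (u, s) ^ (q ^ k)) = (\<Sum>u<n. if u = s then f s else 0)"
    using assms by (intro sum.cong) (auto simp: power_0_left)
  thus ?thesis using assms by simp
qed

lemma tau_comp_one_left:
  assumes "A \<in> tau_series n"
  shows "tau_comp q n (tau_const n (1\<^sub>m n)) A = A"
proof (rule tau_series_eqI)
  fix k r s assume rs: "r < n" "s < n"
  show "tau_comp q n (tau_const n (1\<^sub>m n)) A k $$ (r, s) = A k $$ (r, s)"
    by (rule trans[OF tau_comp_const_left[OF assms one_carrier_mat rs] one_mat_sum_left[OF rs(1)]])
qed (use assms in simp_all)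

lemma tau_comp_one_right:
  assumes "A \<in> tau_series n"
  shows "tau_comp q n A (tau_const n (1\<^sub>m n)) = A"
proof (rule tau_series_eqI)
  fix k r s assume rs: "r < n" "s < n"
  show "tau_comp q n A (tau_const n (1\<^sub>m n)) k $$ (r, s) = A k $$ (r, s)"
    by (rule trans[OF tau_comp_const_right[OF assms one_carrier_mat rs] one_mat_sum_right[OF rs(2)]])
qed (use assms in simp_all)

lemma tau_inverse_in_tau_series [simp]: "tau_inverse q n B \<in> tau_series n"
  unfolding tau_series_def by (intro CollectI allI, subst tau_inverse.simps) simp

lemma tau_inverse_0 [simp]: "tau_inverse k n B 0 = 1\<^sub>m n"
  by (subst tau_inverse.simps) (auto intro!: eq_matI)

lemma tau_inverse_left:
  assumes "B \<in> tau_series n" "B 0 = 1\<^sub>m n"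
  shows "tau_comp q n (tau_inverse q n B) B = tau_const n (1\<^sub>m n)"
proof (rule tau_series_eqI)
  fix k r s assume rs: "r < n" "s < n"
  let ?A = "tau_inverse q n B"
  have last: "(\<Sum>u<n. ?A k $$ (r, u) * (B 0 $$ (u, s)) ^ (q ^ k)) = ?A k $$ (r, s)"
    unfolding assms(2) by (rule one_mat_sum_right[OF rs(2)])
  have "tau_comp q n ?A B k $$ (r, s) =
      (\<Sum>i<k. \<Sum>u<n. ?A i $$ (r, u) * (B (k - i) $$ (u, s)) ^ (q ^ i)) + ?A k $$ (r, s)"
    using rs assms(1) by (simp add: tau_comp_index last flip: lessThan_Suc_atMost)
  also have "\<dots> = (if k = 0 then 1\<^sub>m n $$ (r, s) else 0)"
    using rs by (subst (2) tau_inverse.simps) simp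
  also have "\<dots> = tau_const n (1\<^sub>m n) k $$ (r, s)" using rs by (simp add: tau_const_def)
  finally show "tau_comp q n ?A B k $$ (r, s) = tau_const n (1\<^sub>m n) k $$ (r, s)" .
qed (use assms in simp_all)

text \<open>The left inverse of \<open>B\<close> has a left inverse of its own, and by associativity
  that one must be \<open>B\<close>.\<close>

lemma tau_inverse_right:
  assumes "B \<in> tau_series n" "B 0 = 1\<^sub>m n"
  shows "tau_comp q n B (tau_inverse q n B) = tau_const n (1\<^sub>m n)"
proof -
  let ?A = "tau_inverse q n B"
  let ?C = "tau_inverse q n ?A"
  have AB: "tau_comp q n ?A B = tau_const n (1\<^sub>m n)" by (rule tau_inverse_left[OF assms])
  have CA: "tau_comp q n ?C ?A = tau_const n (1\<^sub>m n)" by (rule tau_inverse_left) simp_all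
  have "?C = tau_comp q n ?C (tau_comp q n ?A B)"
    by (simp only: AB tau_comp_one_right[OF tau_inverse_in_tau_series])
  also have "\<dots> = tau_comp q n (tau_comp q n ?C ?A) B"
    by (rule tau_comp_assoc[symmetric]) (use assms in simp_all)
  also have "\<dots> = B" by (simp only: CA tau_comp_one_left[OF assms(1)])
  finally show ?thesis using CA by simp
qed

section \<open>Evaluation of twisted series at vectors\<close>

definition tau_term :: "nat \<Rightarrow> (nat \<Rightarrow> 'c mat) \<Rightarrow> 'c vec \<Rightarrow> nat \<Rightarrow> nat \<Rightarrow> 'c" where
  "tau_term n A z r i = (\<Sum>s<n. A i $$ (r, s) * z $ s ^ (q ^ i))"

lemma tau_eval_eq:
  assumes "A \<in> tau_series n" "z \<in> carrier_vec n"
  shows "tau_eval q n A z = vec n (\<lambda>r. suminf (tau_term n A z r))"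
proof -
  have "(A i *\<^sub>v map_vec (\<lambda>x. x ^ (q ^ i)) z) $ r = tau_term n A z r i" if "r < n" for r i
  proof -
    have "A i \<in> carrier_mat n n" using assms(1) by (rule tau_series_carrier)
    thus ?thesis
      using assms(2) that by (auto simp: tau_term_def scalar_prod_def atLeast0LessThan intro!: sum.cong)
  qed
  thus ?thesis unfolding tau_eval_def by (intro eq_vecI) simp_all
qed

lemma tau_eval_carrier [simp]: "tau_eval k n A z \<in> carrier_vec n"
  by (simp add: tau_eval_def)

lemma tau_eval_eqI:
  fixes w :: "'c vec"
  assumes "A \<in> tau_series n" "z \<in> carrier_vec n" "w \<in> carrier_vec n" "\<And>r. r < n \<Longrightarrow> tau_term n A z r sums (w $ r)"
  shows "tau_eval q n A z = w"
  using assms by (intro eq_vecI) (auto simp: tau_eval_eq intro!: ultra_sums_unique)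

lemma tau_eval_sums:
  assumes "A \<in> tau_series n" "z \<in> carrier_vec n" "r < n" "tau_term n A z r \<longlonglongrightarrow> 0"
  shows "tau_term n A z r sums (tau_eval q n A z $ r)"
  using assms ultra_summable_sums[of "tau_term n A z r"] by (simp add: tau_eval_eq ultra_summable_iff)

text \<open>A double series whose rows are the terms of \<open>A\<close> at the value of
  \<open>B\<close> and whose diagonals are the terms of the composition. Domination by a null
  sequence in \<open>i + k\<close> yields convergence of the outer series and of the composition as
  well.\<close>

lemma tau_eval_comp:
  fixes z :: "'c vec"
  assumes A: "A \<in> tau_series n" and B: "B \<in> tau_series n" and z: "z \<in> carrier_vec n"
    and bound: "\<And>i k r u s. r < n \<Longrightarrow> u < n \<Longrightarrow> s < n \<Longrightarrow>
      vabs (A i $$ (r, u) * (B k $$ (u, s) * z $ s ^ (q ^ k)) ^ (q ^ i)) \<le> b (i + k)"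
    and b: "b \<longlonglongrightarrow> 0"
    and inner: "\<And>u. u < n \<Longrightarrow> tau_term n B z u \<longlonglongrightarrow> 0"
  shows "tau_eval q n A (tau_eval q n B z) = tau_eval q n (tau_comp q n A B) z"
proof (rule tau_eval_eqI[OF A])
  fix r assume r: "r < n"
  let ?w = "tau_eval q n B z"
  define a where "a = (\<lambda>i k. \<Sum>u<n. A i $$ (r, u) * tau_term n B z u k ^ (q ^ i))"
  have a_alt: "a i k = (\<Sum>u<n. \<Sum>s<n. A i $$ (r, u) * (B k $$ (u, s) * z $ s ^ (q ^ k)) ^ (q ^ i))" for i k
    by (simp add: a_def tau_term_def frobenius_pow_sum sum_distrib_left)
  have bound': "vabs (a i k) \<le> b (i + k)" for i k
    unfolding a_alt using order.trans[OF vabs_nonneg bound[OF r r r]] r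
    by (intro vabs_sum_le bound) auto
  have diag: "(\<Sum>i\<le>m. a i (m - i)) = tau_term n (tau_comp q n A B) z r m" for m
  proof -
    have "(\<Sum>i\<le>m. a i (m - i)) = (\<Sum>i\<le>m. \<Sum>s<n. \<Sum>u<n. A i $$ (r, u) * B (m - i) $$ (u, s) ^ (q ^ i) * z $ s ^ (q ^ m))"
      unfolding a_alt
    proof (rule sum.cong[OF refl])
      fix i assume "i \<in> {..m}"
      hence "(B (m - i) $$ (u, s) * z $ s ^ (q ^ (m - i))) ^ (q ^ i) = B (m - i) $$ (u, s) ^ (q ^ i) * z $ s ^ (q ^ m)" for u s
        by (simp add: power_mult_distrib flip: power_mult power_add)
      thus "(\<Sum>u<n. \<Sum>s<n. A i $$ (r, u) * (B (m - i) $$ (u, s) * z $ s ^ (q ^ (m - i))) ^ (q ^ i)) =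
          (\<Sum>s<n. \<Sum>u<n. A i $$ (r, u) * B (m - i) $$ (u, s) ^ (q ^ i) * z $ s ^ (q ^ m))"
        by (subst sum.swap) (simp add: mult.assoc)
    qed
    also have "\<dots> = (\<Sum>s<n. \<Sum>i\<le>m. \<Sum>u<n. A i $$ (r, u) * B (m - i) $$ (u, s) ^ (q ^ i) * z $ s ^ (q ^ m))"
      by (rule sum.swap)
    also have "\<dots> = tau_term n (tau_comp q n A B) z r m"
      unfolding tau_term_def using A B r by (intro sum.cong) (simp_all add: tau_comp_index sum_distrib_right)
    finally show ?thesis .
  qed
  have "tau_term n (tau_comp q n A B) z r \<longlonglongrightarrow> 0"
  proof (rule vabs_comparison_tendsto_0[OF _ b])
    fix m
    show "vabs (tau_term n (tau_comp q n A B) z r m) \<le> b m"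
      unfolding diag[symmetric]
    proof (rule vabs_sum_le)
      fix i assume "i \<in> {..m}"
      thus "vabs (a i (m - i)) \<le> b m" using bound'[of i "m - i"] by simp
    qed (use order.trans[OF vabs_nonneg bound'[of 0 m]] in simp)
  qed
  hence "tau_term n (tau_comp q n A B) z r sums (tau_eval q n (tau_comp q n A B) z $ r)"
    by (intro tau_eval_sums z r tau_comp_in_tau_series)
  hence sums: "(\<lambda>m. \<Sum>i\<le>m. a i (m - i)) sums (tau_eval q n (tau_comp q n A B) z $ r)"
    by (simp add: diag)
  have row: "a i sums (tau_term n A ?w r i)" for i
    unfolding a_def tau_term_def[of n A]
  proof (rule ultra_sums_sum)
    fix u assume "u \<in> {..<n}"
    hence "tau_term n B z u sums (?w $ u)" by (intro tau_eval_sums B z inner) simp_all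
    from ultra_sums_cmult[OF ultra_sums_frobenius_pow[OF this]]
    show "(\<lambda>k. A i $$ (r, u) * tau_term n B z u k ^ (q ^ i)) sums (A i $$ (r, u) * ?w $ u ^ (q ^ i))" .
  qed
  show "tau_term n A ?w r sums (tau_eval q n (tau_comp q n A B) z $ r)"
    by (rule ultra_double_sums[OF bound' b row sums])
qed simp_all

lemma tau_eval_const:
  fixes z :: "'c vec"
  assumes "M \<in> carrier_mat n n" "z \<in> carrier_vec n"
  shows "tau_eval q n (tau_const n M) z = M *\<^sub>v z"
proof (rule tau_eval_eqI)
  fix r assume r: "r < n"
  have "tau_term n (tau_const n M) z r = (\<lambda>i. if i = 0 then (M *\<^sub>v z) $ r else 0)"
  proof
    fix i
    show "tau_term n (tau_const n M) z r i = (if i = 0 then (M *\<^sub>v z) $ r else 0)"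
      using r assms by (auto simp: tau_term_def tau_const_def scalar_prod_def atLeast0LessThan intro!: sum.cong)
  qed
  thus "tau_term n (tau_const n M) z r sums ((M *\<^sub>v z) $ r)"
    using sums_single[of 0 "\<lambda>_. (M *\<^sub>v z) $ r"] by simp
qed (use assms in simp_all)


subsection \<open>The coefficients of the logarithm and the exponential\<close>

definition pi_prod :: "nat \<Rightarrow> 'c fps" where
  "pi_prod i = (\<Prod>l=1..i. inverse (fps_X - fps_const (\<theta> ^ (q ^ l))))"

text \<open>The \<open>i\<close>-th iterate of \<open>inv_sigma\<close> on
  \<open>(t - \<theta>)^(n-1-s)\<close>, the polynomial of the \<open>s\<close>-th unit vector, in
  closed form.\<close>

definition log_col :: "nat \<Rightarrow> nat \<Rightarrow> nat \<Rightarrow> 'c fps" where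
  "log_col n i s = (fps_X - fps_const (\<theta> ^ (q ^ i))) ^ (n - 1 - s) * pi_prod i ^ n"

definition log_mat :: "nat \<Rightarrow> nat \<Rightarrow> 'c mat" where
  "log_mat n i = mat n n (\<lambda>(r, s). taylor_coeff (log_col n i s) (n - 1 - r))"

lemma pi_prod_0 [simp]: "pi_prod 0 = 1"
  by (simp add: pi_prod_def)

lemma pi_prod_Suc: "pi_prod (Suc i) = pi_prod i * inverse (fps_X - fps_const (\<theta> ^ (q ^ Suc i)))"
  by (simp add: pi_prod_def)

lemma Tate_q_linear [simp]: "fps_X - fps_const c \<in> Tq"
  by (intro Tate_q_diff Tate_q_X Tate_q_const)

lemma Tate_q_linear_inverse:
  assumes "l \<ge> 1"
  shows "inverse (fps_X - fps_const (\<theta> ^ (q ^ l))) \<in> Tq"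
proof (rule gauss_le_imp_Tate[OF _ q_less_q_power_q])
  have "q ^ 1 \<le> q ^ l" using assms q_ge_2 by (intro power_increasing) auto
  hence "real q ^ q \<le> real q ^ (q ^ l)" using q_ge_2 by (intro power_increasing) auto
  thus "gauss_le (real q ^ q) (inverse (vabs (\<theta> ^ (q ^ l)))) (inverse (fps_X - fps_const (\<theta> ^ (q ^ l))))"
    by (intro gauss_le_linear_inverse) (simp_all add: vabs_power vabs_theta)
qed

lemma gauss_le_linear_inverse_theta:
  "gauss_le (real q) (inverse (real q ^ (q ^ l))) (inverse (fps_X - fps_const (\<theta> ^ (q ^ l))))"
proof -
  have "real q ^ 1 \<le> real q ^ (q ^ l)" using q_ge_2 by (intro power_increasing) auto
  hence "gauss_le (real q) (inverse (vabs (\<theta> ^ (q ^ l)))) (inverse (fps_X - fps_const (\<theta> ^ (q ^ l))))"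
    by (intro gauss_le_linear_inverse) (simp_all add: vabs_power vabs_theta)
  thus ?thesis by (simp add: vabs_power vabs_theta)
qed

lemma pi_prod_in_Tate [simp]: "pi_prod i \<in> Tq"
proof (induction i)
  case (Suc i)
  thus ?case unfolding pi_prod_Suc by (intro Tate_q_mult Tate_q_linear_inverse) simp_all
qed simp

lemma log_col_in_Tate [simp]: "log_col n i s \<in> Tq"
  unfolding log_col_def by (intro Tate_q_mult Tate_q_power pi_prod_in_Tate Tate_q_linear)

lemma gauss_le_pi_prod_1: "gauss_le (real q) 1 (pi_prod i)"
proof (induction i)
  case (Suc i)
  have "inverse (real q ^ (q ^ Suc i)) \<le> 1"
    using q_ge_2 one_le_power[of "real q" "q ^ Suc i"] by (simp add: field_simps)
  hence "gauss_le (real q) 1 (inverse (fps_X - fps_const (\<theta> ^ (q ^ Suc i))))"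
    using gauss_le_linear_inverse_theta gauss_le_mono by blast
  from gauss_le_mult[OF Suc this] show ?case by (simp add: pi_prod_Suc)
qed simp

lemma gauss_le_pi_prod:
  assumes "i \<ge> 1"
  shows "gauss_le (real q) (inverse (real q ^ (q ^ i))) (pi_prod i)"
proof -
  obtain m where m: "i = Suc m" using assms by (cases i) auto
  have "gauss_le (real q) (1 * inverse (real q ^ (q ^ i))) (pi_prod i)"
    unfolding m pi_prod_Suc by (intro gauss_le_mult gauss_le_pi_prod_1 gauss_le_linear_inverse_theta) simp
  thus ?thesis by simp
qed

text \<open>Only the last factor of \<open>pi_prod\<close> is exploited, the others having norm at
  most 1. With \<open>c = q^(q^i)\<close> the exponents combine to \<open>c^(-(s+1))\<close>, which
  is at most \<open>inverse c\<close>.\<close>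

lemma gauss_le_log_col:
  assumes "i \<ge> 1" "s < n"
  shows "gauss_le (real q) (inverse (real q ^ (q ^ i))) (log_col n i s)"
proof -
  define c where "c = real q ^ (q ^ i)"
  have c: "c \<ge> 1" unfolding c_def using q_ge_2 by (intro one_le_power) auto
  have "real q ^ 1 \<le> real q ^ (q ^ i)" using q_ge_2 by (intro power_increasing) auto
  hence "gauss_le (real q) c (fps_X - fps_const (\<theta> ^ (q ^ i)))"
    by (intro gauss_le_diff gauss_le_X) (simp_all add: vabs_power vabs_theta c_def)
  hence "gauss_le (real q) (c ^ (n - 1 - s) * inverse c ^ n) (log_col n i s)"
    unfolding log_col_def using gauss_le_pi_prod[OF assms(1)]
    by (intro gauss_le_mult gauss_le_power) (simp_all add: c_def)
  moreover have "c ^ (n - 1 - s) * inverse c ^ n \<le> inverse c"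
  proof -
    have n: "n = (n - 1 - s) + Suc s" using assms by simp
    have "c ^ (n - 1 - s) * inverse c ^ n = (c ^ (n - 1 - s) * inverse c ^ (n - 1 - s)) * inverse c ^ Suc s"
      by (subst (2) n) (simp only: power_add mult.assoc)
    also have "\<dots> = inverse c ^ Suc s"
      using c by (simp flip: power_mult_distrib)
    also have "\<dots> \<le> inverse c ^ 1"
      using c by (intro power_decreasing) (auto simp: field_simps)
    finally show ?thesis by simp
  qed
  ultimately show ?thesis unfolding c_def by (rule gauss_le_mono)
qed

lemma log_mat_in_tau_series [simp]: "log_mat n \<in> tau_series n"
  by (simp add: tau_series_def log_mat_def)

lemma log_mat_index: "r < n \<Longrightarrow> s < n \<Longrightarrow> log_mat n i $$ (r, s) = taylor_coeff (log_col n i s) (n - 1 - r)"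
  by (simp add: log_mat_def)

lemma log_mat_bound:
  assumes "i \<ge> 1" "r < n" "s < n"
  shows "vabs (log_mat n i $$ (r, s)) \<le> inverse (real q ^ (q ^ i))"
proof -
  have "vabs (log_mat n i $$ (r, s)) * 1 \<le> vabs (log_mat n i $$ (r, s)) * real q ^ (n - 1 - r)"
    using q_ge_2 by (intro mult_left_mono one_le_power) auto
  also have "\<dots> \<le> inverse (real q ^ (q ^ i))"
    using assms by (simp add: log_mat_index taylor_coeff_bound gauss_le_log_col del: power_inverse)
  finally show ?thesis by simp
qed

lemma log_mat_0: "log_mat n 0 = 1\<^sub>m n"
  by (rule eq_matI) (auto simp: log_mat_def log_col_def taylor_coeff_linear_power)

text \<open>Write \<open>t = \<theta>^(q^i) + (t - \<theta>^(q^i))\<close>. The second summand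
  raises the exponent and moves column \<open>s\<close> to \<open>s - 1\<close>. For
  \<open>s = 0\<close> the full \<open>n\<close>-th power cancels the last factor of
  \<open>pi_prod i ^ n\<close> and leaves the last column of level \<open>i - 1\<close>; at level 0
  there is nothing to cancel.\<close>

lemma log_col_X:
  assumes "n \<ge> 1" "s < n"
  shows "fps_X * log_col n i s = fps_const (\<theta> ^ (q ^ i)) * log_col n i s +
    (if s = 0 then if i = 0 then (fps_X - fps_const \<theta>) ^ n else log_col n (i - 1) (n - 1) else log_col n i (s - 1))"
proof -
  let ?l = "fps_X - fps_const (\<theta> ^ (q ^ i))"
  have "fps_X * log_col n i s = fps_const (\<theta> ^ (q ^ i)) * log_col n i s + ?l * log_col n i s"
    by (simp add: algebra_simps)
  also have "?l * log_col n i s = ?l ^ (n - s) * pi_prod i ^ n"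
  proof -
    have "n - s = Suc (n - 1 - s)" using assms by simp
    thus ?thesis by (simp only: log_col_def power_Suc mult.assoc)
  qed
  also have "\<dots> = (if s = 0 then if i = 0 then (fps_X - fps_const \<theta>) ^ n else log_col n (i - 1) (n - 1) else log_col n i (s - 1))"
  proof (cases "s = 0")
    case True
    show ?thesis
    proof (cases i)
      case (Suc m)
      have "?l * pi_prod i = pi_prod m * (inverse ?l * ?l)"
        by (simp add: Suc pi_prod_Suc mult_ac)
      also have "inverse ?l * ?l = 1" by (rule inverse_mult_eq_1) simp
      finally have "(?l * pi_prod i) ^ n = pi_prod m ^ n" by simp
      thus ?thesis using True by (simp add: Suc log_col_def power_mult_distrib)
    qed (simp add: True)
  next
    case False
    hence "n - s = n - 1 - (s - 1)" by simp
    thus ?thesis using False by (simp only: log_col_def if_False)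
  qed
  finally show ?thesis .
qed

section \<open>The functional equation of the logarithm\<close>

lemma d_theta_carrier [simp]: "d_theta j n \<in> carrier_mat n n"
  by (simp add: d_theta_def N_mat_def)

lemma d_theta_index:
  assumes "r < n" "s < n"
  shows "d_theta j n $$ (r, s) = (if r = s then \<theta> else 0) + (if s = r + 1 then 1 else 0)"
  using assms by (auto simp: d_theta_def N_mat_def)

lemma phi_theta_in_tau_series [simp]: "phi_theta j n \<in> tau_series n"
  by (auto simp: tau_series_def phi_theta_def E_mat_def)

lemma sum_d_theta_left:
  assumes "r < n"
  shows "(\<Sum>u<n. d_theta j n $$ (r, u) * f u) = \<theta> * f r + (if r + 1 < n then f (r + 1) else 0)"
proof -
  have "(\<Sum>u<n. d_theta j n $$ (r, u) * f u) =
     (\<Sum>u<n. (if u = r then \<theta> * f r else 0) + (if u = r + 1 then f (r + 1) else 0))"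
    using assms by (intro sum.cong) (auto simp: d_theta_index)
  thus ?thesis using assms by (simp add: sum.distrib)
qed

lemma sum_d_theta_right:
  assumes "s < n"
  shows "(\<Sum>u<n. f u * d_theta j n $$ (u, s) ^ (q ^ k)) = f s * \<theta> ^ (q ^ k) + (if s = 0 then 0 else f (s - 1))"
proof -
  have "(\<Sum>u<n. f u * d_theta j n $$ (u, s) ^ (q ^ k)) =
     (\<Sum>u<n. (if u = s then f s * \<theta> ^ (q ^ k) else 0) + (if u = s - 1 then if s = 0 then 0 else f (s - 1) else 0))"
    using assms by (intro sum.cong) (auto simp: d_theta_index power_0_left)
  thus ?thesis using assms by (simp add: sum.distrib)
qed

lemma sum_E_left:
  assumes "r < n"
  shows "(\<Sum>u<n. E_mat n $$ (r, u) * f u) = (if r = n - 1 then f 0 else (0 :: 'c))"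
proof -
  have "(\<Sum>u<n. E_mat n $$ (r, u) * f u) = (\<Sum>u<n. if u = 0 then if r = n - 1 then f 0 else 0 else 0)"
    using assms by (intro sum.cong) (auto simp: E_mat_def)
  thus ?thesis using assms by simp
qed

lemma sum_E_right:
  assumes "s < n"
  shows "(\<Sum>u<n. f u * E_mat n $$ (u, s) ^ (q ^ k)) = (if s = 0 then f (n - 1) else (0 :: 'c))"
proof -
  have "(\<Sum>u<n. f u * E_mat n $$ (u, s) ^ (q ^ k)) = (\<Sum>u<n. if u = n - 1 then if s = 0 then f (n - 1) else 0 else 0)"
    using assms by (intro sum.cong) (auto simp: E_mat_def power_0_left)
  thus ?thesis using assms by simp
qed

lemma tau_comp_phi_right:
  assumes "A \<in> tau_series n" "r < n" "s < n"
  shows "tau_comp q n A (phi_theta j n) k $$ (r, s) =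
    A k $$ (r, s) * \<theta> ^ (q ^ k) + (if s = 0 then if k = 0 then 0 else A (k - 1) $$ (r, n - 1) else A k $$ (r, s - 1))"
proof -
  define T where "T = (\<lambda>i. \<Sum>u<n. A i $$ (r, u) * phi_theta j n (k - i) $$ (u, s) ^ (q ^ i))"
  have "tau_comp q n A (phi_theta j n) k $$ (r, s) = (\<Sum>i\<le>k. T i)"
    unfolding T_def using assms by (intro tau_comp_index) simp_all
  also have "\<dots> = (\<Sum>i\<le>k. (if i = k then \<Sum>u<n. A k $$ (r, u) * d_theta j n $$ (u, s) ^ (q ^ k) else 0)
       + (if i = k - 1 then if k = 0 then 0 else \<Sum>u<n. A (k - 1) $$ (r, u) * E_mat n $$ (u, s) ^ (q ^ (k - 1)) else 0))"
  proof (rule sum.cong[OF refl])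
    fix i assume "i \<in> {..k}"
    then consider "i = k" | "k > 0" "i = k - 1" | "k - i \<ge> 2" by fastforce
    thus "T i = (if i = k then \<Sum>u<n. A k $$ (r, u) * d_theta j n $$ (u, s) ^ (q ^ k) else 0)
       + (if i = k - 1 then if k = 0 then 0 else \<Sum>u<n. A (k - 1) $$ (r, u) * E_mat n $$ (u, s) ^ (q ^ (k - 1)) else 0)"
    proof cases
      case 3
      hence "T i = 0" using assms by (auto simp: T_def phi_theta_def power_0_left intro!: sum.neutral)
      thus ?thesis using 3 by auto
    qed (auto simp: T_def phi_theta_def)
  qed
  also have "\<dots> = (\<Sum>u<n. A k $$ (r, u) * d_theta j n $$ (u, s) ^ (q ^ k)) +
       (if k = 0 then 0 else \<Sum>u<n. A (k - 1) $$ (r, u) * E_mat n $$ (u, s) ^ (q ^ (k - 1)))"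
    by (simp add: sum.distrib)
  also have "\<dots> = A k $$ (r, s) * \<theta> ^ (q ^ k) + (if s = 0 then if k = 0 then 0 else A (k - 1) $$ (r, n - 1) else A k $$ (r, s - 1))"
    using assms by (simp add: sum_d_theta_right sum_E_right)
  finally show ?thesis .
qed

lemma tau_comp_phi_left:
  assumes "A \<in> tau_series n" "r < n" "s < n"
  shows "tau_comp q n (phi_theta j n) A k $$ (r, s) =
    \<theta> * A k $$ (r, s) + (if r + 1 < n then A k $$ (r + 1, s) else 0) +
    (if r = n - 1 \<and> k > 0 then A (k - 1) $$ (0, s) ^ q else 0)"
proof -
  define T where "T = (\<lambda>i. \<Sum>u<n. phi_theta j n i $$ (r, u) * A (k - i) $$ (u, s) ^ (q ^ i))"
  have "tau_comp q n (phi_theta j n) A k $$ (r, s) = (\<Sum>i\<le>k. T i)"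
    unfolding T_def using assms by (intro tau_comp_index) simp_all
  also have "\<dots> = (\<Sum>i\<le>k. (if i = 0 then T 0 else 0) + (if i = 1 then T 1 else 0))"
  proof (rule sum.cong[OF refl])
    fix i :: nat
    consider "i = 0" | "i = 1" | "i \<ge> 2" by fastforce
    thus "T i = (if i = 0 then T 0 else 0) + (if i = 1 then T 1 else 0)"
    proof cases
      case 3
      hence "T i = 0" using assms by (auto simp: T_def phi_theta_def intro!: sum.neutral)
      thus ?thesis using 3 by auto
    qed auto
  qed
  also have "\<dots> = T 0 + (if k > 0 then T 1 else 0)"
    by (simp add: sum.distrib)
  also have "T 0 = \<theta> * A k $$ (r, s) + (if r + 1 < n then A k $$ (r + 1, s) else 0)"
    unfolding T_def using assms by (simp add: phi_theta_def sum_d_theta_left)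
  also have "T 1 = (if r = n - 1 then A (k - 1) $$ (0, s) ^ q else 0)"
    unfolding T_def using assms by (simp add: phi_theta_def sum_E_left)
  finally show ?thesis by (auto simp: algebra_simps)
qed

text \<open>The expansion at \<open>\<theta>\<close> of \<open>t\<close> times a column is computed
  in two ways: by the action of \<open>t\<close> on expansions, which gives \<open>d_theta\<close>,
  and by \<open>log_col_X\<close>, which gives \<open>phi_theta\<close>. The exceptional term
  \<open>(t - \<theta>)^n\<close> does not reach the first \<open>n\<close> coefficients.\<close>

lemma log_mat_functional_equation:
  assumes "n \<ge> 1"
  shows "tau_comp q n (log_mat n) (phi_theta j n) = tau_comp q n (tau_const n (d_theta j n)) (log_mat n)"
proof (rule tau_series_eqI)
  fix k r s assume rs: "r < n" "s < n"
  have "tau_comp q n (tau_const n (d_theta j n)) (log_mat n) k $$ (r, s) =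
     \<theta> * log_mat n k $$ (r, s) + (if r + 1 < n then log_mat n k $$ (r + 1, s) else 0)"
    using rs by (subst tau_comp_const_left) (simp_all add: sum_d_theta_left)
  also have "\<dots> = taylor_coeff (fps_X * log_col n k s) (n - 1 - r)"
    using rs by (subst taylor_coeff_X) (auto simp: log_mat_index)
  also have "\<dots> = log_mat n k $$ (r, s) * \<theta> ^ (q ^ k) +
     (if s = 0 then if k = 0 then 0 else log_mat n (k - 1) $$ (r, n - 1) else log_mat n k $$ (r, s - 1))"
    using rs assms unfolding log_col_X[OF assms rs(2)]
    by (subst taylor_coeff_add)
      (auto simp: taylor_coeff_cmult log_mat_index taylor_coeff_linear_power Tate_q_mult Tate_q_power)
  also have "\<dots> = tau_comp q n (log_mat n) (phi_theta j n) k $$ (r, s)"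
    using rs by (simp add: tau_comp_phi_right)
  finally show "tau_comp q n (log_mat n) (phi_theta j n) k $$ (r, s) =
      tau_comp q n (tau_const n (d_theta j n)) (log_mat n) k $$ (r, s)" by simp
qed simp_all

section \<open>Uniqueness and decay of the coefficients of the exponential\<close>

definition exp_mat :: "nat \<Rightarrow> nat \<Rightarrow> 'c mat" where
  "exp_mat n = tau_inverse q n (log_mat n)"

lemma exp_mat_in_tau_series [simp]: "exp_mat n \<in> tau_series n"
  by (simp add: exp_mat_def)

lemma exp_mat_0: "exp_mat n 0 = 1\<^sub>m n"
  by (simp add: exp_mat_def)

lemma exp_log_mat: "tau_comp q n (exp_mat n) (log_mat n) = tau_const n (1\<^sub>m n)"
  unfolding exp_mat_def by (rule tau_inverse_left[OF log_mat_in_tau_series log_mat_0])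

lemma log_exp_mat: "tau_comp q n (log_mat n) (exp_mat n) = tau_const n (1\<^sub>m n)"
  unfolding exp_mat_def by (rule tau_inverse_right[OF log_mat_in_tau_series log_mat_0])

lemma exp_mat_functional_equation:
  assumes "n \<ge> 1"
  shows "tau_comp q n (exp_mat n) (tau_const n (d_theta j n)) = tau_comp q n (phi_theta j n) (exp_mat n)"
proof -
  let ?a = "exp_mat n" and ?b = "log_mat n" and ?d = "tau_const n (d_theta j n)" and ?p = "phi_theta j n"
  have "tau_comp q n ?p ?a = tau_comp q n (tau_comp q n (tau_comp q n ?a ?b) ?p) ?a"
    by (simp only: exp_log_mat tau_comp_one_left[OF phi_theta_in_tau_series])
  also have "\<dots> = tau_comp q n (tau_comp q n ?a (tau_comp q n ?b ?p)) ?a"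
    by (simp add: tau_comp_assoc)
  also have "\<dots> = tau_comp q n (tau_comp q n ?a (tau_comp q n ?d ?b)) ?a"
    by (simp only: log_mat_functional_equation[OF assms])
  also have "\<dots> = tau_comp q n (tau_comp q n ?a ?d) (tau_comp q n ?b ?a)"
    by (simp add: tau_comp_assoc)
  also have "\<dots> = tau_comp q n ?a ?d"
    by (simp only: log_exp_mat tau_comp_one_right[OF tau_comp_in_tau_series])
  finally show ?thesis by (rule sym)
qed

text \<open>In the equation at an entry of maximal size \<open>m\<close>, the left-hand term has
  size \<open>m * q^(q^k)\<close>, whereas the other entries of \<open>x\<close> contribute at most
  \<open>q * m\<close>, which is strictly less unless \<open>m = 0\<close>. So \<open>y\<close> has
  to balance it. With \<open>y = 0\<close> this gives uniqueness, in general decay.\<close>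

lemma sylvester_bound:
  fixes x y :: "nat \<Rightarrow> nat \<Rightarrow> 'c"
  assumes eq: "\<And>r s. r < n \<Longrightarrow> s < n \<Longrightarrow>
      x r s * \<theta> ^ (q ^ k) + (if s = 0 then 0 else x r (s - 1)) =
      \<theta> * x r s + (if r + 1 < n then x (r + 1) s else 0) + y r s"
    and y: "\<And>r s. r < n \<Longrightarrow> s < n \<Longrightarrow> vabs (y r s) \<le> b"
    and k: "k \<ge> 1" and rs: "r < n" "s < n"
  shows "vabs (x r s) \<le> b / real q ^ (q ^ k)"
proof -
  define S where "S = (\<lambda>(r, s). vabs (x r s)) ` ({..<n} \<times> {..<n})"
  define m where "m = Max S"
  have fin: "finite S" "S \<noteq> {}" using rs by (auto simp: S_def)
  have le: "vabs (x r s) \<le> m" if "r < n" "s < n" for r s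
    unfolding m_def using fin that by (intro Max_ge) (auto simp: S_def)
  have "m \<in> S" unfolding m_def using fin by (intro Max_in)
  then obtain r0 s0 where 0: "r0 < n" "s0 < n" "m = vabs (x r0 s0)" by (auto simp: S_def)
  have m0: "m \<ge> 0" using 0 by simp
  have b0: "b \<ge> 0" using order.trans[OF vabs_nonneg y[OF rs]] .
  have q1: "real q \<ge> 1" using q_ge_2 by simp
  have mq: "m \<le> real q * m" using q1 m0 by (simp add: mult_le_cancel_right1)
  have mm: "c \<le> max (real q * m) b" if "c \<le> m" for c
    using mq that by (simp add: le_max_iff_disj)
  have "q ^ 1 \<le> q ^ k" using k q_ge_2 by (intro power_increasing) auto
  hence "1 < q ^ k" using q_ge_2 by simp
  hence qk: "real q ^ 1 < real q ^ (q ^ k)" using q_ge_2 by (intro power_strict_increasing) auto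
  have "x r0 s0 * \<theta> ^ (q ^ k) = (\<theta> * x r0 s0 + (if r0 + 1 < n then x (r0 + 1) s0 else 0) + y r0 s0)
      - (if s0 = 0 then 0 else x r0 (s0 - 1))"
    using eq[OF 0(1,2)] by (simp add: algebra_simps)
  also have "vabs \<dots> \<le> max (real q * m) b"
  proof (intro vabs_diff_le vabs_add_le)
    show "vabs (\<theta> * x r0 s0) \<le> max (real q * m) b" by (simp add: vabs_mult vabs_theta 0)
    show "vabs (if r0 + 1 < n then x (r0 + 1) s0 else 0) \<le> max (real q * m) b"
      using le[of "r0 + 1" s0] 0(1,2) m0 by (intro mm) auto
    show "vabs (y r0 s0) \<le> max (real q * m) b" using y[OF 0(1,2)] by simp
    show "vabs (if s0 = 0 then 0 else x r0 (s0 - 1)) \<le> max (real q * m) b"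
      using le[of r0 "s0 - 1"] 0(1,2) m0 by (intro mm) auto
  qed
  finally have *: "m * real q ^ (q ^ k) \<le> max (real q * m) b"
    by (simp add: vabs_mult vabs_power vabs_theta 0)
  have "m * real q ^ (q ^ k) \<le> b"
  proof (cases "m = 0")
    case False
    hence "real q * m < real q ^ (q ^ k) * m" using m0 qk by (intro mult_strict_right_mono) auto
    thus ?thesis using * by (auto simp: max_def mult.commute split: if_splits)
  qed (use b0 in simp)
  hence "m \<le> b / real q ^ (q ^ k)" by (simp add: field_simps)
  thus ?thesis using le[OF rs] by linarith
qed

definition is_exp :: "nat \<Rightarrow> (nat \<Rightarrow> 'c mat) \<Rightarrow> bool" where
  "is_exp n A \<longleftrightarrow> A \<in> tau_series n \<and> A 0 = 1\<^sub>m n \<and>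
     tau_comp q n A (tau_const n (d_theta j n)) = tau_comp q n (phi_theta j n) A"

lemma is_exp_step:
  assumes "is_exp n A" "r < n" "s < n" "k \<ge> 1"
  shows "A k $$ (r, s) * \<theta> ^ (q ^ k) + (if s = 0 then 0 else A k $$ (r, s - 1)) =
     \<theta> * A k $$ (r, s) + (if r + 1 < n then A k $$ (r + 1, s) else 0) +
       (if r = n - 1 then A (k - 1) $$ (0, s) ^ q else 0)"
proof -
  have A: "A \<in> tau_series n" using assms by (simp add: is_exp_def)
  have "A k $$ (r, s) * \<theta> ^ (q ^ k) + (if s = 0 then 0 else A k $$ (r, s - 1)) =
          tau_comp q n A (tau_const n (d_theta j n)) k $$ (r, s)"
    using A assms by (subst tau_comp_const_right) (simp_all add: sum_d_theta_right)
  also have "\<dots> = tau_comp q n (phi_theta j n) A k $$ (r, s)"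
    using assms(1) by (simp add: is_exp_def)
  finally show ?thesis using A assms by (simp add: tau_comp_phi_left)
qed

text \<open>Once the coefficients of index \<open>k\<close> agree, the inhomogeneous terms at
  \<open>Suc k\<close> cancel in the difference, and \<open>sylvester_bound\<close> with
  \<open>b = 0\<close> forces it to vanish.\<close>

lemma is_exp_unique:
  assumes A: "is_exp n A" and B: "is_exp n B"
  shows "A = B"
proof (rule tau_series_eqI)
  fix k r s assume "r < n" "s < n"
  thus "A k $$ (r, s) = B k $$ (r, s)"
  proof (induction k arbitrary: r s)
    case 0
    thus ?case using A B by (simp add: is_exp_def)
  next
    case (Suc k)
    have "vabs (A (Suc k) $$ (r, s) - B (Suc k) $$ (r, s)) \<le> 0 / real q ^ (q ^ Suc k)"
    proof (rule sylvester_bound[where x = "\<lambda>r s. A (Suc k) $$ (r, s) - B (Suc k) $$ (r, s)" and y = "\<lambda>_ _. 0"])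
      fix r s assume rs: "r < n" "s < n"
      have "A k $$ (0, s) = B k $$ (0, s)" using rs by (intro Suc.IH) auto
      thus "(A (Suc k) $$ (r, s) - B (Suc k) $$ (r, s)) * \<theta> ^ (q ^ Suc k) +
           (if s = 0 then 0 else A (Suc k) $$ (r, s - 1) - B (Suc k) $$ (r, s - 1)) =
           \<theta> * (A (Suc k) $$ (r, s) - B (Suc k) $$ (r, s)) +
           (if r + 1 < n then A (Suc k) $$ (r + 1, s) - B (Suc k) $$ (r + 1, s) else 0) + 0"
        using is_exp_step[OF A rs, of "Suc k"] is_exp_step[OF B rs, of "Suc k"]
        by (simp add: algebra_simps split: if_splits)
    qed (use Suc.prems in simp_all)
    thus ?case using vabs_nonneg[of "A (Suc k) $$ (r, s) - B (Suc k) $$ (r, s)"] by simp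
  qed
qed (use A B in \<open>simp_all add: is_exp_def\<close>)

lemma is_exp_exp_mat: "n \<ge> 1 \<Longrightarrow> is_exp n (exp_mat n)"
  by (simp add: is_exp_def exp_mat_0 exp_mat_functional_equation)

lemma Exp_series_eq:
  assumes "n \<ge> 1"
  shows "Exp_series j n = exp_mat n"
proof -
  have "Exp_series j n = (THE A. is_exp n A)"
    by (simp add: Exp_series_def is_exp_def tau_series_def)
  also have "\<dots> = exp_mat n"
    by (rule the_equality[where P = "is_exp n"], rule is_exp_exp_mat[OF assms])
      (rule is_exp_unique[OF _ is_exp_exp_mat[OF assms]])
  finally show ?thesis .
qed

lemma Log_series_eq:
  assumes "n \<ge> 1"
  shows "Log_series j n = log_mat n"
  unfolding Log_series_def Exp_series_eq[OF assms]
proof (rule the_equality)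
  show "(\<forall>i. log_mat n i \<in> carrier_mat n n) \<and>
    tau_comp q n (exp_mat n) (log_mat n) = tau_const n (1\<^sub>m n) \<and>
    tau_comp q n (log_mat n) (exp_mat n) = tau_const n (1\<^sub>m n)"
    using tau_series_carrier[OF log_mat_in_tau_series] by (simp add: exp_log_mat log_exp_mat)
next
  fix B assume "(\<forall>i. B i \<in> carrier_mat n n) \<and>
    tau_comp q n (exp_mat n) B = tau_const n (1\<^sub>m n) \<and>
    tau_comp q n B (exp_mat n) = tau_const n (1\<^sub>m n)"
  hence B: "B \<in> tau_series n" "tau_comp q n (exp_mat n) B = tau_const n (1\<^sub>m n)" by (auto simp: tau_series_def)
  have "B = tau_comp q n (tau_comp q n (log_mat n) (exp_mat n)) B"
    by (simp only: log_exp_mat tau_comp_one_left[OF B(1)])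
  also have "\<dots> = tau_comp q n (log_mat n) (tau_comp q n (exp_mat n) B)"
    using B(1) by (intro tau_comp_assoc) simp_all
  also have "\<dots> = log_mat n" by (simp only: B(2) tau_comp_one_right[OF log_mat_in_tau_series])
  finally show "B = log_mat n" .
qed

text \<open>One step of the recursion raises the bound to the \<open>q\<close>-th power and divides
  it by \<open>q^(q^(k+1))\<close>; starting from 1 this yields \<open>q^(-k q^k)\<close>, fast
  enough for convergence everywhere.\<close>

lemma exp_mat_bound:
  assumes "n \<ge> 1" "r < n" "s < n"
  shows "vabs (exp_mat n k $$ (r, s)) \<le> inverse (real q ^ k) ^ (q ^ k)"
  using assms(2,3)
proof (induction k arbitrary: r s)
  case 0
  thus ?case by (simp add: exp_mat_0)
next
  case (Suc k)
  have "vabs (exp_mat n (Suc k) $$ (r, s)) \<le> (inverse (real q ^ k) ^ (q ^ k)) ^ q / real q ^ (q ^ Suc k)"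
  proof (rule sylvester_bound[where x = "\<lambda>r s. exp_mat n (Suc k) $$ (r, s)"
        and y = "\<lambda>r s. if r = n - 1 then exp_mat n k $$ (0, s) ^ q else 0"])
    fix r s assume rs: "r < n" "s < n"
    show "exp_mat n (Suc k) $$ (r, s) * \<theta> ^ (q ^ Suc k) +
           (if s = 0 then 0 else exp_mat n (Suc k) $$ (r, s - 1)) =
           \<theta> * exp_mat n (Suc k) $$ (r, s) +
           (if r + 1 < n then exp_mat n (Suc k) $$ (r + 1, s) else 0) +
           (if r = n - 1 then exp_mat n k $$ (0, s) ^ q else 0)"
      using is_exp_step[OF is_exp_exp_mat[OF assms(1)] rs, of "Suc k"] by simp
    have "vabs (exp_mat n k $$ (0, s)) \<le> inverse (real q ^ k) ^ (q ^ k)"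
      using rs by (intro Suc.IH) auto
    thus "vabs (if r = n - 1 then exp_mat n k $$ (0, s) ^ q else 0) \<le> (inverse (real q ^ k) ^ (q ^ k)) ^ q"
      by (simp add: vabs_power power_mono)
  qed (use Suc.prems in simp_all)
  also have "\<dots> = inverse (real q ^ Suc k) ^ (q ^ Suc k)"
  proof -
    have "(inverse (real q ^ k) ^ (q ^ k)) ^ q = inverse (real q ^ k) ^ (q ^ Suc k)"
      unfolding power_mult[symmetric] power_Suc by (simp only: mult.commute)
    hence "(inverse (real q ^ k) ^ (q ^ k)) ^ q / real q ^ (q ^ Suc k) =
             inverse (real q ^ k) ^ (q ^ Suc k) * inverse (real q) ^ (q ^ Suc k)"
      by (simp only: divide_inverse power_inverse)
    also have "\<dots> = (inverse (real q ^ k) * inverse (real q)) ^ (q ^ Suc k)"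
      by (rule power_mult_distrib[symmetric])
    also have "inverse (real q ^ k) * inverse (real q) = inverse (real q ^ Suc k)" by simp
    finally show ?thesis .
  qed
  finally show ?case .
qed


subsection \<open>Convergence of the exponential\<close>

lemma super_geometric_tendsto_0:
  assumes "c \<ge> 0"
  shows "(\<lambda>i. (c / real q ^ i) ^ (q ^ i)) \<longlonglongrightarrow> 0"
proof (rule tendsto_sandwich[OF _ _ tendsto_const])
  have "(\<lambda>i. c * inverse (real q) ^ i) \<longlonglongrightarrow> 0"
    using q_ge_2 by (intro tendsto_mult_right_zero LIMSEQ_power_zero) (simp add: field_simps)
  thus lim: "(\<lambda>i. c / real q ^ i) \<longlonglongrightarrow> 0" by (simp add: divide_inverse power_inverse)
  have "\<forall>\<^sub>F i in sequentially. c / real q ^ i < 1" using order_tendstoD(2)[OF lim, of 1] by simp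
  thus "\<forall>\<^sub>F i in sequentially. (c / real q ^ i) ^ (q ^ i) \<le> c / real q ^ i"
  proof eventually_elim
    case (elim i)
    have "(c / real q ^ i) ^ (q ^ i) \<le> (c / real q ^ i) ^ 1"
      using elim assms q_ge_2 by (intro power_decreasing) auto
    thus ?case by simp
  qed
qed (use assms in simp)

lemma vec_bound:
  obtains c where "c \<ge> 0" "\<And>s. s < n \<Longrightarrow> vabs ((z :: 'c vec) $ s) \<le> c"
proof -
  have "vabs (z $ s) \<le> (\<Sum>i<n. vabs (z $ i))" if "s < n" for s
    using that by (intro member_le_sum) auto
  thus ?thesis by (intro that[of "\<Sum>i<n. vabs (z $ i)"]) (auto intro: sum_nonneg)
qed

lemma exp_term_bound:
  assumes "n \<ge> 1" "r < n" "u < n" "vabs x \<le> c"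
  shows "vabs (exp_mat n i $$ (r, u) * x ^ (q ^ i)) \<le> (c / real q ^ i) ^ (q ^ i)"
proof -
  have "vabs (exp_mat n i $$ (r, u)) * vabs x ^ (q ^ i) \<le> inverse (real q ^ i) ^ (q ^ i) * c ^ (q ^ i)"
    using assms by (intro mult_mono exp_mat_bound power_mono) auto
  also have "\<dots> = (inverse (real q ^ i) * c) ^ (q ^ i)" by (rule power_mult_distrib[symmetric])
  also have "inverse (real q ^ i) * c = c / real q ^ i" by (simp only: divide_inverse mult.commute)
  finally show ?thesis by (simp add: vabs_mult vabs_power)
qed

lemma exp_term_tendsto_0:
  assumes "n \<ge> 1" "r < n"
  shows "tau_term n (exp_mat n) z r \<longlonglongrightarrow> 0"
proof -
  obtain c where c: "c \<ge> 0" "\<And>s. s < n \<Longrightarrow> vabs (z $ s) \<le> c" using vec_bound[of n z] by blast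
  show ?thesis
  proof (rule vabs_comparison_tendsto_0[OF _ super_geometric_tendsto_0[OF c(1)]])
    fix i
    show "vabs (tau_term n (exp_mat n) z r i) \<le> (c / real q ^ i) ^ (q ^ i)"
      unfolding tau_term_def using assms c by (intro vabs_sum_le exp_term_bound) auto
  qed
qed

lemma Exp_C_eq: "n \<ge> 1 \<Longrightarrow> Exp_C j n = tau_eval q n (exp_mat n)"
  by (simp add: Exp_C_def Exp_series_eq)

lemma Exp_C_carrier [simp]: "Exp_C j n z \<in> carrier_vec n"
  by (simp add: Exp_C_def)

lemma Exp_C_sums:
  assumes "n \<ge> 1" "r < n" "z \<in> carrier_vec n"
  shows "tau_term n (exp_mat n) z r sums (Exp_C j n z $ r)"
  unfolding Exp_C_eq[OF assms(1)] using assms by (intro tau_eval_sums exp_term_tendsto_0) simp_all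

lemma Exp_C_add:
  assumes "n \<ge> 1" "x \<in> carrier_vec n" "y \<in> carrier_vec n"
  shows "Exp_C j n (x + y) = Exp_C j n x + Exp_C j n y"
proof (subst Exp_C_eq[OF assms(1)], rule tau_eval_eqI)
  fix r assume r: "r < n"
  have "tau_term n (exp_mat n) (x + y) r = (\<lambda>i. tau_term n (exp_mat n) x r i + tau_term n (exp_mat n) y r i)"
  proof
    fix i
    show "tau_term n (exp_mat n) (x + y) r i = tau_term n (exp_mat n) x r i + tau_term n (exp_mat n) y r i"
      unfolding tau_term_def sum.distrib[symmetric] using assms
      by (intro sum.cong) (auto simp: frobenius_pow_add distrib_left)
  qed
  moreover have "(Exp_C j n x + Exp_C j n y) $ r = Exp_C j n x $ r + Exp_C j n y $ r"
    using r by (intro index_add_vec(1)) (simp only: carrier_vecD[OF Exp_C_carrier[of n y]])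
  ultimately show "tau_term n (exp_mat n) (x + y) r sums ((Exp_C j n x + Exp_C j n y) $ r)"
    using ultra_sums_add[OF Exp_C_sums[OF assms(1) r assms(2)] Exp_C_sums[OF assms(1) r assms(3)]] by simp
qed (use assms in \<open>simp_all add: add_carrier_vec\<close>)

section \<open>The exponential and the action of \<open>t\<close>\<close>

definition phi_act :: "nat \<Rightarrow> 'c vec \<Rightarrow> 'c vec" where
  "phi_act n w = vec n (\<lambda>r. \<theta> * w $ r + (if r + 1 < n then w $ (r + 1) else 0) + (if r = n - 1 then w $ 0 ^ q else 0))"

lemma tau_eval_phi:
  assumes "w \<in> carrier_vec n"
  shows "tau_eval q n (phi_theta j n) w = phi_act n w"
proof (rule tau_eval_eqI[OF phi_theta_in_tau_series assms])
  fix r assume r: "r < n"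
  have "tau_term n (phi_theta j n) w r i =
     (if i = 0 then \<theta> * w $ r + (if r + 1 < n then w $ (r + 1) else 0) else 0) +
     (if i = 1 then if r = n - 1 then w $ 0 ^ q else 0 else 0)" for i
  proof -
    consider "i = 0" | "i = 1" | "i \<ge> 2" by fastforce
    thus ?thesis
    proof cases
      case 1
      thus ?thesis using r by (simp add: tau_term_def phi_theta_def sum_d_theta_left)
    next
      case 2
      thus ?thesis using r by (simp add: tau_term_def phi_theta_def sum_E_left)
    next
      case 3
      thus ?thesis using r by (auto simp: tau_term_def phi_theta_def intro!: sum.neutral)
    qed
  qed
  hence "tau_term n (phi_theta j n) w r = (\<lambda>i. (if i = 0 then \<theta> * w $ r + (if r + 1 < n then w $ (r + 1) else 0) else 0) +
     (if i = 1 then if r = n - 1 then w $ 0 ^ q else 0 else 0))" by (rule ext)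
  moreover have "phi_act n w $ r = (\<theta> * w $ r + (if r + 1 < n then w $ (r + 1) else 0)) + (if r = n - 1 then w $ 0 ^ q else 0)"
    using r by (simp add: phi_act_def)
  ultimately show "tau_term n (phi_theta j n) w r sums (phi_act n w $ r)"
    by (simp only: ultra_sums_add[OF ultra_sums_single ultra_sums_single])
qed (simp add: phi_act_def)

lemma vabs_d_theta: "r < n \<Longrightarrow> s < n \<Longrightarrow> vabs (d_theta j n $$ (r, s)) \<le> real q"
  using q_ge_2 by (auto simp: d_theta_index vabs_theta)

lemma Exp_C_d_theta:
  assumes n: "n \<ge> 1" and x: "x \<in> carrier_vec n"
  shows "Exp_C j n (d_theta j n *\<^sub>v x) = phi_act n (Exp_C j n x)"
proof -
  obtain c where c: "c \<ge> 0" "\<And>s. s < n \<Longrightarrow> vabs (x $ s) \<le> c" using vec_bound[of n x] by blast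
  have q1: "real q \<ge> 1" using q_ge_2 by simp
  have cq: "real q * c \<ge> 0" using c by simp
  \<comment> \<open>The extra factor \<open>q\<close> absorbs the entries of \<open>d_theta\<close>,
    of size up to \<open>q\<close>. It also matches the index shift caused by
    \<open>E \<tau>\<close>, because \<open>c / q^k = q c / q^(k+1)\<close>.\<close>
  define g where "g = (\<lambda>m. (real q * c / real q ^ m) ^ (q ^ m))"
  have g: "g \<longlonglongrightarrow> 0" unfolding g_def by (rule super_geometric_tendsto_0[OF cq])
  have g0: "g m \<ge> 0" for m using cq by (simp add: g_def)
  have "Exp_C j n (d_theta j n *\<^sub>v x) = tau_eval q n (exp_mat n) (tau_eval q n (tau_const n (d_theta j n)) x)"
    using n x by (simp add: Exp_C_eq tau_eval_const)
  also have "\<dots> = tau_eval q n (tau_comp q n (exp_mat n) (tau_const n (d_theta j n))) x"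
  proof (rule tau_eval_comp[OF _ _ x _ g])
    fix i k r u s :: nat assume rus: "r < n" "u < n" "s < n"
    show "vabs (exp_mat n i $$ (r, u) * (tau_const n (d_theta j n) k $$ (u, s) * x $ s ^ (q ^ k)) ^ (q ^ i)) \<le> g (i + k)"
    proof (cases "k = 0")
      case True
      have "vabs (d_theta j n $$ (u, s) * x $ s) \<le> real q * c"
        unfolding vabs_mult using rus c by (intro mult_mono vabs_d_theta) auto
      hence "vabs (exp_mat n i $$ (r, u) * (d_theta j n $$ (u, s) * x $ s) ^ (q ^ i)) \<le> g i"
        unfolding g_def using rus n by (intro exp_term_bound)
      thus ?thesis using True by (simp add: tau_const_def)
    qed (use rus g0 in \<open>simp add: tau_const_def power_0_left\<close>)
  next
    fix u assume u: "u < n"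
    have "\<forall>\<^sub>F i in sequentially. tau_term n (tau_const n (d_theta j n)) x u i = 0"
      using eventually_gt_at_top[of 0]
      by eventually_elim (use u in \<open>auto simp: tau_term_def tau_const_def intro!: sum.neutral\<close>)
    thus "tau_term n (tau_const n (d_theta j n)) x u \<longlonglongrightarrow> 0" by (rule tendsto_eventually)
  qed simp_all
  also have "\<dots> = tau_eval q n (tau_comp q n (phi_theta j n) (exp_mat n)) x"
    by (simp only: exp_mat_functional_equation[OF n])
  also have "\<dots> = tau_eval q n (phi_theta j n) (tau_eval q n (exp_mat n) x)"
  proof (rule tau_eval_comp[symmetric, OF _ _ x])
    show "(\<lambda>m. real q * g m) \<longlonglongrightarrow> 0" by (rule tendsto_mult_right_zero[OF g])
    show "tau_term n (exp_mat n) x u \<longlonglongrightarrow> 0" if "u < n" for u by (rule exp_term_tendsto_0[OF n that])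
    fix i k r u s :: nat assume rus: "r < n" "u < n" "s < n"
    have t: "vabs (exp_mat n k $$ (u, s) * x $ s ^ (q ^ k)) \<le> (c / real q ^ k) ^ (q ^ k)"
      using rus n c by (intro exp_term_bound)
    consider "i = 0" | "i = 1" | "i \<ge> 2" by fastforce
    thus "vabs (phi_theta j n i $$ (r, u) * (exp_mat n k $$ (u, s) * x $ s ^ (q ^ k)) ^ (q ^ i)) \<le> real q * g (i + k)"
    proof cases
      case 1
      have "vabs (d_theta j n $$ (r, u) * (exp_mat n k $$ (u, s) * x $ s ^ (q ^ k))) \<le> real q * (c / real q ^ k) ^ (q ^ k)"
        unfolding vabs_mult[of "d_theta j n $$ (r, u)"] using rus t by (intro mult_mono vabs_d_theta) auto
      also have "(c / real q ^ k) ^ (q ^ k) \<le> g k"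
        unfolding g_def using c q1 by (intro power_mono divide_right_mono) (auto simp: mult_le_cancel_right1)
      finally show ?thesis using 1 by (simp add: phi_theta_def mult_left_mono)
    next
      case 2
      have "vabs (E_mat n $$ (r, u) :: 'c) \<le> 1" using rus by (auto simp: E_mat_def)
      hence "vabs (E_mat n $$ (r, u) * (exp_mat n k $$ (u, s) * x $ s ^ (q ^ k)) ^ q) \<le> 1 * ((c / real q ^ k) ^ (q ^ k)) ^ q"
        unfolding vabs_mult[of "E_mat n $$ (r, u)"] vabs_power[of _ q] using t by (intro mult_mono power_mono) auto
      also have "((c / real q ^ k) ^ (q ^ k)) ^ q = (c / real q ^ k) ^ (q ^ Suc k)"
        unfolding power_mult[symmetric] power_Suc by (simp only: mult.commute)
      also have "c / real q ^ k = real q * c / real q ^ Suc k" by simp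
      also have "1 * (real q * c / real q ^ Suc k) ^ (q ^ Suc k) = 1 * g (Suc k)" by (simp only: g_def)
      also have "\<dots> \<le> real q * g (Suc k)" using q1 g0 by (intro mult_right_mono)
      finally show ?thesis using 2 by (simp add: phi_theta_def)
    next
      case 3
      thus ?thesis using rus g0 by (simp add: phi_theta_def)
    qed
  qed simp_all
  also have "\<dots> = phi_act n (Exp_C j n x)"
    using n by (simp add: tau_eval_phi Exp_C_eq)
  finally show ?thesis .
qed

text \<open>A geometric weakening that includes \<open>i = 0\<close>, where the coefficient is the
  identity and the sharper bound fails.\<close>

lemma log_mat_bound':
  assumes "r < n" "s < n"
  shows "vabs (log_mat n i $$ (r, s)) \<le> inverse (real q) ^ i"
proof (cases "i = 0")
  case True
  thus ?thesis using assms by (simp add: log_mat_0)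
next
  case False
  have "i \<le> q ^ i" using q_ge_2 by (intro less_imp_le power_gt_expt) auto
  hence "real q ^ i \<le> real q ^ (q ^ i)" using q_ge_2 by (intro power_increasing) auto
  hence "inverse (real q ^ (q ^ i)) \<le> inverse (real q ^ i)" by (intro le_imp_inverse_le) simp_all
  moreover have "vabs (log_mat n i $$ (r, s)) \<le> inverse (real q ^ (q ^ i))"
    using False assms by (intro log_mat_bound) auto
  ultimately show ?thesis unfolding power_inverse by (rule order.trans[rotated])
qed

lemma inverse_q_power_tendsto_0: "(\<lambda>m. inverse (real q) ^ m) \<longlonglongrightarrow> 0"
  using q_ge_2 by (intro LIMSEQ_power_zero) (simp add: field_simps)

text \<open>On the closed unit polydisc a geometric bound dominates the double series, so the formal
  identity can be evaluated. This smaller domain suffices because the descent ends at Gauss norm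
  1.\<close>

lemma Exp_C_log_mat:
  fixes z :: "'c vec"
  assumes n: "n \<ge> 1" and z: "z \<in> carrier_vec n" and small: "\<And>s. s < n \<Longrightarrow> vabs (z $ s) \<le> 1"
  shows "Exp_C j n (tau_eval q n (log_mat n) z) = z"
proof -
  have q1: "real q \<ge> 1" using q_ge_2 by simp
  have i1: "inverse (real q) \<le> 1" "inverse (real q) \<ge> 0" using q1 by (auto simp: field_simps)
  have pw: "vabs (z $ s ^ m) \<le> 1" if "s < n" for s m
    unfolding vabs_power using small[OF that] by (intro power_le_one) auto
  have "tau_eval q n (exp_mat n) (tau_eval q n (log_mat n) z) = tau_eval q n (tau_comp q n (exp_mat n) (log_mat n)) z"
  proof (rule tau_eval_comp[OF _ _ z _ inverse_q_power_tendsto_0])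
    fix i k r u s :: nat assume rus: "r < n" "u < n" "s < n"
    have "i \<le> i * q ^ i" using q_ge_2 by simp
    hence ei: "inverse (real q) ^ (i * q ^ i) \<le> inverse (real q) ^ i" using i1 by (intro power_decreasing)
    have e: "vabs (exp_mat n i $$ (r, u)) \<le> inverse (real q) ^ (i * q ^ i)"
      using exp_mat_bound[OF n rus(1,2), of i] by (simp add: power_inverse flip: power_mult)
    have "vabs (log_mat n k $$ (u, s) * z $ s ^ (q ^ k)) \<le> vabs (log_mat n k $$ (u, s)) * 1"
      unfolding vabs_mult using pw[OF rus(3)] by (intro mult_left_mono) auto
    hence l: "vabs (log_mat n k $$ (u, s) * z $ s ^ (q ^ k)) \<le> vabs (log_mat n k $$ (u, s))" by simp
    show "vabs (exp_mat n i $$ (r, u) * (log_mat n k $$ (u, s) * z $ s ^ (q ^ k)) ^ (q ^ i)) \<le> inverse (real q) ^ (i + k)"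
    \<comment> \<open>For \<open>k = 0\<close> the logarithm coefficient gives no decay and the
      exponential one supplies \<open>q^(-i)\<close>. For \<open>k \<ge> 1\<close> the logarithm
      term raised to the power \<open>q^i\<close> is already at most
      \<open>q^(-q^(i+k))\<close>.\<close>
    proof (cases "k = 0")
      case True
      have "vabs (log_mat n k $$ (u, s) * z $ s ^ (q ^ k)) \<le> 1"
        using l log_mat_bound'[OF rus(2,3), of k] True by simp
      hence "vabs (exp_mat n i $$ (r, u) * (log_mat n k $$ (u, s) * z $ s ^ (q ^ k)) ^ (q ^ i)) \<le> inverse (real q) ^ i * 1"
        unfolding vabs_mult[of "exp_mat n i $$ (r, u)"] vabs_power[of _ "q ^ i"]
        using order.trans[OF e ei] i1 by (intro mult_mono power_le_one) auto
      thus ?thesis using True by simp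
    next
      case False
      have "vabs (log_mat n k $$ (u, s) * z $ s ^ (q ^ k)) \<le> inverse (real q) ^ (q ^ k)"
        using order.trans[OF l log_mat_bound[of k u n s]] False rus by (simp add: power_inverse)
      hence "vabs ((log_mat n k $$ (u, s) * z $ s ^ (q ^ k)) ^ (q ^ i)) \<le> (inverse (real q) ^ (q ^ k)) ^ (q ^ i)"
        unfolding vabs_power[of _ "q ^ i"] by (intro power_mono) auto
      also have "\<dots> = inverse (real q) ^ (q ^ (i + k))"
        by (simp add: power_add mult.commute flip: power_mult)
      also have "\<dots> \<le> inverse (real q) ^ (i + k)"
      proof (rule power_decreasing)
        show "i + k \<le> q ^ (i + k)" using q_ge_2 by (intro less_imp_le power_gt_expt) auto
      qed (use i1 in auto)
      finally have "vabs ((log_mat n k $$ (u, s) * z $ s ^ (q ^ k)) ^ (q ^ i)) \<le> inverse (real q) ^ (i + k)" .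
      moreover have "vabs (exp_mat n i $$ (r, u)) \<le> 1"
        using e i1 by (intro order.trans[OF e] power_le_one)
      ultimately have "vabs (exp_mat n i $$ (r, u) * (log_mat n k $$ (u, s) * z $ s ^ (q ^ k)) ^ (q ^ i)) \<le> 1 * inverse (real q) ^ (i + k)"
        unfolding vabs_mult[of "exp_mat n i $$ (r, u)"] by (intro mult_mono) auto
      thus ?thesis by simp
    qed
  next
    fix u assume u: "u < n"
    show "tau_term n (log_mat n) z u \<longlonglongrightarrow> 0"
    proof (rule vabs_comparison_tendsto_0[OF _ inverse_q_power_tendsto_0])
      fix k
      show "vabs (tau_term n (log_mat n) z u k) \<le> inverse (real q) ^ k"
        unfolding tau_term_def
      proof (rule vabs_sum_le)
        fix s assume s: "s \<in> {..<n}"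
        have "vabs (log_mat n k $$ (u, s) * z $ s ^ (q ^ k)) \<le> inverse (real q) ^ k * 1"
          unfolding vabs_mult using pw[of s] s u i1 by (intro mult_mono log_mat_bound') auto
        thus "vabs (log_mat n k $$ (u, s) * z $ s ^ (q ^ k)) \<le> inverse (real q) ^ k" by simp
      qed (use i1 in simp)
    qed
  qed simp_all
  also have "\<dots> = z"
    using z by (simp add: exp_log_mat tau_eval_const)
  finally show ?thesis using n by (simp add: Exp_C_eq)
qed


subsection \<open>The exponential of a solution\<close>

definition coord_poly :: "nat \<Rightarrow> 'c vec \<Rightarrow> 'c fps" where
  "coord_poly n z = (\<Sum>s<n. fps_const (z $ s) * (fps_X - fps_const \<theta>) ^ (n - 1 - s))"

lemma gauss_le_sum:
  "(\<And>x. x \<in> A \<Longrightarrow> gauss_le r b (f x)) \<Longrightarrow> 0 \<le> b \<Longrightarrow> 0 \<le> r \<Longrightarrow> gauss_le r b (sum f A)"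
  using gauss_le_const[of r b 0]
  by (induction A rule: infinite_finite_induct) (auto intro: gauss_le_add)

lemma coord_poly_altdef:
  "(\<Sum>k=1..n. (fps_X - fps_const \<theta>) ^ (n - k) * fps_const ((z :: 'c vec) $ (k - 1))) = coord_poly n z"
  by (simp add: coord_poly_def sum.atLeast1_atMost_eq mult.commute)

lemma coord_poly_in_Tate [simp]: "coord_poly n z \<in> Tq"
  unfolding coord_poly_def by (intro Tate_q_sum Tate_q_mult Tate_q_power Tate_q_const Tate_q_linear)

lemma taylor_coeff_coord_poly:
  assumes "r < n"
  shows "taylor_coeff (coord_poly n z) (n - 1 - r) = z $ r"
proof -
  have "taylor_coeff (coord_poly n z) (n - 1 - r) =
      (\<Sum>s<n. taylor_coeff (fps_const (z $ s) * (fps_X - fps_const \<theta>) ^ (n - 1 - s)) (n - 1 - r))"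
    unfolding coord_poly_def by (intro taylor_coeff_sum Tate_q_mult Tate_q_power Tate_q_const Tate_q_linear)
  also have "\<dots> = (\<Sum>s<n. if s = r then z $ r else 0)"
  proof (rule sum.cong[OF refl])
    fix s assume "s \<in> {..<n}"
    hence "n - 1 - r = n - 1 - s \<longleftrightarrow> s = r" using assms by auto
    thus "taylor_coeff (fps_const (z $ s) * (fps_X - fps_const \<theta>) ^ (n - 1 - s)) (n - 1 - r) = (if s = r then z $ r else 0)"
      by (simp only: taylor_coeff_cmult[OF Tate_q_power[OF Tate_q_linear]] taylor_coeff_linear_power) simp
  qed
  also have "\<dots> = z $ r" using assms by simp
  finally show ?thesis .
qed

lemma inv_sigma_add: "inv_sigma n (f + g) = inv_sigma n f + inv_sigma n g"
  by (simp add: inv_sigma_def twist_add distrib_left)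

lemma inv_sigma_cmult: "inv_sigma n (fps_const c * f) = fps_const (c ^ q) * inv_sigma n f"
  by (simp add: inv_sigma_def twist_mult mult_ac)

lemma inv_sigma_X: "inv_sigma n (fps_X * f) = fps_X * inv_sigma n f"
  by (simp add: inv_sigma_def twist_mult mult_ac)

lemma inv_sigma_sum: "inv_sigma n (\<Sum>x\<in>A. f x) = (\<Sum>x\<in>A. inv_sigma n (f x))"
  by (simp add: inv_sigma_def twist_sum sum_distrib_left)

text \<open>The twist of \<open>(t - \<theta>)^n\<close> is exactly the denominator in
  \<open>inv_sigma\<close>. Constant multiples of this series are the corrections that make
  \<open>f\<close> divisible by \<open>t\<close>.\<close>

lemma inv_sigma_linear_power: "inv_sigma n ((fps_X - fps_const \<theta>) ^ n) = 1"
proof -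
  let ?l = "fps_X - fps_const (\<theta> ^ q)"
  have "inverse ?l * ?l = 1" by (rule inverse_mult_eq_1) simp
  thus ?thesis by (simp add: inv_sigma_def twist_power twist_diff flip: power_mult_distrib)
qed

lemma inv_sigma_in_Tate:
  assumes "f \<in> Tq"
  shows "inv_sigma n f \<in> Tq"
  unfolding inv_sigma_def using Tate_q_linear_inverse[of 1] assms
  by (intro Tate_q_mult Tate_q_power Tate_q_twist) simp_all

lemma gauss_le_inv_sigma:
  assumes "gauss_le (real q) b f"
  shows "gauss_le (real q) (inverse (real q ^ q) ^ n * b ^ q) (inv_sigma n f)"
  unfolding inv_sigma_def using gauss_le_linear_inverse_theta[of 1] assms
  by (intro gauss_le_mult gauss_le_power gauss_le_twist) simp_all

lemma pi_prod_twist: "inverse (fps_X - fps_const (\<theta> ^ q)) * twist q (pi_prod i) = pi_prod (Suc i)"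
proof (induction i)
  case (Suc i)
  have "twist q (inverse (fps_X - fps_const (\<theta> ^ (q ^ Suc i)))) = inverse (fps_X - fps_const (\<theta> ^ (q ^ Suc (Suc i))))"
    by (subst twist_inverse) (simp_all add: twist_diff mult_ac flip: power_mult)
  hence "twist q (pi_prod (Suc i)) = twist q (pi_prod i) * inverse (fps_X - fps_const (\<theta> ^ (q ^ Suc (Suc i))))"
    by (simp only: pi_prod_Suc twist_mult)
  thus ?case by (simp only: mult.assoc[symmetric] Suc pi_prod_Suc[of "Suc i"])
qed (simp add: pi_prod_Suc)

lemma inv_sigma_log_col: "inv_sigma n (log_col n i s) = log_col n (Suc i) s"
proof -
  have "twist q (fps_X - fps_const (\<theta> ^ (q ^ i))) = fps_X - fps_const (\<theta> ^ (q ^ Suc i))"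
    by (simp add: twist_diff mult.commute flip: power_mult)
  hence "inv_sigma n (log_col n i s) = (fps_X - fps_const (\<theta> ^ (q ^ Suc i))) ^ (n - 1 - s) *
      (inverse (fps_X - fps_const (\<theta> ^ q)) * twist q (pi_prod i)) ^ n"
    by (simp only: inv_sigma_def log_col_def twist_mult twist_power power_mult_distrib mult_ac)
  thus ?thesis by (simp only: pi_prod_twist log_col_def)
qed

lemma funpow_inv_sigma_coord_poly:
  "(inv_sigma n ^^ i) (coord_poly n z) = (\<Sum>s<n. fps_const (z $ s ^ (q ^ i)) * log_col n i s)"
proof (induction i)
  case 0
  show ?case by (simp add: coord_poly_def log_col_def)
next
  case (Suc i)
  have "(x ^ (q ^ i)) ^ q = x ^ (q ^ Suc i)" for x :: 'c
    by (simp add: mult.commute flip: power_mult)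
  thus ?case
    by (simp only: funpow.simps o_apply Suc inv_sigma_sum inv_sigma_cmult inv_sigma_log_col)
qed

lemma taylor_coeff_funpow_inv_sigma:
  assumes "r < n"
  shows "taylor_coeff ((inv_sigma n ^^ i) (coord_poly n z)) (n - 1 - r) = tau_term n (log_mat n) z r i"
proof -
  have "taylor_coeff ((inv_sigma n ^^ i) (coord_poly n z)) (n - 1 - r) =
      (\<Sum>s<n. taylor_coeff (fps_const (z $ s ^ (q ^ i)) * log_col n i s) (n - 1 - r))"
    unfolding funpow_inv_sigma_coord_poly by (intro taylor_coeff_sum Tate_q_mult Tate_q_const log_col_in_Tate)
  also have "\<dots> = tau_term n (log_mat n) z r i"
    unfolding tau_term_def
  proof (rule sum.cong[OF refl])
    fix s assume "s \<in> {..<n}"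
    hence s: "s < n" by simp
    show "taylor_coeff (fps_const (z $ s ^ (q ^ i)) * log_col n i s) (n - 1 - r) = log_mat n i $$ (r, s) * z $ s ^ (q ^ i)"
      by (subst taylor_coeff_cmult[OF log_col_in_Tate], subst log_mat_index[OF assms s], rule mult.commute)
  qed
  finally show ?thesis .
qed

lemma funpow_inv_sigma_in_Tate: "f \<in> Tq \<Longrightarrow> (inv_sigma n ^^ k) f \<in> Tq"
  by (induction k) (simp_all add: inv_sigma_in_Tate)

lemma funpow_inv_sigma_add: "(inv_sigma n ^^ k) (f + g) = (inv_sigma n ^^ k) f + (inv_sigma n ^^ k) g"
  by (induction k) (simp_all add: inv_sigma_add)

lemma Sol_unfold:
  assumes "f \<in> Sol n Z"
  shows "f = (\<Sum>i<k. (inv_sigma n ^^ i) Z) + (inv_sigma n ^^ k) f"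
proof (induction k)
  case (Suc k)
  have "f = Z + inv_sigma n f" using assms by (auto simp: Sol_def)
  hence "(inv_sigma n ^^ k) f = (inv_sigma n ^^ k) (Z + inv_sigma n f)" by (rule arg_cong)
  also have "\<dots> = (inv_sigma n ^^ k) Z + (inv_sigma n ^^ Suc k) f"
    by (simp only: funpow_inv_sigma_add funpow_Suc_right o_apply)
  finally have "(\<Sum>i<k. (inv_sigma n ^^ i) Z) + (inv_sigma n ^^ k) f =
      (\<Sum>i<Suc k. (inv_sigma n ^^ i) Z) + (inv_sigma n ^^ Suc k) f"
    by (simp only: sum.lessThan_Suc add.assoc)
  with Suc show ?case by (rule trans)
qed simp

text \<open>
  The constant \<open>a\<close> is the fixed point of the map \<open>b \<mapsto> q^{-nq} b^q\<close> that governs the Gauss norm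
  under \<open>inv_sigma\<close>; below it the iteration contracts.
\<close>

lemma Sol_log_sums:
  assumes f: "f \<in> Sol n (coord_poly n z)" and b: "gauss_le (real q) b f" "b < a"
    and a: "a > 0" "inverse (real q ^ q) ^ n * a ^ q = a" and r: "r < n"
  shows "tau_term n (log_mat n) z r sums taylor_coeff f (n - 1 - r)"
proof -
  \<comment> \<open>Measured in units of \<open>a\<close>, each application of
    \<open>inv_sigma\<close> raises the bound to the \<open>q\<close>-th power, which produces
    \<open>\<rho>^(q^k)\<close>.\<close>
  define \<rho> where "\<rho> = b / a"
  have fT: "f \<in> Tq" using f by (simp add: Sol_def)
  have b0: "b \<ge> 0" using gauss_le_nonneg[OF b(1)] .
  have \<rho>: "0 \<le> \<rho>" "\<rho> < 1" using b0 b a by (simp_all add: \<rho>_def)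
  have gk: "gauss_le (real q) (a * \<rho> ^ (q ^ k)) ((inv_sigma n ^^ k) f)" for k
  proof (induction k)
    case 0
    show ?case using b a by (simp add: \<rho>_def)
  next
    case (Suc k)
    have "inverse (real q ^ q) ^ n * (a * \<rho> ^ (q ^ k)) ^ q = (inverse (real q ^ q) ^ n * a ^ q) * \<rho> ^ (q ^ k * q)"
      by (simp only: power_mult_distrib power_mult mult.assoc)
    also have "\<dots> = a * \<rho> ^ (q ^ Suc k)" unfolding a(2) power_Suc by (simp only: mult.commute)
    finally show ?case using gauss_le_inv_sigma[OF Suc, of n] by simp
  qed
  have lim: "(\<lambda>k. a * \<rho> ^ (q ^ k)) \<longlonglongrightarrow> 0"
  proof (rule tendsto_sandwich[OF _ _ tendsto_const])
    show "(\<lambda>k. a * \<rho> ^ k) \<longlonglongrightarrow> 0"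
      using \<rho> by (intro tendsto_mult_right_zero LIMSEQ_power_zero) simp
    show "\<forall>\<^sub>F k in sequentially. a * \<rho> ^ (q ^ k) \<le> a * \<rho> ^ k"
    proof (intro always_eventually allI mult_left_mono power_decreasing)
      fix k show "k \<le> q ^ k" using q_ge_2 by (intro less_imp_le power_gt_expt) auto
    qed (use \<rho> a in simp_all)
  qed (use \<rho> a in simp)
  have eq: "taylor_coeff f (n - 1 - r) =
      (\<Sum>i<k. tau_term n (log_mat n) z r i) + taylor_coeff ((inv_sigma n ^^ k) f) (n - 1 - r)" for k
  proof -
    have "taylor_coeff f (n - 1 - r) = taylor_coeff ((\<Sum>i<k. (inv_sigma n ^^ i) (coord_poly n z)) + (inv_sigma n ^^ k) f) (n - 1 - r)"
      by (rule arg_cong[OF Sol_unfold[OF f]])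
    also have "\<dots> = taylor_coeff (\<Sum>i<k. (inv_sigma n ^^ i) (coord_poly n z)) (n - 1 - r) + taylor_coeff ((inv_sigma n ^^ k) f) (n - 1 - r)"
      by (intro taylor_coeff_add Tate_q_sum funpow_inv_sigma_in_Tate coord_poly_in_Tate fT)
    also have "taylor_coeff (\<Sum>i<k. (inv_sigma n ^^ i) (coord_poly n z)) (n - 1 - r) = (\<Sum>i<k. tau_term n (log_mat n) z r i)"
      by (subst taylor_coeff_sum)
        (simp_all only: taylor_coeff_funpow_inv_sigma[OF r] funpow_inv_sigma_in_Tate[OF coord_poly_in_Tate])
    finally show ?thesis .
  qed
  have "(\<lambda>k. vabs ((\<Sum>i<k. tau_term n (log_mat n) z r i) - taylor_coeff f (n - 1 - r))) \<longlonglongrightarrow> 0"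
  proof (rule tendsto_sandwich[OF _ _ tendsto_const lim])
    show "\<forall>\<^sub>F k in sequentially. vabs ((\<Sum>i<k. tau_term n (log_mat n) z r i) - taylor_coeff f (n - 1 - r)) \<le> a * \<rho> ^ (q ^ k)"
    proof (intro always_eventually allI)
      fix k
      let ?t = "taylor_coeff ((inv_sigma n ^^ k) f) (n - 1 - r)"
      have "vabs ?t * 1 \<le> vabs ?t * real q ^ (n - 1 - r)"
        using q_ge_2 by (intro mult_left_mono one_le_power) auto
      also have "\<dots> \<le> a * \<rho> ^ (q ^ k)"
        by (rule taylor_coeff_bound[OF funpow_inv_sigma_in_Tate[OF fT] gk])
      also have "vabs ?t * 1 = vabs ((\<Sum>i<k. tau_term n (log_mat n) z r i) - taylor_coeff f (n - 1 - r))"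
        by (subst eq[of k]) simp
      finally show "vabs ((\<Sum>i<k. tau_term n (log_mat n) z r i) - taylor_coeff f (n - 1 - r)) \<le> a * \<rho> ^ (q ^ k)" .
    qed
  qed simp
  thus ?thesis unfolding sums_def by (subst tendsto_iff_vabs)
qed

text \<open>The descent controls \<open>f\<close> and not \<open>z\<close>; the bound on the
  coordinates of \<open>z\<close> is recovered by applying the equation to \<open>f\<close> and
  expanding at \<open>\<theta>\<close>.\<close>

lemma Exp_C_delta0_small:
  assumes n: "n \<ge> 1" and z: "z \<in> carrier_vec n" and f: "f \<in> Sol n (coord_poly n z)"
    and g: "gauss_le (real q) 1 f"
    and a: "a > 1" "inverse (real q ^ q) ^ n * a ^ q = a"
  shows "Exp_C j n (delta0 j n f) = z"
proof -
  have fT: "f \<in> Tq" using f by (simp add: Sol_def)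
  have "inverse (real q ^ q) ^ n * 1 ^ q \<le> 1"
    using q_ge_2 by (auto intro!: power_le_one simp: field_simps)
  hence "gauss_le (real q) 1 (inv_sigma n f)"
    using gauss_le_inv_sigma[OF g] gauss_le_mono by blast
  hence "gauss_le (real q) 1 (f - inv_sigma n f)" using g by (intro gauss_le_diff) simp_all
  hence gz: "gauss_le (real q) 1 (coord_poly n z)" using f by (simp add: Sol_def)
  have small: "vabs (z $ s) \<le> 1" if s: "s < n" for s
  proof -
    have "vabs (z $ s) * 1 \<le> vabs (z $ s) * real q ^ (n - 1 - s)"
      using q_ge_2 by (intro mult_left_mono one_le_power) auto
    also have "\<dots> \<le> 1"
      using taylor_coeff_bound[OF coord_poly_in_Tate gz, of "n - 1 - s"]
      unfolding taylor_coeff_coord_poly[OF s] .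
    finally show ?thesis by simp
  qed
  have "tau_eval q n (log_mat n) z = delta0 j n f"
  proof (rule tau_eval_eqI[OF log_mat_in_tau_series z])
    fix r assume r: "r < n"
    have "tau_term n (log_mat n) z r sums taylor_coeff f (n - 1 - r)"
      by (rule Sol_log_sums[OF f g _ _ a(2) r]) (use a in simp_all)
    thus "tau_term n (log_mat n) z r sums (delta0 j n f $ r)" using r by (simp add: delta0_eq[OF fT])
  qed (simp add: delta0_def)
  thus ?thesis using Exp_C_log_mat[OF n z small] by simp
qed

section \<open>Division of a solution by \<open>t\<close>\<close>

lemma coord_poly_X:
  assumes n: "n \<ge> 1"
  shows "fps_X * coord_poly n w + fps_const (w $ 0 ^ q) =
    coord_poly n (phi_act n w) + fps_const (w $ 0) * (fps_X - fps_const \<theta>) ^ n"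
proof -
  let ?l = "fps_X - fps_const \<theta>"
  obtain m where m: "n = Suc m" using n by (cases n) auto
  \<comment> \<open>\<open>t = \<theta> + (t - \<theta>)\<close>: the first sum gives the diagonal
    of the action, the second shifts the coordinates. Its leading term overflows to degree
    \<open>n\<close> and stays apart, while the constant \<open>w $ 0 ^ q\<close> supplies the
    Frobenius part in the last coordinate.\<close>
  have 1: "fps_X * coord_poly n w = (\<Sum>s<n. fps_const (\<theta> * w $ s) * ?l ^ (m - s)) + (\<Sum>s<n. fps_const (w $ s) * ?l ^ (n - s))"
  proof -
    have step: "fps_X * (fps_const (w $ s) * ?l ^ (m - s)) =
        fps_const (\<theta> * w $ s) * ?l ^ (m - s) + fps_const (w $ s) * ?l ^ (n - s)" if "s < n" for s
    proof -
      have "?l ^ (n - s) = ?l * ?l ^ (m - s)" using that by (simp add: m Suc_diff_le)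
      moreover have "fps_const (\<theta> * w $ s) = fps_const \<theta> * fps_const (w $ s)" by simp
      ultimately show ?thesis by (simp only:) (simp add: algebra_simps)
    qed
    have "fps_X * coord_poly n w = (\<Sum>s<n. fps_X * (fps_const (w $ s) * ?l ^ (m - s)))"
      by (simp only: coord_poly_def sum_distrib_left m diff_Suc_1)
    also have "\<dots> = (\<Sum>s<n. fps_const (\<theta> * w $ s) * ?l ^ (m - s) + fps_const (w $ s) * ?l ^ (n - s))"
      by (rule sum.cong[OF refl step]) simp
    finally show ?thesis by (simp only: sum.distrib)
  qed
  have 2: "(\<Sum>s<n. fps_const (w $ s) * ?l ^ (n - s)) =
      fps_const (w $ 0) * ?l ^ n + (\<Sum>s<n. fps_const (if s + 1 < n then w $ (s + 1) else 0) * ?l ^ (m - s))"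
  proof -
    have "(\<Sum>s<n. fps_const (w $ s) * ?l ^ (n - s)) =
       fps_const (w $ 0) * ?l ^ n + (\<Sum>s<m. fps_const (w $ Suc s) * ?l ^ (m - s))"
      unfolding m sum.lessThan_Suc_shift by simp
    also have "(\<Sum>s<m. fps_const (w $ Suc s) * ?l ^ (m - s)) =
        (\<Sum>s<n. fps_const (if s + 1 < n then w $ (s + 1) else 0) * ?l ^ (m - s))"
      unfolding m by simp
    finally show ?thesis .
  qed
  have 3: "fps_const (w $ 0 ^ q) = (\<Sum>s<n. fps_const (if s = n - 1 then w $ 0 ^ q else 0) * ?l ^ (m - s))"
    unfolding m by simp
  have "coord_poly n (phi_act n w) = (\<Sum>s<n. fps_const (\<theta> * w $ s) * ?l ^ (m - s)) +
      (\<Sum>s<n. fps_const (if s + 1 < n then w $ (s + 1) else 0) * ?l ^ (m - s)) +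
      (\<Sum>s<n. fps_const (if s = n - 1 then w $ 0 ^ q else 0) * ?l ^ (m - s))"
  proof -
    have "fps_const (phi_act n w $ s) * ?l ^ (n - 1 - s) = fps_const (\<theta> * w $ s) * ?l ^ (m - s) +
        fps_const (if s + 1 < n then w $ (s + 1) else 0) * ?l ^ (m - s) +
        fps_const (if s = n - 1 then w $ 0 ^ q else 0) * ?l ^ (m - s)" if "s < n" for s
    proof -
      have "fps_const (phi_act n w $ s) = fps_const (\<theta> * w $ s) +
        fps_const (if s + 1 < n then w $ (s + 1) else 0) + fps_const (if s = n - 1 then w $ 0 ^ q else 0)"
        using that unfolding phi_act_def fps_const_add by simp
      moreover have "n - 1 - s = m - s" by (simp add: m)
      ultimately show ?thesis by (simp only: distrib_right)
    qed
    thus ?thesis unfolding coord_poly_def sum.distrib[symmetric] by (intro sum.cong) simp_all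
  qed
  thus ?thesis unfolding 1 2 3 by (simp only: add_ac)
qed

lemma coord_poly_eq_up_to_last:
  fixes x y :: "'c vec"
  assumes "n \<ge> 1" "\<And>r. r + 1 < n \<Longrightarrow> x $ r = y $ r"
  shows "coord_poly n x = coord_poly n y + fps_const (x $ (n - 1) - y $ (n - 1))"
proof -
  obtain m where m: "n = Suc m" using assms(1) by (cases n) auto
  have "(\<Sum>s<m. fps_const (x $ s) * (fps_X - fps_const \<theta>) ^ (n - 1 - s)) =
        (\<Sum>s<m. fps_const (y $ s) * (fps_X - fps_const \<theta>) ^ (n - 1 - s))"
    using assms(2) by (intro sum.cong) (simp_all add: m)
  hence "coord_poly n x - fps_const (x $ m) = coord_poly n y - fps_const (y $ m)"
    by (simp add: coord_poly_def m)
  moreover have "n - 1 = m" by (simp add: m)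
  ultimately show ?thesis
    by (simp only: fps_const_sub[symmetric] diff_eq_eq add_diff_eq diff_add_eq add_diff_cancel_right')
qed

text \<open>One descent step: the coordinates of \<open>w\<close> are forced by \<open>w $ 0\<close>
  and all but the last equation of \<open>phi_act n w = z\<close>; divisibility by \<open>t\<close>
  then supplies the last equation.\<close>

lemma Sol_divide:
  assumes n: "n \<ge> 1" and z: "z \<in> carrier_vec n" and f: "f \<in> Sol n (coord_poly n z)"
    and b: "gauss_le (real q) b f"
  obtains w g where "w \<in> carrier_vec n" "g \<in> Sol n (coord_poly n w)" "gauss_le (real q) (b / real q) g"
    "phi_act n w = z" "delta0 j n f = d_theta j n *\<^sub>v delta0 j n g"
proof -
  let ?l = "fps_X - fps_const \<theta>"
  have fT: "f \<in> Tq" using f by (simp add: Sol_def)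
  \<comment> \<open>Chosen so that \<open>w0 (t - \<theta>)^n = - f(0) (1 - t/\<theta>)^n\<close>,
    which cancels the constant term of \<open>f\<close>. The same number is the overflow term in
    \<open>coord_poly_X\<close>, hence the first coordinate of \<open>w\<close>.\<close>
  define w0 where "w0 = - fps_nth f 0 / (- \<theta>) ^ n"
  define h where "h = f + fps_const w0 * ?l ^ n"
  define g where "g = fps_shift 1 h"
  have h0: "fps_nth h 0 = 0" by (simp add: h_def w0_def fps_power_zeroth)
  have Xg: "fps_X * g = h"
  proof (rule fps_ext)
    fix k show "fps_nth (fps_X * g) k = fps_nth h k" by (cases k) (simp_all add: g_def h0)
  qed
  have hT: "h \<in> Tq" unfolding h_def by (intro Tate_q_add Tate_q_mult Tate_q_power Tate_q_const Tate_q_linear fT)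
  have g_nth: "vabs (fps_nth g i) * real q ^ i = vabs (fps_nth h (Suc i)) * real q ^ Suc i / real q" for i
    by (simp add: g_def)
  have gT: "g \<in> Tq"
    unfolding Tate_q_iff g_nth
    using tendsto_divide[OF LIMSEQ_Suc[OF hT[unfolded Tate_q_iff]] tendsto_const[of "real q"]] by simp
  \<comment> \<open>On the disc of radius \<open>q = vabs \<theta>\<close> the correction has norm
    at most that of \<open>f\<close>, since \<open>q^n\<close> cancels. The factor \<open>q\<close>
    is gained afterwards, by dividing by \<open>t\<close>.\<close>
  have hb: "gauss_le (real q) b h"
  proof -
    have "vabs w0 = vabs (fps_nth f 0) / real q ^ n"
      by (simp add: w0_def vabs_divide vabs_power vabs_theta)
    moreover have "vabs (fps_nth f 0) \<le> b" using gauss_leD[OF b, of 0] by simp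
    ultimately have w0: "vabs w0 \<le> b / real q ^ n" by (simp add: divide_right_mono)
    have "gauss_le (real q) (real q) ?l"
      by (intro gauss_le_diff gauss_le_X) (simp_all add: vabs_theta)
    hence "gauss_le (real q) (b / real q ^ n * real q ^ n) (fps_const w0 * ?l ^ n)"
      using w0 by (intro gauss_le_mult gauss_le_power) simp_all
    hence "gauss_le (real q) b (fps_const w0 * ?l ^ n)" by simp
    thus ?thesis unfolding h_def by (intro gauss_le_add b) simp_all
  qed
  have gb: "gauss_le (real q) (b / real q) g"
    unfolding gauss_le_def g_nth by (intro allI divide_right_mono gauss_leD hb) simp
  \<comment> \<open>All but the last coordinate of \<open>phi_act n w = z\<close> form a triangular
    system: row \<open>s\<close> determines \<open>w $ Suc s\<close> from
    \<open>w $ s\<close>.\<close>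
  define wf where "wf = rec_nat w0 (\<lambda>s x. z $ s - \<theta> * x)"
  define w where "w = vec n wf"
  have w_0: "w $ 0 = w0" using n by (simp add: w_def wf_def)
  have w_Suc: "w $ Suc s = z $ s - \<theta> * w $ s" if "Suc s < n" for s
    using that by (simp add: w_def wf_def)
  have phi: "phi_act n w $ r = z $ r" if "r + 1 < n" for r
    using that w_Suc[of r] by (simp add: phi_act_def)
  define e where "e = z $ (n - 1) - phi_act n w $ (n - 1)"
  have cz: "coord_poly n z = coord_poly n (phi_act n w) + fps_const e"
    unfolding e_def by (rule coord_poly_eq_up_to_last[OF n]) (simp add: phi)
  have "inv_sigma n (fps_const w0 * ?l ^ n) = fps_const (w0 ^ q)"
    by (simp only: inv_sigma_cmult inv_sigma_linear_power mult_1_right)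
  hence "h - inv_sigma n h = (f - inv_sigma n f) + fps_const w0 * ?l ^ n - fps_const (w0 ^ q)"
    unfolding h_def inv_sigma_add by (simp only: algebra_simps)
  also have "f - inv_sigma n f = coord_poly n z" using f by (simp add: Sol_def)
  finally have hs: "h - inv_sigma n h = coord_poly n (phi_act n w) + fps_const w0 * ?l ^ n - fps_const (w0 ^ q) + fps_const e"
    unfolding cz by (simp only: algebra_simps)
  have "fps_X * coord_poly n w = coord_poly n (phi_act n w) + fps_const w0 * ?l ^ n - fps_const (w0 ^ q)"
    using coord_poly_X[OF n, of w] unfolding w_0 by (simp only: eq_diff_eq)
  with hs have hw: "h - inv_sigma n h = fps_X * coord_poly n w + fps_const e" by simp
  have Xs: "fps_X * (g - inv_sigma n g) = h - inv_sigma n h"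
    by (simp only: right_diff_distrib Xg flip: inv_sigma_X)
  \<comment> \<open>\<open>e\<close> is the defect in the last coordinate and enters as a constant.
    Everything else in the identity is divisible by \<open>t\<close>, so comparing constant terms
    gives \<open>e = 0\<close>.\<close>
  have "fps_nth (fps_X * (g - inv_sigma n g)) 0 = fps_nth (fps_X * coord_poly n w + fps_const e) 0"
    by (simp only: Xs hw)
  hence e0: "e = 0" by simp
  have "fps_X * (g - inv_sigma n g) = fps_X * coord_poly n w" using Xs hw by (simp add: e0)
  hence gw: "g - inv_sigma n g = coord_poly n w" by (metis mult_left_cancel fps_X_neq_zero)
  show ?thesis
  proof (rule that)
    show "w \<in> carrier_vec n" by (simp add: w_def)
    show "g \<in> Sol n (coord_poly n w)" using gw gT by (simp add: Sol_def)
    show "gauss_le (real q) (b / real q) g" by (rule gb)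
    show "phi_act n w = z"
    proof (rule eq_vecI)
      fix r assume "r < dim_vec z"
      hence r: "r < n" using z by simp
      show "phi_act n w $ r = z $ r"
      proof (cases "r + 1 < n")
        case False
        hence "r = n - 1" using r by simp
        thus ?thesis using e0 by (simp add: e_def)
      qed (rule phi)
    qed (use z in \<open>simp add: phi_act_def\<close>)
    show "delta0 j n f = d_theta j n *\<^sub>v delta0 j n g"
    proof (rule eq_vecI)
      fix r assume "r < dim_vec (d_theta j n *\<^sub>v delta0 j n g)"
      hence r: "r < n" by (simp add: d_theta_def N_mat_def)
      \<comment> \<open>The subtracted multiple of \<open>(t - \<theta>)^n\<close> has no
        coefficient of order below \<open>n\<close> at \<open>\<theta>\<close>; only the action of
        \<open>t\<close> on the expansion of \<open>g\<close> remains.\<close>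
      have "f = fps_X * g - fps_const w0 * ?l ^ n" unfolding Xg h_def by simp
      hence "taylor_coeff f (n - 1 - r) = taylor_coeff (fps_X * g) (n - 1 - r) - taylor_coeff (fps_const w0 * ?l ^ n) (n - 1 - r)"
        by (simp only:) (intro taylor_coeff_diff Tate_q_mult Tate_q_power Tate_q_const Tate_q_linear Tate_q_X gT)
      also have "taylor_coeff (fps_const w0 * ?l ^ n) (n - 1 - r) = 0"
        using r by (simp only: taylor_coeff_cmult[OF Tate_q_power[OF Tate_q_linear]] taylor_coeff_linear_power) simp
      also have "taylor_coeff (fps_X * g) (n - 1 - r) - 0 =
          \<theta> * delta0 j n g $ r + (if r + 1 < n then delta0 j n g $ (r + 1) else 0)"
        using r by (subst taylor_coeff_X[OF gT]) (auto simp: delta0_eq[OF gT])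
      also have "\<dots> = (\<Sum>u<n. d_theta j n $$ (r, u) * delta0 j n g $ u)"
        by (rule sum_d_theta_left[OF r, symmetric])
      also have "\<dots> = (d_theta j n *\<^sub>v delta0 j n g) $ r"
        using r carrier_matD[OF d_theta_carrier[of n]]
        by (auto simp: scalar_prod_def atLeast0LessThan delta0_def intro!: sum.cong)
      finally show "delta0 j n f $ r = (d_theta j n *\<^sub>v delta0 j n g) $ r"
        using r by (simp add: delta0_eq[OF fT])
    qed (simp add: delta0_def d_theta_def N_mat_def)
  qed
qed

text \<open>\<open>m\<close> counts the divisions by \<open>t\<close> that bring the Gauss norm down
  to 1.\<close>

lemma Exp_C_delta0_bounded:
  assumes n: "n \<ge> 1" and a: "a > 1" "inverse (real q ^ q) ^ n * a ^ q = a"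
    and "z \<in> carrier_vec n" "f \<in> Sol n (coord_poly n z)" "gauss_le (real q) (real q ^ m) f"
  shows "Exp_C j n (delta0 j n f) = z"
  using assms(4-)
proof (induction m arbitrary: z f)
  case 0
  show ?case by (rule Exp_C_delta0_small[OF n 0(1,2) _ a]) (use 0 in simp)
next
  case (Suc m)
  obtain w g where wg: "w \<in> carrier_vec n" "g \<in> Sol n (coord_poly n w)"
    "gauss_le (real q) (real q ^ Suc m / real q) g"
    "phi_act n w = z" "delta0 j n f = d_theta j n *\<^sub>v delta0 j n g"
    by (rule Sol_divide[OF n Suc.prems])
  have "Exp_C j n (delta0 j n g) = w" using wg by (intro Suc.IH) simp_all
  moreover have "delta0 j n g \<in> carrier_vec n" by (simp add: delta0_def)
  ultimately show ?case using Exp_C_d_theta[OF n] wg(4,5) by simp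
qed

lemma Exp_C_delta0:
  assumes n: "n \<ge> 1" and a: "a > 1" "inverse (real q ^ q) ^ n * a ^ q = a"
    and z: "z \<in> carrier_vec n" and f: "f \<in> Sol n (coord_poly n z)"
  shows "Exp_C j n (delta0 j n f) = z"
proof -
  obtain b where b: "gauss_le (real q) b f"
    using f Tate_q_imp_gauss_le[of f] by (auto simp: Sol_def)
  obtain m where "b < real q ^ m" using real_arch_pow[of "real q" b] q_ge_2 by auto
  hence "gauss_le (real q) (real q ^ m) f" using b by (auto intro: gauss_le_mono)
  thus ?thesis by (rule Exp_C_delta0_bounded[OF n a z f])
qed

text \<open>By additivity the cosets of the kernel are the fibres of the exponential, so statements
  about the quotient become statements about values of \<open>Exp_C\<close>.\<close>

lemma coset_Lambda:
  assumes n: "n \<ge> 1" and x: "x \<in> carrier_vec n"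
  shows "x +o Lambda j n = {y \<in> carrier_vec n. Exp_C j n y = Exp_C j n x}"
proof (intro equalityI subsetI)
  fix y assume "y \<in> x +o Lambda j n"
  then obtain l where l: "y = x + l" "l \<in> carrier_vec n" "Exp_C j n l = 0\<^sub>v n"
    by (auto simp: elt_set_plus_def Lambda_def)
  have "Exp_C j n y = Exp_C j n x + 0\<^sub>v n" using Exp_C_add[OF n x l(2)] by (simp only: l)
  thus "y \<in> {y \<in> carrier_vec n. Exp_C j n y = Exp_C j n x}"
    using x l right_zero_vec[OF Exp_C_carrier[of n x]] by (simp add: add_carrier_vec)
next
  fix y assume "y \<in> {y \<in> carrier_vec n. Exp_C j n y = Exp_C j n x}"
  hence y: "y \<in> carrier_vec n" "Exp_C j n y = Exp_C j n x" by auto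
  have d: "y - x \<in> carrier_vec n" using x y by simp
  have yx: "y = x + (y - x)" using x y by (intro eq_vecI) auto
  have "Exp_C j n x = Exp_C j n x + Exp_C j n (y - x)"
    using Exp_C_add[OF n x d] y(2) by (simp only: yx[symmetric])
  hence "Exp_C j n x $ i = Exp_C j n x $ i + Exp_C j n (y - x) $ i" if "i < n" for i
    using that carrier_vecD[OF Exp_C_carrier[of n "y - x"]] by (metis index_add_vec(1))
  hence "Exp_C j n (y - x) = 0\<^sub>v n"
    using carrier_vecD[OF Exp_C_carrier[of n "y - x"]] by (intro eq_vecI) simp_all
  thus "y \<in> x +o Lambda j n"
    using yx d unfolding elt_set_plus_def Lambda_def by blast
qed

lemma Exp_n_coset:
  assumes n: "n \<ge> 1" and x: "x \<in> carrier_vec n"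
  shows "Exp_n j n (x +o Lambda j n) = Exp_C j n x"
proof -
  have "Exp_C j n ` (x +o Lambda j n) = {Exp_C j n x}"
    unfolding coset_Lambda[OF assms] using x by auto
  thus ?thesis by (simp add: Exp_n_def)
qed

section \<open>The critical radius and the two logarithms\<close>

context
  fixes \<eta> :: 'c
  assumes root: "\<eta> ^ (q - 1) = - \<theta>"
begin

lemma vabs_root_power: "vabs \<eta> ^ (q - 1) = real q"
  using arg_cong[OF root, of vabs] by (simp only: vabs_power vabs_minus vabs_theta)

lemma vabs_root_gt_1: "vabs \<eta> > 1"
proof (rule ccontr)
  assume "\<not> vabs \<eta> > 1"
  hence "vabs \<eta> ^ (q - 1) \<le> 1" by (intro power_le_one) auto
  thus False using vabs_root_power q_ge_2 by simp
qed

lemma radius_gt_1: "n \<ge> 1 \<Longrightarrow> (vabs \<eta> ^ q) ^ n > 1"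
  using vabs_root_gt_1 by (auto intro!: one_less_power)

text \<open>From \<open>vabs \<eta> ^ (q - 1) = q\<close> one gets
  \<open>vabs \<eta> ^ q = q * vabs \<eta>\<close>; its \<open>q\<close>-th power cancels the factor
  \<open>q^(-q)\<close>, and the \<open>n\<close>-th power follows.\<close>

lemma radius_fixed_point:
  "inverse (real q ^ q) ^ n * ((vabs \<eta> ^ q) ^ n) ^ q = (vabs \<eta> ^ q) ^ n"
proof -
  have "vabs \<eta> * vabs \<eta> ^ (q - 1) = vabs \<eta> ^ q" by (metis power_eq_if q_neq_0)
  hence "vabs \<eta> ^ q = vabs \<eta> * real q" by (simp only: vabs_root_power)
  hence "(vabs \<eta> ^ q) ^ q = vabs \<eta> ^ q * real q ^ q" by (simp only: power_mult_distrib)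
  hence "inverse (real q ^ q) * (vabs \<eta> ^ q) ^ q = vabs \<eta> ^ q" by simp
  moreover have "inverse (real q ^ q) ^ n * ((vabs \<eta> ^ q) ^ n) ^ q = (inverse (real q ^ q) * (vabs \<eta> ^ q) ^ q) ^ n"
    by (simp only: power_mult_distrib power_mult[symmetric] mult.assoc mult.commute[of n q])
  ultimately show ?thesis by simp
qed

text \<open>Identifies the norm of \<open>\<Omega>^(-n)\<close> with the power of \<open>q\<close>
  that bounds the convergence region of the logarithm.\<close>

lemma radius_powr: "(vabs \<eta> ^ q) ^ n = real q powr (real n * real q / (real q - 1))"
proof -
  have pos: "vabs \<eta> > 0" using vabs_root_gt_1 by linarith
  have "real q powr (real n * real q / (real q - 1)) = (vabs \<eta> powr real (q - 1)) powr (real n * real q / (real q - 1))"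
    using pos vabs_root_power by (simp add: powr_realpow)
  also have "\<dots> = vabs \<eta> powr (real (q - 1) * (real n * real q / (real q - 1)))" by (rule powr_powr)
  also have "real (q - 1) * (real n * real q / (real q - 1)) = real (q * n)"
    using q_ge_2 by (simp add: of_nat_diff field_simps)
  also have "vabs \<eta> powr real (q * n) = vabs \<eta> ^ (q * n)" using pos by (rule powr_realpow)
  finally show ?thesis by (simp add: power_mult)
qed

text \<open>Every solution expands to a point of the same fibre, and that fibre is a single coset,
  so the value does not depend on the representative.\<close>

lemma Log_n_eq:
  assumes n: "n \<ge> 1" and z: "z \<in> carrier_vec n"
  shows "Log_n j \<eta> n z = {x \<in> carrier_vec n. Exp_C j n x = z}"
proof -
  have c: "delta0 j n f +o Lambda j n = {x \<in> carrier_vec n. Exp_C j n x = z}" if "f \<in> Sol n (coord_poly n z)" for f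
    using Exp_C_delta0[OF n radius_gt_1[OF n] radius_fixed_point z that]
    by (subst coset_Lambda[OF n]) (simp_all add: delta0_def)
  have "(\<lambda>f. delta0 j n f +o Lambda j n) ` Sol n (coord_poly n z) =
      (\<lambda>_. {x \<in> carrier_vec n. Exp_C j n x = z}) ` Sol n (coord_poly n z)"
    by (rule image_cong[OF refl c])
  also have "\<dots> = {{x \<in> carrier_vec n. Exp_C j n x = z}}"
    using Sol_nonempty[OF root coord_poly_in_Tate, of n n z] by blast
  finally have "(\<lambda>f. delta0 j n f +o Lambda j n) ` Sol n (coord_poly n z) = {{x \<in> carrier_vec n. Exp_C j n x = z}}" .
  thus ?thesis
    unfolding Log_n_def coord_poly_altdef Li_eq_Sol[OF root coord_poly_in_Tate] by simp
qed

lemma Exp_C_surj: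
  assumes n: "n \<ge> 1" and z: "z \<in> carrier_vec n"
  obtains x where "x \<in> carrier_vec n" "Exp_C j n x = z"
proof -
  obtain f where f: "f \<in> Sol n (coord_poly n z)" using Sol_nonempty[OF root coord_poly_in_Tate, of n n z] by blast
  show ?thesis
    by (rule that[OF _ Exp_C_delta0[OF n radius_gt_1[OF n] radius_fixed_point z f]]) (simp add: delta0_def)
qed

text \<open>Multiplied by \<open>q^(n-i)\<close>, the condition on \<open>z_i\<close> reads
  \<open>vabs z_i * q^(n-i) < vabs \<eta> ^ (q n)\<close>: it bounds the summands of
  \<open>coord_poly n z\<close> in Gauss norm, which gives a small solution whose expansion is the
  value of the logarithm.\<close>

lemma Exp_C_Log_C:
  fixes z :: "'c vec"
  assumes n: "n \<ge> 1" and z: "z \<in> carrier_vec n"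
    and small: "\<And>i. i \<in> {1..n} \<Longrightarrow> vabs (z $ (i - 1)) <
      real q powr (real i - real n + real n * real q / (real q - 1))"
  shows "Log_C j n z \<in> carrier_vec n" "Exp_C j n (Log_C j n z) = z"
proof -
  let ?a = "(vabs \<eta> ^ q) ^ n"
  \<comment> \<open>A maximum over finitely many coordinates, so the strict inequalities yield one
    \<open>b\<close> strictly below the critical radius. With \<open>s = i - 1\<close> the exponent
    \<open>n - i\<close> becomes \<open>n - 1 - s\<close>.\<close>
  define b where "b = Max ((\<lambda>s. vabs (z $ s) * real q ^ (n - 1 - s)) ` {..<n})"
  have fin: "finite ((\<lambda>s. vabs (z $ s) * real q ^ (n - 1 - s)) ` {..<n})"
    "(\<lambda>s. vabs (z $ s) * real q ^ (n - 1 - s)) ` {..<n} \<noteq> {}" using n by (auto simp: lessThan_empty_iff)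
  have le: "vabs (z $ s) * real q ^ (n - 1 - s) \<le> b" if "s < n" for s
    unfolding b_def using that fin by (intro Max_ge) auto
  have b0: "b \<ge> 0" using le[of 0] n by (auto intro: order.trans[rotated])
  have lt: "vabs (z $ s) * real q ^ (n - 1 - s) < ?a" if s: "s < n" for s
  proof -
    have "vabs (z $ s) < real q powr (real (s + 1) - real n + real n * real q / (real q - 1))"
      using small[of "s + 1"] s by simp
    also have "real (s + 1) - real n = - real (n - 1 - s)" using s by (simp add: of_nat_diff)
    also have "real q powr (- real (n - 1 - s) + real n * real q / (real q - 1)) =
        real q powr (- real (n - 1 - s)) * ?a"
      by (simp only: powr_add radius_powr)
    also have "real q powr (- real (n - 1 - s)) = inverse (real q ^ (n - 1 - s))"
      by (simp add: powr_minus powr_realpow del: of_nat_diff)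
    finally show ?thesis by (simp add: field_simps)
  qed
  have "b \<in> (\<lambda>s. vabs (z $ s) * real q ^ (n - 1 - s)) ` {..<n}"
    unfolding b_def using fin by (intro Max_in)
  hence ba: "b < ?a" using lt by auto
  have "gauss_le (real q) b (coord_poly n z)"
    unfolding coord_poly_def
  proof (rule gauss_le_sum)
    fix s assume "s \<in> {..<n}"
    hence "vabs (z $ s) * real q ^ (n - 1 - s) \<le> b" using le by simp
    moreover have "gauss_le (real q) (real q) (fps_X - fps_const \<theta>)"
      by (intro gauss_le_diff gauss_le_X) (simp_all add: vabs_theta)
    hence "gauss_le (real q) (vabs (z $ s) * real q ^ (n - 1 - s)) (fps_const (z $ s) * (fps_X - fps_const \<theta>) ^ (n - 1 - s))"
      by (intro gauss_le_mult gauss_le_power) simp_all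
    ultimately show "gauss_le (real q) b (fps_const (z $ s) * (fps_X - fps_const \<theta>) ^ (n - 1 - s))"
      by (rule gauss_le_mono[rotated])
  qed (use b0 in simp_all)
  then obtain f where f: "f \<in> Sol n (coord_poly n z)" "gauss_le (real q) b f"
    using Sol_small[OF root coord_poly_in_Tate _ ba] by blast
  have fT: "f \<in> Tq" using f by (simp add: Sol_def)
  have a0: "?a > 0" using radius_gt_1[OF n] by linarith
  have "Log_C j n z = delta0 j n f"
    unfolding Log_C_def Log_series_eq[OF n]
  proof (rule tau_eval_eqI[OF log_mat_in_tau_series z])
    fix r assume r: "r < n"
    show "tau_term n (log_mat n) z r sums (delta0 j n f $ r)"
      using Sol_log_sums[OF f ba a0 radius_fixed_point r] r by (simp add: delta0_eq[OF fT])
  qed (simp add: delta0_def)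
  thus "Log_C j n z \<in> carrier_vec n" "Exp_C j n (Log_C j n z) = z"
    using Exp_C_delta0[OF n radius_gt_1[OF n] radius_fixed_point z f(1)] by (simp_all add: delta0_def)
qed

end

end

theorem theorem2p3:
  fixes j :: "'f::{finite,field} fls alg_closure \<Rightarrow> 'c::{field,complete_space}"
    and \<eta> :: 'c and n :: nat
  assumes "C_infinity j"
    and "\<eta> ^ (qcard j - 1) = - theta j"
    and "n \<ge> 1"
  shows "(\<forall>z \<in> carrier_vec n.
            (\<forall>i \<in> {1..n}. vabs (z $ (i - 1)) <
               vabs (theta j) powr
                 (real i - real n + real n * real (qcard j) / (real (qcard j) - 1))) \<longrightarrow>
            Log_C j n z +o Lambda j n = Log_n j \<eta> n z) \<and>
         Exp_n j n \<in> quot_Lambda j n \<rightarrow> carrier_vec n \<and>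
         Log_n j \<eta> n \<in> carrier_vec n \<rightarrow> quot_Lambda j n \<and>
         (\<forall>z \<in> carrier_vec n. Exp_n j n (Log_n j \<eta> n z) = z) \<and>
         (\<forall>C \<in> quot_Lambda j n. Log_n j \<eta> n (Exp_n j n C) = C)"
proof -
  interpret C_infinity j by fact
  note n = assms(3) and root = assms(2)
  \<comment> \<open>A fibre of the exponential is a coset only when it is nonempty; surjectivity
    provides the base point \<open>x\<close>.\<close>
  have coset: "\<exists>x\<in>carrier_vec n. Exp_C j n x = z \<and> Log_n j \<eta> n z = x +o Lambda j n"
    if z: "z \<in> carrier_vec n" for z
  proof -
    obtain x where x: "x \<in> carrier_vec n" "Exp_C j n x = z" by (rule Exp_C_surj[OF root n z])
    have "Log_n j \<eta> n z = x +o Lambda j n"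
      unfolding Log_n_eq[OF root n z] coset_Lambda[OF n x(1)] x(2) ..
    thus ?thesis using x by blast
  qed
  show ?thesis
  proof (intro conjI ballI impI)
    fix z :: "'c vec"
    assume z: "z \<in> carrier_vec n"
      and small: "\<forall>i \<in> {1..n}. vabs (z $ (i - 1)) <
        vabs (theta j) powr (real i - real n + real n * real (qcard j) / (real (qcard j) - 1))"
    have L: "Log_C j n z \<in> carrier_vec n" "Exp_C j n (Log_C j n z) = z"
      by (rule Exp_C_Log_C[OF root n z]; use small in \<open>simp add: vabs_theta\<close>)+
    show "Log_C j n z +o Lambda j n = Log_n j \<eta> n z"
      by (simp only: coset_Lambda[OF n L(1)] Log_n_eq[OF root n z] L(2))
  next
    show "Exp_n j n \<in> quot_Lambda j n \<rightarrow> carrier_vec n"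
      by (auto simp: quot_Lambda_def Exp_n_coset[OF n])
    show "Log_n j \<eta> n \<in> carrier_vec n \<rightarrow> quot_Lambda j n"
      using coset by (fastforce simp: quot_Lambda_def)
  next
    fix z :: "'c vec" assume "z \<in> carrier_vec n"
    with coset show "Exp_n j n (Log_n j \<eta> n z) = z"
      using Exp_n_coset[OF n] by fastforce
  next
    fix C assume "C \<in> quot_Lambda j n"
    then obtain x where x: "x \<in> carrier_vec n" "C = x +o Lambda j n" by (auto simp: quot_Lambda_def)
    have "Exp_n j n C = Exp_C j n x" by (simp only: x(2) Exp_n_coset[OF n x(1)])
    hence "Log_n j \<eta> n (Exp_n j n C) = Log_n j \<eta> n (Exp_C j n x)" by simp
    also have "\<dots> = C" by (simp only: Log_n_eq[OF root n Exp_C_carrier] coset_Lambda[OF n x(1)] x(2))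
    finally show "Log_n j \<eta> n (Exp_n j n C) = C" .
  qed
qed

end
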